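(* Let $G=\Delta(p,q,r)=\langle x,y\mid x^p=y^q=(xy)^r=1\rangle$ be a triangle group with $p$ prime and $p\le q\le r$. Let $\pi:G\to\mathcal S(\Omega)$ be a transitive permutation representation of degree $n>6$, $\Omega=\{1,\dots,n\}$, with $\pi(G)\cong\mathcal A_n$, and with disjoint $t$-handles $[a,b]_t$ and $[c,d]_t$ for some $t$. Let $m\ge5$ be an integer with $m\ne n-1$, and let $\alpha=\alpha_1\cdots\alpha_k$ and $\beta=\beta_1\cdots\beta_l$ be two permutations, both products of disjoint $p$-cycles (the $\alpha_i$ and $\beta_j$ respectively), that generate a transitive subgroup of $\mathcal S_m$ with $\langle\alpha,\beta\rangle\cong\mathcal A_m$. For $i=1,\dots,m$ let $\pi_i$ be the copy of $\pi$ on $\{(i-1)n+1,\dots,in\}$, given by $((i-1)n+\omega)^{\pi_i(g)}=(i-1)n+\omega^{\pi(g)}$, and let $a_i,b_i,c_i,d_i$ be the copies $(i-1)n+a$, $(i-1)n+b$, $(i-1)n+c$, $(i-1)n+d$ of $a,b,c,d$. For each cycle $\alpha_i=(i_1,\dots,i_p)$ of $\alpha$ let $\gamma_i=(a_{i_1},\dots,a_{i_p})(b_{i_p},\dots,b_{i_1})$, and for each cycle $\beta_j=(j_1,\dots,j_p)$ of $\beta$ let $\delta_j=(c_{j_1},\dots,c_{j_p})(d_{j_p},\dots,d_{j_1})$. Let $\phi$ be the permutation representation of $G$ on $\{1,\dots,mn\}$ with $$\phi(x)=\pi_1(x)\pi_2(x)\cdots\pi_m(x)\,\gamma_1\cdots\gamma_k\,\delta_1\cdots\delta_l,\qquad\phi(y)=\pi_1(y)\pi_2(y)\cdots\pi_m(y),$$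 and let $H=\phi(G)$. Then $H\cong\mathcal A_m\wr\mathcal A_n$.
   Context: $\mathcal S(X)$ is the group of all permutations of a set $X$, $\mathcal S_m=\mathcal S(\{1,\dots,m\})$, and $\mathcal A_n$ is the alternating group of degree $n$. Permutations act on the right, $\omega^g$ is the image of $\omega$ under $g$, and products are composed left to right. Each $\pi_i(g)$ is regarded as a permutation of $\{1,\dots,mn\}$ fixing all points outside $\{(i-1)n+1,\dots,in\}$. For a permutation representation $\pi$ of $G=\Delta(p,q,r)$, a $t$-handle $[a,b]_t$ consists of two distinct points $a,b$, both fixed by $\pi(x)$, such that $(\pi(x)\pi(y))^t$ maps $a$ to $b$. $\mathcal A_m\wr\mathcal A_n=\mathcal A_m^{\,n}\rtimes\mathcal A_n$, with $\mathcal A_n$ permuting the $n$ factors in its natural action.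
   Formalization: Added hypothesis: {a,b} and {c,d} do not separate each other on a cycle of π(x)π(y). If they do, the prescribed φ may fail to be a representation of G, or exist with H not isomorphic to A_m wr A_n. Existence of φ is also proved. *)

theory Defs
  imports "HOL-Algebra.Sym_Groups" "HOL-Algebra.Product_Groups" "HOL-Computational_Algebra.Primes"
begin

section \<open>Groups given by generators and relators\<close>

text \<open>A word is a list of signed generators: \<open>(s, True)\<close> stands for \<open>s\<close> and \<open>(s, False)\<close>
  for its inverse. The relation below is the least congruence on words that cancels
  adjacent inverse letters and deletes relators.\<close>

type_synonym 'a word = "('a \<times> bool) list"

inductive_set pres_rel :: "'a word set \<Rightarrow> ('a word \<times> 'a word) set" for R where
  refl: "(u, u) \<in> pres_rel R"
| sym: "(u, v) \<in> pres_rel R \<Longrightarrow> (v, u) \<in> pres_rel R"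
| trans: "(u, v) \<in> pres_rel R \<Longrightarrow> (v, w) \<in> pres_rel R \<Longrightarrow> (u, w) \<in> pres_rel R"
| cancel: "(u @ [(s, e), (s, \<not> e)] @ v, u @ v) \<in> pres_rel R"
| relator: "w \<in> R \<Longrightarrow> (u @ w @ v, u @ v) \<in> pres_rel R"

definition presented_group :: "'a word set \<Rightarrow> 'a word set monoid" where
  "presented_group R =
    \<lparr> carrier = UNIV // pres_rel R,
      mult = (\<lambda>A B. \<Union>u\<in>A. \<Union>v\<in>B. pres_rel R `` {u @ v}),
      one = pres_rel R `` {[]} \<rparr>"

definition pres_gen :: "'a word set \<Rightarrow> 'a \<Rightarrow> 'a word set" where
  "pres_gen R s = pres_rel R `` {[(s, True)]}"

datatype tri_gen = Gen_x | Gen_y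

definition triangle_relators :: "nat \<Rightarrow> nat \<Rightarrow> nat \<Rightarrow> tri_gen word set" where
  "triangle_relators p q r =
    {replicate p (Gen_x, True),
     replicate q (Gen_y, True),
     concat (replicate r [(Gen_x, True), (Gen_y, True)])}"

definition triangle_group :: "nat \<Rightarrow> nat \<Rightarrow> nat \<Rightarrow> tri_gen word set monoid" where
  "triangle_group p q r = presented_group (triangle_relators p q r)"

definition tri_x :: "nat \<Rightarrow> nat \<Rightarrow> nat \<Rightarrow> tri_gen word set" where
  "tri_x p q r = pres_gen (triangle_relators p q r) Gen_x"

definition tri_y :: "nat \<Rightarrow> nat \<Rightarrow> nat \<Rightarrow> tri_gen word set" where
  "tri_y p q r = pres_gen (triangle_relators p q r) Gen_y"

lemma equiv_pres_rel: "equiv UNIV (pres_rel R)"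
  by (auto simp: equiv_def refl_on_def sym_def trans_def intro: pres_rel.intros)

lemma pres_rel_append:
  assumes "(u, u') \<in> pres_rel R" "(v, v') \<in> pres_rel R"
  shows "(u @ v, u' @ v') \<in> pres_rel R"
proof -
  have 1: "(u @ w, u' @ w) \<in> pres_rel R" for w
    using assms(1)
  proof induction
    case (cancel u s e v)
    then show ?case using pres_rel.cancel[of u s e "v @ w" R] by simp
  next
    case (relator x u v)
    then show ?case using pres_rel.relator[of x R u "v @ w"] by simp
  qed (blast intro: pres_rel.intros)+
  have 2: "(w @ v, w @ v') \<in> pres_rel R" for w
    using assms(2)
  proof induction
    case (cancel u s e v)
    then show ?case using pres_rel.cancel[of "w @ u" s e v R] by simp
  next
    case (relator x u v)
    then show ?case using pres_rel.relator[of x R "w @ u" v] by simp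
  qed (blast intro: pres_rel.intros)+
  show ?thesis using 1 2 pres_rel.trans by blast
qed

lemma presented_group_mult:
  "pres_rel R `` {u} \<otimes>\<^bsub>presented_group R\<^esub> pres_rel R `` {v} = pres_rel R `` {u @ v}"
proof -
  have "congruent2 (pres_rel R) (pres_rel R) (\<lambda>u v. pres_rel R `` {u @ v})"
    by (rule congruent2I')
      (metis pres_rel_append equiv_pres_rel equiv_class_eq)
  then show ?thesis
    by (simp add: presented_group_def UN_equiv_class2[OF equiv_pres_rel equiv_pres_rel])
qed

lemma group_presented_group: "group (presented_group R)"
proof (rule groupI)
  have ex: "\<exists>u. A = pres_rel R `` {u}" if "A \<in> carrier (presented_group R)" for A
    using that by (auto simp: presented_group_def elim: quotientE)
  have car: "pres_rel R `` {u} \<in> carrier (presented_group R)" for u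
    by (simp add: presented_group_def quotientI)
  have one: "\<one>\<^bsub>presented_group R\<^esub> = pres_rel R `` {[]}"
    by (simp add: presented_group_def)
  show "\<one>\<^bsub>presented_group R\<^esub> \<in> carrier (presented_group R)"
    by (simp add: one car)
  fix A assume A: "A \<in> carrier (presented_group R)"
  then obtain u where u: "A = pres_rel R `` {u}" using ex by blast
  show "\<one>\<^bsub>presented_group R\<^esub> \<otimes>\<^bsub>presented_group R\<^esub> A = A"
    by (simp add: one u presented_group_mult)
  have inv: "(rev (map (\<lambda>(s, e). (s, \<not> e)) w) @ w, []) \<in> pres_rel R" for w
  proof (induction w)
    case (Cons l w)
    obtain s e where l: "l = (s, e)" by force
    show ?case
      using pres_rel.cancel[of "rev (map (\<lambda>(s, e). (s, \<not> e)) w)" s "\<not> e" w R] Cons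
      by (auto simp: l intro: pres_rel.trans)
  qed (simp add: pres_rel.refl)
  show "\<exists>B\<in>carrier (presented_group R). B \<otimes>\<^bsub>presented_group R\<^esub> A = \<one>\<^bsub>presented_group R\<^esub>"
    using car inv by (metis u one presented_group_mult equiv_class_eq[OF equiv_pres_rel])
  fix B assume B: "B \<in> carrier (presented_group R)"
  then obtain v where v: "B = pres_rel R `` {v}" using ex by blast
  show "A \<otimes>\<^bsub>presented_group R\<^esub> B \<in> carrier (presented_group R)"
    by (simp add: u v presented_group_mult car)
  fix C assume "C \<in> carrier (presented_group R)"
  then obtain w where w: "C = pres_rel R `` {w}" using ex by blast
  show "A \<otimes>\<^bsub>presented_group R\<^esub> B \<otimes>\<^bsub>presented_group R\<^esub> C
      = A \<otimes>\<^bsub>presented_group R\<^esub> (B \<otimes>\<^bsub>presented_group R\<^esub> C)"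
    by (simp add: u v w presented_group_mult)
qed


section \<open>Permutations acting on the right\<close>

text \<open>\<^const>\<open>sym_group\<close> multiplies by \<^term>\<open>f \<circ> g\<close> (first \<open>g\<close>, then \<open>f\<close>). Here permutations act
  on the right, so a product is composed from left to right: the image of \<open>\<omega>\<close> under
  the product of \<open>f\<close> and \<open>g\<close> is \<open>g (f \<omega>)\<close>.\<close>

definition perm_group :: "'a set \<Rightarrow> ('a \<Rightarrow> 'a) monoid" where
  "perm_group X = \<lparr> carrier = {f. f permutes X}, mult = (\<lambda>f g. g \<circ> f), one = id \<rparr>"

lemma group_perm_group: "group (perm_group X)"
proof (rule groupI)
  fix f assume "f \<in> carrier (perm_group X)"
  then show "\<exists>g\<in>carrier (perm_group X). g \<otimes>\<^bsub>perm_group X\<^esub> f = \<one>\<^bsub>perm_group X\<^esub>"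
    using permutes_inv permutes_inv_o(1) by (fastforce simp: perm_group_def)
qed (auto simp: perm_group_def permutes_compose permutes_id comp_assoc)

abbreviation perm_subgroup :: "'a set \<Rightarrow> ('a \<Rightarrow> 'a) set \<Rightarrow> ('a \<Rightarrow> 'a) monoid" where
  "perm_subgroup X K \<equiv> (perm_group X)\<lparr> carrier := K \<rparr>"

text \<open>The left-to-right product \<open>f\<^sub>1 f\<^sub>2 \<dots> f\<^sub>k\<close>: apply \<open>f\<^sub>1\<close> first.\<close>

definition perm_prod :: "('a \<Rightarrow> 'a) list \<Rightarrow> 'a \<Rightarrow> 'a" where
  "perm_prod fs = fold (\<circ>) fs id"

definition transitive_on :: "'a set \<Rightarrow> ('a \<Rightarrow> 'a) set \<Rightarrow> bool" where
  "transitive_on X K \<longleftrightarrow> (\<forall>a\<in>X. \<forall>b\<in>X. \<exists>f\<in>K. f a = b)"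

text \<open>\<open>\<alpha>\<close> is the product of the pairwise disjoint \<open>p\<close>-cycles listed in \<open>cs\<close>.
  \<^term>\<open>cycle_of_list [i, j, k]\<close> is the cycle \<open>i \<mapsto> j \<mapsto> k \<mapsto> i\<close>.\<close>

definition disjoint_p_cycles :: "nat \<Rightarrow> 'a set \<Rightarrow> 'a list list \<Rightarrow> ('a \<Rightarrow> 'a) \<Rightarrow> bool" where
  "disjoint_p_cycles p X cs \<alpha> \<longleftrightarrow>
     (\<forall>c\<in>set cs. length c = p \<and> set c \<subseteq> X) \<and> distinct (concat cs) \<and>
     \<alpha> = perm_prod (map cycle_of_list cs)"


section \<open>Handles\<close>

text \<open>\<open>f\<close> and \<open>g\<close> are the images of the generators \<open>x\<close> and \<open>y\<close>.\<close>

definition t_handle :: "'a set \<Rightarrow> ('a \<Rightarrow> 'a) \<Rightarrow> ('a \<Rightarrow> 'a) \<Rightarrow> int \<Rightarrow> 'a \<Rightarrow> 'a \<Rightarrow> bool" where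
  "t_handle X f g t a b \<longleftrightarrow>
     a \<in> X \<and> b \<in> X \<and> a \<noteq> b \<and> f a = a \<and> f b = b \<and>
     ((f \<otimes>\<^bsub>perm_group X\<^esub> g) [^]\<^bsub>perm_group X\<^esub> t) a = b"

text \<open>The points met strictly between \<open>a\<close> and \<open>b\<close> when following the cycle of \<open>z\<close> through \<open>a\<close>
  (for \<open>a \<noteq> b\<close> on the same cycle).\<close>

definition open_arc :: "('a \<Rightarrow> 'a) \<Rightarrow> 'a \<Rightarrow> 'a \<Rightarrow> 'a set" where
  "open_arc z a b = {(z ^^ j) a | j. 0 < j \<and> (\<forall>i. 0 < i \<and> i \<le> j \<longrightarrow> (z ^^ i) a \<noteq> b)}"

text \<open>The pairs \<open>a, b\<close> and \<open>c, d\<close> do not separate each other on a cycle of \<open>z\<close>; this holds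
  in particular when they lie on different cycles. For disjoint handles with
  \<open>z = \<pi>(x)\<pi>(y)\<close> it is what makes the permutation \<open>\<phi>(x)\<phi>(y)\<close> obtained by joining
  the copies have the same cycle lengths as \<open>z\<close>: following a cycle of \<open>z\<close> once around,
  \<open>a\<close>, \<open>b\<close>, \<open>c\<close>, \<open>d\<close> change the copy by \<open>\<alpha>\<close>, \<open>\<alpha>\<inverse>\<close>, \<open>\<beta>\<close>, \<open>\<beta>\<inverse>\<close>, and these cancel unless the
  pairs are linked, when they give a commutator of \<open>\<alpha>\<close> and \<open>\<beta>\<close>.\<close>

definition unlinked :: "('a \<Rightarrow> 'a) \<Rightarrow> 'a \<Rightarrow> 'a \<Rightarrow> 'a \<Rightarrow> 'a \<Rightarrow> bool" where
  "unlinked z a b c d \<longleftrightarrow> (c \<in> open_arc z a b \<longleftrightarrow> d \<in> open_arc z a b)"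


section \<open>Joining \<open>m\<close> copies of a permutation representation\<close>

definition copy_pt :: "nat \<Rightarrow> nat \<Rightarrow> nat \<Rightarrow> nat" where
  "copy_pt n i \<omega> = (i - 1) * n + \<omega>"

definition copy_perm :: "nat \<Rightarrow> nat \<Rightarrow> (nat \<Rightarrow> nat) \<Rightarrow> nat \<Rightarrow> nat" where
  "copy_perm n i f u =
     (if u \<in> {(i - 1) * n + 1..i * n} then copy_pt n i (f (u - (i - 1) * n)) else u)"

text \<open>For a cycle \<open>(i\<^sub>1, \<dots>, i\<^sub>p)\<close>, the permutation
  \<open>(a\<^sub>i\<^sub>1, \<dots>, a\<^sub>i\<^sub>p) (b\<^sub>i\<^sub>p, \<dots>, b\<^sub>i\<^sub>1)\<close>, where \<open>a\<^sub>i\<close> is the copy of \<open>a\<close> in the \<open>i\<close>-th block.\<close>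

definition handle_join :: "nat \<Rightarrow> nat \<Rightarrow> nat \<Rightarrow> nat list \<Rightarrow> nat \<Rightarrow> nat" where
  "handle_join n a b c =
     perm_prod [cycle_of_list (map (\<lambda>i. copy_pt n i a) c),
                cycle_of_list (rev (map (\<lambda>i. copy_pt n i b) c))]"

definition all_copies :: "nat \<Rightarrow> nat \<Rightarrow> (nat \<Rightarrow> nat) \<Rightarrow> (nat \<Rightarrow> nat) list" where
  "all_copies m n f = map (\<lambda>i. copy_perm n i f) [1..<Suc m]"


section \<open>Wreath products\<close>

definition semidirect_product ::
  "('a, 'c) monoid_scheme \<Rightarrow> ('b, 'd) monoid_scheme \<Rightarrow> ('b \<Rightarrow> 'a \<Rightarrow> 'a) \<Rightarrow> ('a \<times> 'b) monoid" where
  "semidirect_product N K act =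
    \<lparr> carrier = carrier N \<times> carrier K,
      mult = (\<lambda>(f, s) (g, t). (f \<otimes>\<^bsub>N\<^esub> act s g, s \<otimes>\<^bsub>K\<^esub> t)),
      one = (\<one>\<^bsub>N\<^esub>, \<one>\<^bsub>K\<^esub>) \<rparr>"

text \<open>\<open>A\<^sub>m\<close> wr \<open>A\<^sub>n\<close>: the permutation \<open>s\<close> moves the \<open>i\<close>-th coordinate to position \<open>s i\<close>. Here the
  library's \<^const>\<open>alt_group\<close>, composing from right to left, acts on the left;
  the right-acting convention gives an isomorphic group (invert every permutation).\<close>

definition alt_wreath_alt :: "nat \<Rightarrow> nat \<Rightarrow> ((nat \<Rightarrow> nat \<Rightarrow> nat) \<times> (nat \<Rightarrow> nat)) monoid" where
  "alt_wreath_alt m n =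
     semidirect_product (product_group {1..n} (\<lambda>_. alt_group m)) (alt_group n)
       (\<lambda>s f. \<lambda>i\<in>{1..n}. f (inv' s i))"

end

theory Submission
  imports Defs "HOL-Combinatorics.Perm"
begin

text \<open>
  Write a point of the \<open>i\<close>-th copy as a pair \<open>(i, \<omega>)\<close>. Both \<open>\<phi>(x)\<close> and \<open>\<phi>(y)\<close> permute the
  fibres \<open>{1..m} \<times> {\<omega>}\<close> as \<open>\<pi>(x)\<close> and \<open>\<pi>(y)\<close> permute the points \<open>\<omega>\<close>; on the way \<open>\<phi>(y)\<close> keeps the
  copy, and \<open>\<phi>(x)\<close> changes it only over the four handle points, by \<open>\<alpha>\<close>, \<open>\<alpha>\<inverse>\<close>, \<open>\<beta>\<close>, \<open>\<beta>\<inverse>\<close> over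
  \<open>a\<close>, \<open>b\<close>, \<open>c\<close>, \<open>d\<close>. A subgroup of \<open>S\<^sub>n\<close> isomorphic to \<open>A\<^sub>n\<close> has index two and is therefore \<open>A\<^sub>n\<close>
  itself (\<open>iso_alt_group_imp_alternating\<close>), so \<open>H\<close> lies in the wreath product of \<open>A\<^sub>m\<close>, acting on
  the fibres, by \<open>A\<^sub>n\<close>, acting on the base. The relations of the triangle group hold for
  \<open>\<phi>(x)\<close> and \<open>\<phi>(y)\<close> because relabelling each fibre along the cycles of \<open>\<pi>(x)\<pi>(y)\<close> removes every
  change of copy from \<open>\<phi>(x)\<phi>(y)\<close>; this is where the handles must not be linked
  (\<open>gauge_step\<close>).

  Let \<open>K\<close> be the kernel of the action of \<open>H\<close> on the base. It has to be shown that \<open>K = A\<^sub>m\<^sup>n\<close>. Any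
  two fibres are identified by some element of \<open>H\<close> that keeps the copies, since the loops
  \<open>\<pi>(x)\<close> at the handle points can be left out of a path. Hence the stabiliser of a fibre induces
  \<open>\<langle>\<alpha>, \<beta>\<rangle> = A\<^sub>m\<close> on it. Because \<open>A\<^sub>m\<close> is simple and \<open>A\<^sub>n\<close> is doubly transitive, either \<open>K\<close>
  is everything, or an element of \<open>K\<close> is determined by its action on any one fibre
  (\<open>unfaithful_imp_full\<close>). In the second case \<open>K\<close> is trivial or a diagonal copy of \<open>A\<^sub>m\<close>. If \<open>K\<close>
  is trivial then \<open>A\<^sub>n\<^sub>-\<^sub>1\<close>, the stabiliser of a point, maps onto \<open>A\<^sub>m\<close>, and \<open>m = n - 1\<close>
  (\<open>card_of_trivial_kernel\<close>).

  The diagonal case is the heart of the matter. Then \<open>H\<close> is the direct product of \<open>K\<close> and its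
  centraliser \<open>C\<close>, and \<open>C\<close> identifies all fibres in such a way that every \<open>h \<in> H\<close> acts on the
  copies by one and the same element \<open>\<kappa>(h)\<close> of \<open>A\<^sub>m\<close>, whatever the fibre
  (\<open>constant_part_fib\<close>). Put \<open>\<xi> = \<kappa>(x)\<close>, and let \<open>\<zeta>\<close> be the image of the product of the
  generators. Comparing both ends of the handles shows that \<open>\<tau> = \<zeta>\<^sup>t\<close> is an involution that
  inverts \<open>\<xi>\<close>, when \<open>p\<close> is odd. Now the identifications of the fibres form a map from the
  points \<open>\<omega>\<close> to \<open>A\<^sub>m\<close>, and the number of points over each group element is a function on the
  closed surface obtained from the Cayley graph of \<open>A\<^sub>m\<close> by gluing a face to each cycle of a
  generator or of their product. It jumps exactly across two closed curves, one for each handle,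
  so these curves together bound. Intersecting them with their translates shows that this
  happens only if \<open>\<beta> = \<alpha>\<close> or \<open>\<beta> = \<alpha>\<inverse>\<close> (\<open>handle_pair_obstruction\<close>, \<open>handles_parallel\<close>), and then
  \<open>\<langle>\<alpha>, \<beta>\<rangle>\<close> is abelian. For \<open>p = 2\<close> the group \<open>\<langle>\<alpha>, \<beta>\<rangle>\<close> would be dihedral.
\<close>

section \<open>Multiplicative groups as a type class\<close>

notation "apply" (infixl "$" 999)

class group_mult = monoid_mult + inverse +
  assumes group_left_inverse: "inverse a * a = 1"

sublocale group_mult \<subseteq> mg: Groups.group times 1 inverse
  by standard (simp_all add: group_left_inverse)

declare mg.inverse_distrib_swap [simp]

lemma mult_inverse_cancel [simp]:
  fixes a b :: "'a::group_mult"
  shows "inverse a * (a * b) = b" "a * (inverse a * b) = b"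
  by (simp_all add: mult.assoc[symmetric])

lemma group_cancel_left [simp]: "a * b = a * c \<longleftrightarrow> b = c" for a b c :: "'a::group_mult"
  by (metis mult_inverse_cancel(1))

lemma group_cancel_right [simp]: "b * a = c * a \<longleftrightarrow> b = c" for a b c :: "'a::group_mult"
  by (metis mg.right_inverse mult.assoc mult_1_right)

lemma inverse_eq_swap: "inverse a = b \<longleftrightarrow> a = inverse b" for a b :: "'a::group_mult"
  by (metis mg.inverse_inverse)

lemma conj_power: "(a * g * inverse a) ^ n = a * g ^ n * inverse a" for a g :: "'a::group_mult"
  by (induction n) (simp_all add: mult.assoc)

lemma inverse_power_group: "inverse (g ^ n) = inverse g ^ n" for g :: "'a::group_mult"
  by (induction n) (simp_all add: power_commutes)

lemma square_power_odd: "(g * g) ^ Suc k = g" if "g ^ (2 * k + 1) = 1" for g :: "'a::group_mult"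
proof -
  have "(g * g) ^ Suc k = g ^ (2 * Suc k)"
    by (simp only: power_mult power2_eq_square)
  also have "\<dots> = g ^ (2 * k + 1) * g"
    by (simp only: power_Suc2[symmetric]) simp
  finally show ?thesis using that by simp
qed

lemma commute_of_commute_square:
  fixes g h :: "'a::group_mult"
  assumes "g ^ (2 * k + 1) = 1" "h * (g * g) = g * g * h"
  shows "h * g = g * h"
proof -
  have "h * (g * g) ^ j = (g * g) ^ j * h" for j
    by (induction j) (simp, metis assms(2) mult.assoc power_Suc)
  then show ?thesis using square_power_odd[OF assms(1)] by metis
qed

lemma group_left_right_inverse [simp]:
  fixes a :: "'a::group_mult"
  shows "a * inverse a = 1" "inverse a * a = 1"
  by (simp_all add: group_left_inverse)

lemma conj_eq_conj_inverse:
  fixes g x :: "'a::group_mult"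
  assumes "x * g * inverse x = inverse x * g * x"
  shows "g * (x * x) = x * x * g"
proof -
  have "x * (inverse x * g * x) * x = x * (x * g * inverse x) * x"
    by (simp only: assms)
  then show ?thesis by (simp add: mult.assoc)
qed

lemma odd_involution_trivial: "g = 1" if "g ^ (2 * k + 1) = 1" "g * g = 1" for g :: "'a::group_mult"
  using square_power_odd[OF that(1)] that(2) by simp

lemma power_add_exponent_cancel: "a ^ i = a ^ (i + j) \<longleftrightarrow> a ^ j = 1" for a :: "'a::group_mult"
  by (metis group_cancel_left mult_1_right power_add)

lemma power_mod_exponent: "z ^ i = z ^ (i mod n)" if "z ^ n = 1" for z :: "'a::group_mult"
proof -
  have "z ^ i = (z ^ n) ^ (i div n) * z ^ (i mod n)"
    by (simp flip: power_add power_mult)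
  then show ?thesis using that by simp
qed

text \<open>An involution in a finite cyclic group sits half a period after the identity.\<close>

lemma involution_in_cyclic:
  fixes z w :: "'a::group_mult"
  assumes "z ^ n = 1" "n > 0" "w = z ^ t" "w * w = 1" "w \<noteq> 1"
  obtains s where "s > 0" "z ^ s = w" "\<And>i. z ^ i = 1 \<longleftrightarrow> 2 * s dvd i"
proof -
  define d where "d = (LEAST d. d > 0 \<and> z ^ d = 1)"
  have d: "d > 0" "z ^ d = 1"
    using LeastI[of "\<lambda>d. d > 0 \<and> z ^ d = 1" n] assms(1,2) by (auto simp: d_def)
  have least: "d \<le> i" if "i > 0" "z ^ i = 1" for i
    using that by (auto simp: d_def intro: Least_le)
  have md: "z ^ i = z ^ (i mod d)" for i
    using power_mod_exponent[OF d(2)] .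
  have dv: "z ^ i = 1 \<longleftrightarrow> d dvd i" for i
  proof
    assume "z ^ i = 1"
    then have "z ^ (i mod d) = 1" using md by simp
    then show "d dvd i" using least[of "i mod d"] d(1)
      by (metis dvd_eq_mod_eq_0 gr0I leD mod_less_divisor)
  qed (metis d(2) dvd_def power_mult power_one)
  define s where "s = t mod d"
  have s: "z ^ s = w" using md assms(3) by (simp add: s_def)
  then have "s > 0" using assms(5) by (cases s) auto
  moreover have "d dvd 2 * s"
    using dv[of "2 * s"] assms(4) s by (simp add: mult_2 power_add)
  moreover have "s < d" using d(1) by (simp add: s_def)
  ultimately have "2 * s = d"
  proof -
    obtain e where e: "2 * s = d * e" using \<open>d dvd 2 * s\<close> by (auto simp: dvd_def)
    have "e < 2"
    proof (rule ccontr)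
      assume "\<not> e < 2"
      then have "d * 2 \<le> d * e" by simp
      then show False using e \<open>s < d\<close> by linarith
    qed
    moreover have "e \<noteq> 0" using e \<open>s > 0\<close> by (intro notI) simp
    ultimately show ?thesis using e by (cases e) auto
  qed
  then show ?thesis using that[of s] s \<open>s > 0\<close> dv by auto
qed


section \<open>The obstruction from a pair of handles\<close>

text \<open>
  Glue a face to each cycle \<open>\<langle>\<xi>\<rangle>g\<close>, \<open>\<langle>\<eta>\<rangle>g\<close>, \<open>\<langle>\<zeta>\<rangle>g\<close> of the Cayley graph of the group generated by
  \<open>\<xi>\<close> and \<open>\<eta>\<close>: this gives a closed surface on which the group acts from the right. Here \<open>N\<close> is a
  function on the \<open>\<eta>\<close>-faces and \<open>N'\<close> one on the \<open>\<xi>\<close>-faces, and they agree except at the corners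
  counted by \<open>D\<close>. A handle joins the \<open>\<xi>\<close>-faces of \<open>1\<close> and \<open>\<tau>\<close>, which are opposite to each other in
  the \<open>\<zeta>\<close>-face of \<open>1\<close>. As \<open>\<tau>\<close> inverts \<open>\<xi>\<close>, they are opposite in the \<open>\<zeta>\<close>-face of \<open>\<xi>\<inverse>\<close> as well,
  and the two diagonals make up a closed curve. The jumps of \<open>N\<close> are those along this curve and along
  its translate by \<open>u\<close>; a function with such jumps exists only if the two curves together bound.
  Each of them meets its image under a rotation about the centre of a \<open>\<zeta>\<close>-face exactly once, so by
  itself it does not bound. The two together would have to compensate all these crossings, and this
  leaves only translations \<open>u\<close> that conjugate \<open>\<xi>\<close> to \<open>\<xi>\<close> or \<open>\<xi>\<inverse>\<close>.
\<close>

lemma handle_pair_obstruction: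
  fixes \<xi> \<eta> \<zeta> \<tau> u :: "'a::group_mult" and N N' D :: "'a \<Rightarrow> int"
  assumes \<zeta>: "\<zeta> = \<eta> * \<xi>"
    and N: "\<And>g. N (\<eta> * g) = N g"
    and N': "\<And>g. N' (\<xi> * g) = N' g"
    and NN': "\<And>g. N g = N' g + D g"
    and D: "\<And>g. D g = of_bool (g = 1) + of_bool (g = \<tau> * inverse \<xi>)
              + of_bool (g = u) + of_bool (g = \<tau> * inverse \<xi> * u)"
    and \<tau>: "\<tau> = \<zeta> ^ t" and \<tau>\<xi>: "\<tau> * \<xi> * inverse \<tau> = inverse \<xi>"
    and odd: "\<xi> ^ (2 * k + 1) = 1" and \<xi>1: "\<xi> \<noteq> 1"
    and fin: "\<zeta> ^ n = 1" "n > 0"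
    and centre: "\<And>i. \<zeta> ^ i * \<xi> = \<xi> * \<zeta> ^ i \<Longrightarrow> \<zeta> ^ i = 1"
    and not_inv: "\<zeta> * \<xi> * inverse \<zeta> \<noteq> inverse \<xi>"
  shows "inverse u * \<xi> * u = \<xi> \<or> inverse u * \<xi> * u = inverse \<xi>"
proof -
  have \<tau>\<xi>': "\<tau> * \<xi> = inverse \<xi> * \<tau>"
  proof -
    have "\<tau> * \<xi> * inverse \<tau> * \<tau> = inverse \<xi> * \<tau>" by (simp only: \<tau>\<xi>)
    then show ?thesis by (simp add: mult.assoc)
  qed
  have \<tau>\<xi>'': "\<tau> * inverse \<xi> = \<xi> * \<tau>"
  proof -
    have "\<xi> * (\<tau> * \<xi>) * inverse \<xi> = \<xi> * (inverse \<xi> * \<tau>) * inverse \<xi>"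
      by (simp only: \<tau>\<xi>')
    then show ?thesis by (simp add: mult.assoc)
  qed
  have \<tau>p: "\<tau> * (\<xi> * g) = inverse \<xi> * (\<tau> * g)" "\<tau> * (inverse \<xi> * g) = \<xi> * (\<tau> * g)" for g
    by (simp_all add: mult.assoc[symmetric] \<tau>\<xi>' \<tau>\<xi>'')
  have \<tau>\<tau>: "\<tau> * \<tau> = 1"
  proof -
    have "\<tau> * \<tau> * \<xi> = \<xi> * (\<tau> * \<tau>)"
      by (simp add: mult.assoc \<tau>\<xi>' \<tau>p)
    then show ?thesis using centre[of "t + t"] by (simp add: \<tau> power_add)
  qed
  have inv\<tau>: "inverse \<tau> = \<tau>"
    using \<tau>\<tau> by (metis mult_1_right mult_inverse_cancel(1))
  have sq1: "\<xi> * \<xi> \<noteq> 1" using odd_involution_trivial[OF odd] \<xi>1 by blast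
  have "\<tau> \<noteq> 1"
  proof
    assume "\<tau> = 1"
    then have "\<xi> = inverse \<xi>" using \<tau>\<xi> by simp
    then show False using sq1 by (metis group_left_inverse)
  qed
  obtain s where s: "s > 0" "\<zeta> ^ s = \<tau>" "\<And>i. \<zeta> ^ i = 1 \<longleftrightarrow> 2 * s dvd i"
    using involution_in_cyclic[OF fin \<tau> \<tau>\<tau> \<open>\<tau> \<noteq> 1\<close>] by blast
  define Z where "Z = range (\<lambda>i. \<zeta> ^ i)"
  have Z1: "1 \<in> Z" using rangeI[of "\<lambda>i. \<zeta> ^ i" 0] by (simp add: Z_def)
  have Zm: "g * h \<in> Z" if "g \<in> Z" "h \<in> Z" for g h
    using that by (auto simp: Z_def simp flip: power_add)
  have Zi: "inverse g \<in> Z" if gZ: "g \<in> Z" for g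
  proof -
    obtain i where i: "g = \<zeta> ^ i" using gZ by (auto simp: Z_def)
    have "g * \<zeta> ^ (i * (n - 1)) = (\<zeta> ^ n) ^ i"
      using fin(2) by (simp add: i power_add[symmetric] power_mult[symmetric] mult.commute
         flip: mult_Suc_right)
    then have "inverse g = \<zeta> ^ (i * (n - 1))"
      using fin(1) by (metis mult_inverse_cancel(1) mult_1_right power_one)
    then show ?thesis by (simp add: Z_def)
  qed
  have Zmr: "g * h \<in> Z \<longleftrightarrow> g \<in> Z" if "h \<in> Z" for g h
    using Zm Zi that by (metis mg.right_inverse mult.assoc mult_1_right)
  have Zml: "h * g \<in> Z \<longleftrightarrow> g \<in> Z" if "h \<in> Z" for g h
    using Zm Zi that by (metis mult_inverse_cancel(1))
  have Zinv: "inverse g \<in> Z \<longleftrightarrow> g \<in> Z" for g using Zi by (metis mg.inverse_inverse)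
  have \<zeta>Z: "\<zeta> \<in> Z" using rangeI[of "\<lambda>i. \<zeta> ^ i" 1] by (simp add: Z_def)
  have Zpow: "\<zeta> ^ i \<in> Z" for i by (simp add: Z_def)
  have \<tau>Z: "\<tau> \<in> Z" unfolding Z_def \<tau> by blast
  have Zc: "\<tau> * g = g * \<tau>" if "g \<in> Z" for g
    using that by (auto simp: Z_def \<tau> simp flip: power_add simp: add.commute)
  have Zcentre: "g = 1" if "g \<in> Z" "g * \<xi> = \<xi> * g" for g
    using that centre by (auto simp: Z_def)
  have half: "g * \<xi> = \<xi> * g" if "g * (\<xi> * \<xi>) = \<xi> * \<xi> * g" for g
    using commute_of_commute_square[OF odd that] .
  have Zp: "\<tau> * (g * h) = g * (\<tau> * h)" if "g \<in> Z" for g h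
    using Zc[OF that] by (simp flip: mult.assoc)
  have \<xi>Z: "\<xi> \<notin> Z"
  proof
    assume "\<xi> \<in> Z"
    then have "\<xi> = inverse \<xi>" using Zc \<tau>\<xi>' by (metis group_cancel_right)
    then show False using sq1 by (metis group_left_inverse)
  qed
  have sqZ: "\<xi> * \<xi> \<notin> Z"
  proof
    assume "\<xi> * \<xi> \<in> Z"
    then have "\<xi> * \<xi> = 1" using Zcentre by (simp add: mult.assoc)
    then show False using sq1 by simp
  qed
  \<comment> \<open>Conjugation by \<open>\<tau>\<close> is trivial on \<open>Z\<close> and inverts \<open>\<xi>\<close>. Applied to a relation between cosets of \<open>Z\<close>
    it gives a second one, and together they place elements of \<open>Z\<close> in the centre.\<close>
  have conj_sq: "g * (x * x) = x * x * g"
    if x: "\<tau> * x = inverse x * \<tau>" "\<tau> * inverse x = x * \<tau>"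
      and g: "g \<in> Z" "inverse x * g * x \<in> Z" for g x
  proof -
    have "\<tau> * (inverse x * g * x) = (\<tau> * inverse x) * (g * x)" by (simp add: mult.assoc)
    also have "\<dots> = x * (\<tau> * (g * x))" by (simp only: x(2) mult.assoc)
    also have "\<dots> = x * g * (\<tau> * x)" by (simp only: Zp[OF g(1)] mult.assoc)
    also have "\<dots> = x * g * inverse x * \<tau>" by (simp only: x(1) mult.assoc)
    finally have "x * g * inverse x = inverse x * g * x" using Zc[OF g(2)] by simp
    then show ?thesis by (rule conj_eq_conj_inverse)
  qed
  have conj: "g = 1" if "g \<in> Z" "inverse \<xi> * g * \<xi> \<in> Z" for g
    using conj_sq[OF \<tau>\<xi>' \<tau>\<xi>'' that] half Zcentre that(1) by blast
  have conj2: "g = 1" if "g \<in> Z" "inverse (\<xi> * \<xi>) * g * (\<xi> * \<xi>) \<in> Z" for g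
  proof -
    have "g * (\<xi> * \<xi> * (\<xi> * \<xi>)) = \<xi> * \<xi> * (\<xi> * \<xi>) * g"
      by (rule conj_sq[OF _ _ that]) (simp_all add: mult.assoc \<tau>p \<tau>\<xi>' \<tau>\<xi>'')
    moreover have "(\<xi> * \<xi>) ^ (2 * k + 1) = 1"
      by (metis odd power_mult power2_eq_square mult.commute power_one)
    ultimately have "g * (\<xi> * \<xi>) = \<xi> * \<xi> * g" using commute_of_commute_square by blast
    then show ?thesis using half Zcentre that(1) by blast
  qed
  have flip: "g = \<tau>" if "g \<in> Z" "\<xi> * g * \<xi> \<in> Z" for g
  proof -
    have "\<tau> * (\<xi> * g * \<xi>) = \<xi> * g * \<xi> * \<tau>" using Zc that(2) by blast
    moreover have "\<tau> * (\<xi> * g * \<xi>) = inverse \<xi> * g * inverse \<xi> * \<tau>"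
      by (simp add: mult.assoc \<tau>p \<tau>\<xi>' Zp[OF that(1)])
    ultimately have *: "\<xi> * g * \<xi> = inverse \<xi> * g * inverse \<xi>" by simp
    then have "\<xi> * (\<xi> * g * \<xi>) * \<xi> = \<xi> * (inverse \<xi> * g * inverse \<xi>) * \<xi>"
      by simp
    then have g: "g = \<xi> * (\<xi> * (g * (\<xi> * \<xi>)))"
      by (simp add: mult.assoc)
    have "(g * \<tau>) * (\<xi> * \<xi>) = g * inverse (\<xi> * \<xi>) * \<tau>"
      by (simp add: \<tau>p \<tau>\<xi>' mult.assoc)
    also have "\<dots> = \<xi> * \<xi> * (g * \<tau>)"
      by (subst g) (simp add: mult.assoc)
    finally have "(g * \<tau>) * (\<xi> * \<xi>) = \<xi> * \<xi> * (g * \<tau>)" .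
    then have "g * \<tau> = 1" using half Zcentre Zm that(1) \<tau>Z by blast
    then show ?thesis using \<tau>\<tau> by (metis group_cancel_right)
  qed
  define d where "d g = (of_bool (g = 1) + of_bool (g = \<tau> * inverse \<xi>) :: int)" for g
  \<comment> \<open>\<open>E g\<close> is the signed number of crossings of the diagonals that start at \<open>1\<close> and at \<open>g\<close>, and \<open>J g\<close>
    the change of \<open>N'\<close> along the diagonal that starts at \<open>g\<close>.\<close>
  define E where "E g = (\<Sum>j<s. of_bool (\<zeta> ^ j * g = \<tau>)) - (\<Sum>j<s. of_bool (\<zeta> ^ Suc j * g = 1) :: int)" for g
  define J where "J g = N' (\<tau> * g) - N' g" for g
  have Dd: "D g = d g + d (g * inverse u)" for g
  proof -
    have *: "g = h * u \<longleftrightarrow> g * inverse u = h" for h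
      by (metis group_left_right_inverse mult.assoc mult_1_right)
    have "g = u \<longleftrightarrow> g * inverse u = 1" using *[of 1] by simp
    then show ?thesis using *[of "\<tau> * inverse \<xi>"] by (simp add: D d_def)
  qed
  \<comment> \<open>The diagonals that start at \<open>g\<close> and at \<open>\<xi> g\<close> join the same two \<open>\<xi>\<close>-faces.\<close>
  have J_inv: "J (\<xi> * g) = J g" for g
  proof -
    have "N' (\<tau> * (\<xi> * g)) = N' (\<xi> * (\<tau> * (\<xi> * g)))" by (simp only: N')
    also have "\<xi> * (\<tau> * (\<xi> * g)) = \<tau> * g" by (simp add: \<tau>p)
    finally show ?thesis by (simp add: J_def N')
  qed
  have N\<zeta>: "N (\<zeta> * g) = N g - D g + D (\<xi> * g)" for g
  proof -
    have "N (\<zeta> * g) = N (\<xi> * g)" by (simp add: \<zeta> N mult.assoc)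
    also have "\<dots> = N' g + D (\<xi> * g)" using NN' N' by metis
    finally show ?thesis using NN'[of g] by simp
  qed
  \<comment> \<open>Walk around a \<open>\<zeta>\<close>-face and add up the jumps.\<close>
  have N\<zeta>_power: "N (\<zeta> ^ i * g) = N g + (\<Sum>j<i. D (\<xi> * (\<zeta> ^ j * g)) - D (\<zeta> ^ j * g))" for i g
    by (induction i) (simp_all add: mult.assoc N\<zeta>)
  have JD: "J g = (\<Sum>j<s. D (\<xi> * (\<zeta> ^ j * g))) - (\<Sum>j<s. D (\<zeta> ^ Suc j * g))" for g
  proof -
    have "(\<Sum>j<s. D (\<zeta> ^ Suc j * g)) = (\<Sum>j<s. D (\<zeta> ^ j * g)) + D (\<zeta> ^ s * g) - D g"
      using sum.lessThan_Suc_shift[of "\<lambda>j. D (\<zeta> ^ j * g)" s] by (simp add: mult.assoc)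
    then show ?thesis
      using N\<zeta>_power[of s g] NN'[of g] NN'[of "\<tau> * g"] by (simp add: J_def s(2) sum_subtractf)
  qed
  have eE: "(\<Sum>j<s. d (\<xi> * (\<zeta> ^ j * g))) - (\<Sum>j<s. d (\<zeta> ^ Suc j * g)) = E g - E (g * \<xi>)" for g
  proof -
    have 1: "\<xi> * h = \<tau> * inverse \<xi> \<longleftrightarrow> h = \<tau>" for h by (simp add: \<tau>\<xi>'')
    have rot: "a * b = 1 \<longleftrightarrow> b * a = 1" for a b :: 'a
      by (metis group_left_right_inverse group_cancel_left mult.assoc mult_1_left mult_1_right)
    have 2: "\<xi> * (h * g) = 1 \<longleftrightarrow> h * (g * \<xi>) = 1" for h
      using rot[of \<xi> "h * g"] by (simp add: mult.assoc)
    have 3: "h * g = \<tau> * inverse \<xi> \<longleftrightarrow> h * (g * \<xi>) = \<tau>" for h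
      by (metis group_left_right_inverse mult.assoc mult_1_right)
    define f where "f j = (of_bool (\<zeta> ^ j * (g * \<xi>) = 1) + of_bool (\<zeta> ^ j * (g * \<xi>) = \<tau>) :: int)" for j
    have "(\<Sum>j<s. f (Suc j)) - (\<Sum>j<s. f j) = f s - f 0"
      by (simp only: sum_subtractf[symmetric] sum_lessThan_telescope)
    also have "\<dots> = 0"
    proof -
      have "\<tau> * h = 1 \<longleftrightarrow> h = \<tau>" "\<tau> * h = \<tau> \<longleftrightarrow> h = 1" for h
        using \<tau>\<tau> by (metis group_cancel_left, metis group_cancel_left mult_1_right)
      then show ?thesis by (simp add: f_def s(2))
    qed
    finally show ?thesis
      unfolding d_def E_def 1 2 3 f_def
      by (simp add: sum.distrib)
  qed
  have J: "J g = E g - E (g * \<xi>) + E (g * inverse u) - E (g * inverse u * \<xi>)" for g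
  proof -
    have "J g = ((\<Sum>j<s. d (\<xi> * (\<zeta> ^ j * g))) - (\<Sum>j<s. d (\<zeta> ^ Suc j * g)))
      + ((\<Sum>j<s. d (\<xi> * (\<zeta> ^ j * (g * inverse u)))) - (\<Sum>j<s. d (\<zeta> ^ Suc j * (g * inverse u))))"
      by (simp add: JD Dd sum.distrib mult.assoc)
    then show ?thesis by (simp only: eE)
  qed
  have E0: "E g = 0" if "g \<notin> Z" for g
  proof -
    have "\<zeta> ^ j * g \<noteq> \<tau>" "\<zeta> ^ Suc j * g \<noteq> 1" for j
      using that Zml[of "\<zeta> ^ j" g] Zml[of "\<zeta> ^ Suc j" g] \<tau>Z Z1 Zpow by metis+
    then show ?thesis by (simp add: E_def)
  qed
  \<comment> \<open>Two different diagonals of one \<open>\<zeta>\<close>-face cross once, at its centre; \<open>1\<close> and \<open>\<tau>\<close> start the same one.\<close>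
  have E\<zeta>: "E g \<noteq> 0 \<longleftrightarrow> g \<noteq> 1 \<and> g \<noteq> \<tau>" if gZ: "g \<in> Z" for g
  proof -
    have "inverse g \<in> Z" using Zi gZ .
    then obtain i where i: "inverse g = \<zeta> ^ i" by (auto simp: Z_def)
    define j where "j = i mod (2 * s)"
    have per: "\<zeta> ^ (2 * s) = 1" using s(3) by simp
    have gj: "g = inverse (\<zeta> ^ j)"
      using i power_mod_exponent[OF per] mg.inverse_inverse by (metis j_def)
    have jl: "j < 2 * s" using s(1) by (simp add: j_def)
    have inj: "a = b" if ab: "\<zeta> ^ a = \<zeta> ^ b" "a \<le> b" "b < 2 * s" for a b
    proof -
      have "2 * s dvd b - a"
        using power_add_exponent_cancel[of \<zeta> a "b - a"] s(3) ab(1,2) by simp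
      then show ?thesis using ab(2,3) by (auto dest: dvd_imp_le)
    qed
    have key: "\<zeta> ^ a * g = 1 \<longleftrightarrow> a = j" if "a < 2 * s" for a
    proof -
      have "\<zeta> ^ a * g = 1 \<longleftrightarrow> \<zeta> ^ a = \<zeta> ^ j"
        unfolding gj by (metis group_left_right_inverse(1) group_cancel_right)
      then show ?thesis using inj[of a j] inj[of j a] that jl by (metis nat_le_linear)
    qed
    have key\<tau>: "\<zeta> ^ a * g = \<tau> \<longleftrightarrow> a + s = j" if "a < s" for a
    proof -
      have "\<zeta> ^ a * g = \<tau> \<longleftrightarrow> \<tau> * (\<zeta> ^ a * g) = 1"
        using \<tau>\<tau> by (metis group_cancel_left)
      also have "\<tau> * (\<zeta> ^ a * g) = \<zeta> ^ (s + a) * g"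
        by (simp add: power_add s(2) mult.assoc)
      finally show ?thesis using key[of "s + a"] that by (simp add: add.commute)
    qed
    have 1: "\<zeta> ^ l * g = \<tau> \<longleftrightarrow> s \<le> j \<and> l = j - s" if "l < s" for l
      using key\<tau>[OF that] by auto
    have 2: "\<zeta> ^ Suc l * g = 1 \<longleftrightarrow> 1 \<le> j \<and> l = j - 1" if "l < s" for l
      using key[of "Suc l"] that by auto
    have "(\<Sum>l<s. of_bool (\<zeta> ^ l * g = \<tau>) :: int) = of_bool (s \<le> j)"
    proof -
      have "(\<Sum>l<s. of_bool (\<zeta> ^ l * g = \<tau>) :: int) = (\<Sum>l<s. if j - s = l then of_bool (s \<le> j) else 0)"
        by (rule sum.cong) (auto simp: 1)
      then show ?thesis using jl s(1) by (auto simp: Int_def)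
    qed
    moreover have "(\<Sum>l<s. of_bool (\<zeta> ^ Suc l * g = 1) :: int) = of_bool (1 \<le> j \<and> j \<le> s)"
    proof -
      have "(\<Sum>l<s. of_bool (\<zeta> ^ Suc l * g = 1) :: int) = (\<Sum>l<s. if j - 1 = l then of_bool (1 \<le> j) else 0)"
        by (rule sum.cong) (simp, subst 2, auto)
      then show ?thesis using s(1) by auto
    qed
    ultimately have "E g = of_bool (s \<le> j) - of_bool (1 \<le> j \<and> j \<le> s)"
      by (simp add: E_def)
    then have "E g \<noteq> 0 \<longleftrightarrow> j \<noteq> 0 \<and> j \<noteq> s" using s(1) by auto
    moreover have "g = 1 \<longleftrightarrow> j = 0" using key[of 0] s(1) by auto
    moreover have "g = \<tau> \<longleftrightarrow> j = s" using key\<tau>[of 0] s(1) by auto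
    ultimately show ?thesis by simp
  qed
  have E1: "E 1 = 0" using E\<zeta> Z1 by blast
  define v where "v = inverse u"
  have J: "J g = E g - E (g * \<xi>) + E (g * v) - E (g * v * \<xi>)" for g
    using J by (simp add: v_def)
  have concl: ?thesis if "v = 1 \<or> v = \<tau> \<or> v * \<xi> = 1 \<or> v * \<xi> = \<tau>"
  proof -
    have u: "u = inverse v" by (simp add: v_def)
    have iw: "inverse u * \<xi> * u = (v * \<xi>) * \<xi> * inverse (v * \<xi>)"
      unfolding u by (simp add: mult.assoc)
    from that show ?thesis
    proof (elim disjE)
      assume "v = 1" then show ?thesis by (simp add: u)
    next
      assume "v = \<tau>" then show ?thesis by (simp add: u \<tau>\<xi>)
    next
      assume "v * \<xi> = 1" then show ?thesis by (simp only: iw) simp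
    next
      assume "v * \<xi> = \<tau>" then show ?thesis by (simp only: iw \<tau>\<xi>) simp
    qed
  qed
  have nZ: "g * \<xi> \<notin> Z" "g * inverse \<xi> \<notin> Z" "\<xi> * g \<notin> Z" "inverse \<xi> * g \<notin> Z" if "g \<in> Z" for g
    using Zmr[OF that] Zml[OF that] Zinv \<xi>Z by blast+
  have conj': "g = 1" if "g \<in> Z" "\<xi> * g * inverse \<xi> \<in> Z" for g
  proof -
    have "\<xi> * g * inverse \<xi> = 1"
      by (rule conj[OF that(2)]) (use that(1) in \<open>simp add: mult.assoc\<close>)
    then have "inverse \<xi> * (\<xi> * g * inverse \<xi>) * \<xi> = 1" by simp
    then show ?thesis by (simp add: mult.assoc)
  qed
  have flip': "g = \<tau>" if "g \<in> Z" "inverse \<xi> * g * inverse \<xi> \<in> Z" for g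
  proof -
    have "inverse \<xi> * g * inverse \<xi> = \<tau>"
      by (rule flip[OF that(2)]) (use that(1) in \<open>simp add: mult.assoc\<close>)
    then have "\<xi> * (inverse \<xi> * g * inverse \<xi>) * \<xi> = \<xi> * \<tau> * \<xi>" by simp
    then show ?thesis by (simp add: mult.assoc \<tau>\<xi>')
  qed
  \<comment> \<open>Either the translated curve passes through the \<open>\<zeta>\<close>-face of \<open>1\<close>, where \<open>J 1 = J \<xi>\<close> leaves only the
    symmetries in the conclusion, or it does not.\<close>
  consider "v \<in> Z" | "v * \<xi> \<in> Z" | "v \<notin> Z" "v * \<xi> \<notin> Z" by blast
  then show ?thesis
  proof cases
    assume v: "v \<in> Z"
    have "J 1 = E v"
      using J[of 1] E0[OF \<xi>Z] E0[OF nZ(1)[OF v]] E1 by simp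
    moreover have "J \<xi> = 0" if "v \<noteq> \<tau>"
      using J[of \<xi>] E0[OF \<xi>Z] E0[OF sqZ] E0[OF nZ(3)[OF v]] E0[of "\<xi> * v * \<xi>"] flip[OF v] that
      by auto
    ultimately show ?thesis using J_inv[of 1] E\<zeta>[OF v] concl by auto
  next
    assume w: "v * \<xi> \<in> Z"
    have v: "v = (v * \<xi>) * inverse \<xi>" by (simp add: mult.assoc)
    have "v \<notin> Z" using nZ(2)[OF w] v by simp
    then have "J 1 = - E (v * \<xi>)"
      using J[of 1] E0[OF \<xi>Z] E0[of v] E1 by simp
    moreover have "J \<xi> = 0" if "v * \<xi> \<noteq> 1"
    proof -
      have "\<xi> * v \<notin> Z" using conj'[OF w] that v by (metis mult.assoc)
      moreover have "\<xi> * v * \<xi> \<notin> Z" using nZ(3)[OF w] by (simp add: mult.assoc)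
      ultimately show ?thesis
        using J[of \<xi>] E0[OF \<xi>Z] E0[OF sqZ] E0 by simp
    qed
    ultimately show ?thesis using J_inv[of 1] E\<zeta>[OF w] concl by auto
  next
    assume v: "v \<notin> Z" "v * \<xi> \<notin> Z"
    \<comment> \<open>Only the translated curve can compensate, at \<open>\<xi> \<zeta>\<close> and at \<open>\<xi>\<inverse> \<zeta>\<close>, for the crossing seen at \<open>\<zeta>\<close>.
      This fixes the cosets \<open>v Z\<close>, \<open>v \<xi> Z\<close> up to order, and the crossing at \<open>\<zeta> \<xi>\<inverse>\<close> fixes them
      a second time. The two descriptions differ by the factor \<open>\<xi>\<close>, which therefore permutes two cosets
      of \<open>Z\<close>; so \<open>\<xi>\<^sup>2\<close> preserves both, and \<open>conj2\<close> rules this out.\<close>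
    define R where "R a b \<longleftrightarrow> inverse a * b \<in> Z" for a b
    have Rsym: "R b a" if "R a b" for a b
      using that Zi[of "inverse a * b"] by (simp add: R_def)
    have Rtrans: "R a c" if "R a b" "R b c" for a b c
      using that Zm[of "inverse a * b" "inverse b * c"] by (simp add: R_def mult.assoc)
    have Rl: "R (c * a) (c * b) \<longleftrightarrow> R a b" for a b c
      by (simp add: R_def mult.assoc)
    have "\<zeta> \<noteq> 1" using \<open>\<tau> \<noteq> 1\<close> \<tau> by auto
    have "\<zeta> \<noteq> \<tau>" using not_inv \<tau>\<xi> by auto
    define P where "P = inverse \<zeta> * inverse \<xi>"
    define Q where "Q = inverse \<zeta> * \<xi>"
    have "J \<zeta> = E \<zeta>"
      using J[of \<zeta>] E0[OF nZ(1)[OF \<zeta>Z]] Zml[OF \<zeta>Z] v E0 by (simp add: mult.assoc)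
    then have J\<zeta>: "J \<zeta> \<noteq> 0" using E\<zeta>[OF \<zeta>Z] \<open>\<zeta> \<noteq> 1\<close> \<open>\<zeta> \<noteq> \<tau>\<close> by simp
    have "J (\<xi> * \<zeta>) \<noteq> 0" using J_inv[of \<zeta>] J\<zeta> by simp
    moreover have "\<xi> * \<zeta> * \<xi> \<notin> Z" using flip \<zeta>Z \<open>\<zeta> \<noteq> \<tau>\<close> by blast
    ultimately have "\<xi> * \<zeta> * v \<in> Z \<or> \<xi> * \<zeta> * v * \<xi> \<in> Z"
      using J[of "\<xi> * \<zeta>"] E0 nZ(3)[OF \<zeta>Z] by fastforce
    then have c1: "R P v \<or> R P (v * \<xi>)"
      by (simp add: R_def P_def mult.assoc)
    have "J (inverse \<xi> * \<zeta>) \<noteq> 0" using J_inv[of "inverse \<xi> * \<zeta>"] J\<zeta> by simp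
    moreover have "inverse \<xi> * \<zeta> * \<xi> \<notin> Z" using conj \<zeta>Z \<open>\<zeta> \<noteq> 1\<close> by blast
    ultimately have "inverse \<xi> * \<zeta> * v \<in> Z \<or> inverse \<xi> * \<zeta> * v * \<xi> \<in> Z"
      using J[of "inverse \<xi> * \<zeta>"] E0 nZ(4)[OF \<zeta>Z] by fastforce
    then have c2: "R Q v \<or> R Q (v * \<xi>)"
      by (simp add: R_def Q_def mult.assoc)
    have PQ: "\<not> R P Q"
      using Zinv sqZ by (simp add: R_def P_def Q_def mult.assoc)
    have c: "(R P v \<and> R Q (v * \<xi>)) \<or> (R P (v * \<xi>) \<and> R Q v)"
      using c1 c2 PQ Rsym Rtrans by blast
    have "\<not> R \<xi> P"
      using flip'[OF Zi[OF \<zeta>Z]] \<open>\<zeta> \<noteq> \<tau>\<close> inv\<tau> inverse_eq_swap[of \<zeta> \<tau>] by (auto simp: R_def P_def mult.assoc)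
    moreover have "\<not> R \<xi> Q"
      using conj[OF Zi[OF \<zeta>Z]] \<open>\<zeta> \<noteq> 1\<close> inverse_eq_swap[of \<zeta> 1] by (auto simp: R_def Q_def mult.assoc)
    ultimately have nv: "\<not> R \<xi> v" "\<not> R \<xi> (v * \<xi>)"
      using c Rsym Rtrans by blast+
    have "J (\<zeta> * inverse \<xi>) = - E \<zeta>"
    proof -
      have "\<zeta> * inverse \<xi> * v \<notin> Z" "\<zeta> * inverse \<xi> * v * \<xi> \<notin> Z"
        using nv Zml[OF \<zeta>Z] by (simp_all add: R_def mult.assoc)
      then show ?thesis
        using J[of "\<zeta> * inverse \<xi>"] E0 nZ(2)[OF \<zeta>Z] by (simp add: mult.assoc)
    qed
    then have J\<zeta>': "J (\<zeta> * inverse \<xi>) \<noteq> 0" using E\<zeta>[OF \<zeta>Z] \<open>\<zeta> \<noteq> 1\<close> \<open>\<zeta> \<noteq> \<tau>\<close> by simp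
    have "J (\<xi> * (\<zeta> * inverse \<xi>)) \<noteq> 0" using J_inv J\<zeta>' by simp
    moreover have "\<xi> * (\<zeta> * inverse \<xi>) \<notin> Z"
      using conj'[OF \<zeta>Z] \<open>\<zeta> \<noteq> 1\<close> by (auto simp: mult.assoc)
    moreover have "\<xi> * (\<zeta> * inverse \<xi>) * \<xi> \<notin> Z" using nZ(3)[OF \<zeta>Z] by (simp add: mult.assoc)
    ultimately have "\<xi> * (\<zeta> * inverse \<xi>) * v \<in> Z \<or> \<xi> * (\<zeta> * inverse \<xi>) * v * \<xi> \<in> Z"
      using J[of "\<xi> * (\<zeta> * inverse \<xi>)"] E0 by fastforce
    then have d1: "R (\<xi> * P) v \<or> R (\<xi> * P) (v * \<xi>)"
      by (simp add: R_def P_def mult.assoc)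
    have "J (inverse \<xi> * (\<zeta> * inverse \<xi>)) \<noteq> 0"
      using J_inv[of "inverse \<xi> * (\<zeta> * inverse \<xi>)"] J\<zeta>' by simp
    moreover have "inverse \<xi> * (\<zeta> * inverse \<xi>) \<notin> Z"
      using flip'[OF \<zeta>Z] \<open>\<zeta> \<noteq> \<tau>\<close> by (auto simp: mult.assoc)
    moreover have "inverse \<xi> * (\<zeta> * inverse \<xi>) * \<xi> \<notin> Z" using nZ(4)[OF \<zeta>Z] by (simp add: mult.assoc)
    ultimately have "inverse \<xi> * (\<zeta> * inverse \<xi>) * v \<in> Z \<or> inverse \<xi> * (\<zeta> * inverse \<xi>) * v * \<xi> \<in> Z"
      using J[of "inverse \<xi> * (\<zeta> * inverse \<xi>)"] E0 by fastforce
    then have d2: "R (\<xi> * Q) v \<or> R (\<xi> * Q) (v * \<xi>)"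
      by (simp add: R_def Q_def mult.assoc)
    have "\<not> R (\<xi> * P) (\<xi> * Q)" using PQ by (simp only: Rl not_False_eq_True)
    then have d: "(R (\<xi> * P) v \<and> R (\<xi> * Q) (v * \<xi>)) \<or> (R (\<xi> * P) (v * \<xi>) \<and> R (\<xi> * Q) v)"
      using d1 d2 Rsym Rtrans by blast
    have "(R (\<xi> * P) P \<and> R (\<xi> * Q) Q) \<or> (R (\<xi> * P) Q \<and> R (\<xi> * Q) P)"
      using c d Rsym Rtrans by meson
    then have "R (\<xi> * (\<xi> * P)) P \<and> R (\<xi> * (\<xi> * Q)) Q"
      using Rl Rtrans by meson
    then have PP: "R P (\<xi> * (\<xi> * P))" "R Q (\<xi> * (\<xi> * Q))"
      using Rsym by blast+
    define g where "g = inverse P * (\<xi> * (\<xi> * P))"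
    have "g \<in> Z" using PP(1) by (simp add: R_def g_def)
    moreover have "inverse (\<xi> * \<xi>) * g * (\<xi> * \<xi>) \<in> Z"
      using PP(2) by (simp add: R_def g_def P_def Q_def mult.assoc)
    ultimately have "g = 1" by (rule conj2)
    then have "P * g * inverse P = 1" by simp
    then have "\<xi> * \<xi> = 1" by (simp add: g_def mult.assoc)
    then show ?thesis using sq1 by simp
  qed
qed

section \<open>Nonabelian simple groups\<close>

definition subgrp :: "'a::group_mult set \<Rightarrow> bool" where
  "subgrp S \<longleftrightarrow> 1 \<in> S \<and> (\<forall>a\<in>S. \<forall>b\<in>S. a * b \<in> S) \<and> (\<forall>a\<in>S. inverse a \<in> S)"

definition normal_in :: "'a::group_mult set \<Rightarrow> 'a set \<Rightarrow> bool" where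
  "normal_in N T \<longleftrightarrow> subgrp N \<and> N \<subseteq> T \<and> (\<forall>t\<in>T. \<forall>g\<in>N. t * g * inverse t \<in> N)"

definition nonabelian_simple :: "'a::group_mult set \<Rightarrow> bool" where
  "nonabelian_simple T \<longleftrightarrow> subgrp T \<and> (\<exists>a\<in>T. \<exists>b\<in>T. a * b \<noteq> b * a)
     \<and> (\<forall>N. normal_in N T \<longrightarrow> N = {1} \<or> N = T)"

lemma subgrpD:
  assumes "subgrp S"
  shows "1 \<in> S" "a \<in> S \<Longrightarrow> b \<in> S \<Longrightarrow> a * b \<in> S" "a \<in> S \<Longrightarrow> inverse a \<in> S"
  using assms by (auto simp: subgrp_def)

lemma nonabelian_simple_centre:
  assumes T: "nonabelian_simple T" and g: "g \<in> T" "\<And>t. t \<in> T \<Longrightarrow> g * t = t * g"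
  shows "g = 1"
proof -
  define N where "N = {g \<in> T. \<forall>t\<in>T. g * t = t * g}"
  have sT: "subgrp T" using T by (simp add: nonabelian_simple_def)
  have "subgrp N"
    unfolding subgrp_def
  proof (intro conjI ballI)
    show "1 \<in> N" using subgrpD(1)[OF sT] by (simp add: N_def)
    show "a * b \<in> N" if ab: "a \<in> N" "b \<in> N" for a b
    proof -
      have "a * b * t = t * (a * b)" if "t \<in> T" for t
      proof -
        have "b * t = t * b" "a * t = t * a" using ab that by (auto simp: N_def)
        then have "a * (b * t) = (t * a) * b" by (simp flip: mult.assoc)
        then show ?thesis by (simp add: mult.assoc)
      qed
      then show ?thesis using ab subgrpD(2)[OF sT] unfolding N_def by blast
    qed
    show "inverse a \<in> N" if a: "a \<in> N" for a
    proof -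
      have "inverse a * t = t * inverse a" if "t \<in> T" for t
      proof -
        have "inverse a * (t * a) * inverse a = inverse a * (a * t) * inverse a"
          using a that unfolding N_def by auto
        then show ?thesis by (simp add: mult.assoc)
      qed
      then show ?thesis using a subgrpD(3)[OF sT] unfolding N_def by blast
    qed
  qed
  moreover have "t * g * inverse t = g" if "t \<in> T" "g \<in> N" for t g
  proof -
    have "t * g = g * t" using that by (simp add: N_def)
    then show ?thesis by (simp add: mult.assoc)
  qed
  ultimately have "normal_in N T" by (auto simp: normal_in_def N_def)
  then have "N = {1} \<or> N = T" using T by (simp add: nonabelian_simple_def)
  moreover have "N \<noteq> T" using T by (auto simp: nonabelian_simple_def N_def)
  moreover have "g \<in> N" using g by (simp add: N_def)
  ultimately show ?thesis by blast
qed

text \<open>Excludes dihedral groups: a cyclic normal subgroup is trivial, since the whole group is not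
  abelian.\<close>

lemma nonabelian_simple_no_normal_cyclic:
  assumes T: "nonabelian_simple T" and g: "g \<in> T" "g ^ n = 1" "n > 0"
    and conj: "\<And>t. t \<in> T \<Longrightarrow> \<exists>i::nat. t * g * inverse t = g ^ i"
  shows "g = 1"
proof -
  define N where "N = range (\<lambda>i::nat. g ^ i)"
  have sT: "subgrp T" using T by (simp add: nonabelian_simple_def)
  have "subgrp N"
    unfolding subgrp_def
  proof (intro conjI ballI)
    show "1 \<in> N" using rangeI[of "\<lambda>i. g ^ i" 0] by (simp add: N_def)
    show "a * b \<in> N" if "a \<in> N" "b \<in> N" for a b
      using that by (auto simp: N_def simp flip: power_add)
    show "inverse a \<in> N" if "a \<in> N" for a
    proof -
      obtain i where i: "a = g ^ i" using \<open>a \<in> N\<close> by (auto simp: N_def)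
      have "i + i * (n - 1) = n * i" using g(3) by (cases n) auto
      then have "a * g ^ (i * (n - 1)) = (g ^ n) ^ i"
        by (simp add: i flip: power_add power_mult)
      then have "inverse a = g ^ (i * (n - 1))"
        using g(2) by (metis mult_inverse_cancel(1) mult_1_right power_one)
      then show ?thesis by (simp add: N_def)
    qed
  qed
  moreover have "N \<subseteq> T"
  proof -
    have "g ^ i \<in> T" for i by (induction i) (simp_all add: sT subgrpD g(1))
    then show ?thesis by (auto simp: N_def)
  qed
  moreover have "t * a * inverse t \<in> N" if "t \<in> T" "a \<in> N" for t a
  proof -
    obtain i where i: "a = g ^ i" using \<open>a \<in> N\<close> by (auto simp: N_def)
    obtain j where j: "t * g * inverse t = g ^ j" using conj[OF \<open>t \<in> T\<close>] by blast
    have "t * a * inverse t = g ^ (j * i)"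
      unfolding i conj_power[symmetric] j by (simp add: power_mult)
    then show ?thesis by (simp add: N_def)
  qed
  ultimately have "normal_in N T" by (simp add: normal_in_def)
  then have "N = {1} \<or> N = T" using T by (simp add: nonabelian_simple_def)
  moreover have "N \<noteq> T"
  proof
    assume "N = T"
    then obtain a b where ab: "a \<in> N" "b \<in> N" "a * b \<noteq> b * a"
      using T by (auto simp: nonabelian_simple_def)
    then show False by (auto simp: N_def add.commute simp flip: power_add)
  qed
  moreover have "g \<in> N" using rangeI[of "\<lambda>i. g ^ i" 1] by (simp add: N_def)
  ultimately show ?thesis by blast
qed

section \<open>Wreath products\<close>

instance Perm.perm :: (type) group_mult
  by standard (rule perm.left_inverse)

lemma perm_inverse_apply [simp]:
  "inverse s $ (s $ w) = w" "s $ (inverse s $ w) = w"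
  by (simp_all add: apply_inverse inv_f_f bij_is_inj surj_f_inv_f bij_is_surj)

text \<open>The element \<open>Wr f s\<close> stands for the permutation \<open>(i, w) \<mapsto> (f w i, s w)\<close> of pairs, and the product
  is composition from right to left: \<open>fib\<close> is a cocycle over \<open>top\<close>. Elements for which the pairs
  range over \<open>X \<times> \<Omega>\<close> are cut out by conditions on \<open>f\<close> and \<open>s\<close> where needed.\<close>

datatype ('w, 'a) wr = Wr (fib: "'w \<Rightarrow> 'a") (top: "'w perm")

instantiation wr :: (type, group_mult) group_mult
begin

definition "1 = Wr (\<lambda>_. 1) 1"
definition "g * h = Wr (\<lambda>w. fib g (top h $ w) * fib h w) (top g * top h)"
definition "inverse g = Wr (\<lambda>w. inverse (fib g (inverse (top g) $ w))) (inverse (top g))"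
definition "divide g h = g * inverse (h :: ('a, 'b) wr)"

instance
proof
  fix a b c :: "('a, 'b) wr"
  show "a * b * c = a * (b * c)"
    unfolding times_wr_def wr.sel wr.inject by (simp only: apply_times mult.assoc o_apply)
  show "1 * a = a" "a * 1 = a"
    unfolding times_wr_def one_wr_def by (cases a, simp)+
  show "inverse a * a = 1"
    unfolding times_wr_def one_wr_def inverse_wr_def wr.sel wr.inject
    by (simp only: perm_inverse_apply group_left_right_inverse)
qed

end

lemma wr_simps [simp]:
  "fib 1 w = 1" "top 1 = 1"
  "fib (g * h) w = fib g (top h $ w) * fib h w" "top (g * h) = top g * top h"
  "top (inverse g) = inverse (top g)"
  by (simp_all only: one_wr_def times_wr_def inverse_wr_def wr.sel)

lemma fib_inverse: "fib (inverse g) w = inverse (fib g (inverse (top g) $ w))"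
  by (simp only: inverse_wr_def wr.sel)

lemma fib_inverse' [simp]: "fib (inverse g) (top g $ w) = inverse (fib g w)"
  by (simp add: fib_inverse)

lemma wr_eqI: "g = h" if "top g = top h" "\<And>w. fib g w = fib h w" for g h :: "('w, 'a) wr"
  using that by (cases g; cases h) auto


section \<open>Subgroups of a wreath product with simple fibres\<close>

locale fibred_group =
  fixes \<Omega> :: "'w set" and T :: "'a::group_mult set" and H :: "('w, 'a) wr set"
  assumes H: "subgrp H"
    and top_in: "h \<in> H \<Longrightarrow> w \<in> \<Omega> \<Longrightarrow> top h $ w \<in> \<Omega>"
    and top_out: "h \<in> H \<Longrightarrow> w \<notin> \<Omega> \<Longrightarrow> top h $ w = w"
    and fib_in: "h \<in> H \<Longrightarrow> w \<in> \<Omega> \<Longrightarrow> fib h w \<in> T"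
    and fib_out: "h \<in> H \<Longrightarrow> w \<notin> \<Omega> \<Longrightarrow> fib h w = 1"
    and finite_\<Omega>: "finite \<Omega>" and card_\<Omega>: "card \<Omega> \<ge> 3"
    and two_transitive: "\<lbrakk>a \<in> \<Omega>; b \<in> \<Omega>; a' \<in> \<Omega>; b' \<in> \<Omega>; a \<noteq> b; a' \<noteq> b'\<rbrakk>
          \<Longrightarrow> \<exists>h\<in>H. top h $ a = a' \<and> top h $ b = b'"
    and stabiliser_onto: "\<lbrakk>w \<in> \<Omega>; t \<in> T\<rbrakk> \<Longrightarrow> \<exists>h\<in>H. top h $ w = w \<and> fib h w = t"
    and T: "nonabelian_simple T"
begin

definition K :: "('w, 'a) wr set" where
  "K = {h \<in> H. top h = 1}"

lemma subgrp_T: "subgrp T"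
  using T by (simp add: nonabelian_simple_def)

lemmas H_closed = subgrpD[OF H] and T_closed = subgrpD[OF subgrp_T]

lemma KI: "h \<in> H \<Longrightarrow> top h = 1 \<Longrightarrow> h \<in> K" by (simp add: K_def)

lemma KH: "k \<in> K \<Longrightarrow> k \<in> H" by (simp add: K_def)

lemma subgrp_K: "subgrp K"
  using H_closed by (auto simp: subgrp_def K_def)

lemmas K_closed = subgrpD[OF subgrp_K]

lemma K_conj: "h \<in> H \<Longrightarrow> k \<in> K \<Longrightarrow> h * k * inverse h \<in> K"
  using H_closed by (auto simp: K_def)

lemma K_mult [simp]: "k \<in> K \<Longrightarrow> fib (h * k) w = fib h w * fib k w"
  "k \<in> K \<Longrightarrow> fib (inverse k) w = inverse (fib k w)"
  "k \<in> K \<Longrightarrow> top k = 1"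
  by (auto simp: K_def fib_inverse)

lemma fib_conj: "k \<in> K \<Longrightarrow> fib (h * k * inverse h) (top h $ w) = fib h w * fib k w * inverse (fib h w)"
  by (simp add: apply_sequence mult.assoc del: wr_simps(4)) (simp add: apply_times)

lemma K_eqI: "k = k'" if "k \<in> K" "k' \<in> K" "\<And>w. w \<in> \<Omega> \<Longrightarrow> fib k w = fib k' w"
  using that fib_out[OF KH] by (intro wr_eqI) (auto, metis)

text \<open>Either this holds and \<open>K\<close> embeds into each single coordinate, or \<open>K\<close> is the full product.\<close>

definition faithful_coordinates :: bool where
  "faithful_coordinates \<longleftrightarrow> (\<forall>k\<in>K. \<forall>w\<in>\<Omega>. fib k w = 1 \<longrightarrow> k = 1)"

definition partial_fibre :: "'w set \<Rightarrow> 'w \<Rightarrow> 'a set" where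
  "partial_fibre S w = {fib k w | k. k \<in> K \<and> (\<forall>s\<in>S. fib k s = 1)}"

lemma subgrp_partial_fibre: "subgrp (partial_fibre S w)"
  unfolding subgrp_def
proof (intro conjI ballI)
  show "1 \<in> partial_fibre S w"
    using K_closed(1) by (auto simp: partial_fibre_def intro!: exI[of _ 1])
next
  fix a b assume "a \<in> partial_fibre S w" "b \<in> partial_fibre S w"
  then obtain k l where "k \<in> K" "l \<in> K" "\<forall>s\<in>S. fib k s = 1" "\<forall>s\<in>S. fib l s = 1" "a = fib k w" "b = fib l w"
    by (auto simp: partial_fibre_def)
  then show "a * b \<in> partial_fibre S w"
    using K_closed(2) unfolding partial_fibre_def by (intro CollectI exI[of _ "k * l"]) (simp del: wr_simps(3))
next
  fix a assume "a \<in> partial_fibre S w"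
  then obtain k where "k \<in> K" "\<forall>s\<in>S. fib k s = 1" "a = fib k w"
    by (auto simp: partial_fibre_def)
  then show "inverse a \<in> partial_fibre S w"
    using K_closed(3) unfolding partial_fibre_def by (intro CollectI exI[of _ "inverse k"]) simp
qed

lemma partial_fibre_subset: "w \<in> \<Omega> \<Longrightarrow> partial_fibre S w \<subseteq> T"
  using fib_in KH by (auto simp: partial_fibre_def)

lemma partial_fibre_empty:
  assumes w: "w \<in> \<Omega>" and ne: "\<exists>k\<in>K. fib k w \<noteq> 1"
  shows "partial_fibre {} w = T"
proof -
  have "normal_in (partial_fibre {} w) T"
    unfolding normal_in_def
  proof (intro conjI ballI subgrp_partial_fibre partial_fibre_subset w)
    fix t g assume t: "t \<in> T" and "g \<in> partial_fibre {} w"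
    then obtain k where k: "k \<in> K" "g = fib k w" by (auto simp: partial_fibre_def)
    obtain h where h: "h \<in> H" "top h $ w = w" "fib h w = t"
      using stabiliser_onto[OF w t] by blast
    have "t * g * inverse t = fib (h * k * inverse h) w"
      using fib_conj[OF k(1), of h w] h k(2) by simp
    then show "t * g * inverse t \<in> partial_fibre {} w"
      using K_conj[OF h(1) k(1)] unfolding partial_fibre_def by blast
  qed
  moreover have "partial_fibre {} w \<noteq> {1}" using ne by (auto simp: partial_fibre_def)
  ultimately show ?thesis using T by (auto simp: nonabelian_simple_def)
qed

text \<open>The values at \<open>w\<close> of the kernel elements that vanish on \<open>S\<close> form a normal subgroup. Conjugating by
  the stabiliser of \<open>w\<close> would move \<open>S\<close>; the kernel itself keeps \<open>S\<close> and already induces all of \<open>T\<close>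
  at \<open>w\<close>, by the case of empty \<open>S\<close>.\<close>

lemma partial_fibre_full:
  assumes w: "w \<in> \<Omega>" and ne: "\<exists>k\<in>K. fib k w \<noteq> 1 \<and> (\<forall>s\<in>S. fib k s = 1)"
  shows "partial_fibre S w = T"
proof -
  have all: "partial_fibre {} w = T" using partial_fibre_empty w ne by blast
  have "normal_in (partial_fibre S w) T"
    unfolding normal_in_def
  proof (intro conjI ballI subgrp_partial_fibre partial_fibre_subset w)
    fix t g assume t: "t \<in> T" and "g \<in> partial_fibre S w"
    then obtain k where k: "k \<in> K" "g = fib k w" "\<forall>s\<in>S. fib k s = 1" by (auto simp: partial_fibre_def)
    obtain h where h: "h \<in> K" "fib h w = t"
      using t all by (auto simp: partial_fibre_def)
    have c: "fib (h * k * inverse h) v = fib h v * fib k v * inverse (fib h v)" for v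
      using fib_conj[OF k(1), of h v] h by simp
    then have "t * g * inverse t = fib (h * k * inverse h) w" using h k by simp
    moreover have "\<forall>s\<in>S. fib (h * k * inverse h) s = 1"
      using c k(3) by simp
    ultimately show "t * g * inverse t \<in> partial_fibre S w"
      using K_conj[OF KH[OF h(1)] k(1)] unfolding partial_fibre_def by blast
  qed
  moreover have "partial_fibre S w \<noteq> {1}" using ne by (auto simp: partial_fibre_def)
  ultimately show ?thesis using T by (auto simp: nonabelian_simple_def)
qed

text \<open>A kernel element with a trivial and a nontrivial coordinate can be moved, by double
  transitivity, to any pair of coordinates. The commutator of two elements that vanish on \<open>S\<close> and
  at \<open>s\<close> vanishes on both, and can be chosen nontrivial at \<open>w\<close> as \<open>T\<close> is not abelian. So every
  coordinate subgroup lies in \<open>K\<close>.\<close>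

theorem unfaithful_imp_full:
  assumes nf: "\<not> faithful_coordinates" and f: "\<And>w. w \<in> \<Omega> \<Longrightarrow> f w \<in> T"
  shows "\<exists>k\<in>K. \<forall>w\<in>\<Omega>. fib k w = f w"
proof -
  obtain k0 w0 where k0: "k0 \<in> K" "w0 \<in> \<Omega>" "fib k0 w0 = 1" "k0 \<noteq> 1"
    using nf by (auto simp: faithful_coordinates_def)
  obtain w1 where w1: "w1 \<in> \<Omega>" "fib k0 w1 \<noteq> 1"
    using K_eqI[OF k0(1) K_closed(1)] k0(4) by auto
  have sep: "\<exists>k\<in>K. fib k w \<noteq> 1 \<and> fib k s = 1" if ws: "w \<in> \<Omega>" "s \<in> \<Omega>" "w \<noteq> s" for w s
  proof -
    obtain h where h: "h \<in> H" "top h $ w0 = s" "top h $ w1 = w"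
      using two_transitive[of w0 w1 s w] k0 w1 ws by auto
    have "fib (h * k0 * inverse h) s = 1"
      using fib_conj[OF k0(1), of h w0] h k0(3) by simp
    moreover have "fib (h * k0 * inverse h) w = fib h w1 * fib k0 w1 * inverse (fib h w1)"
      using fib_conj[OF k0(1), of h w1] h by simp
    moreover have "fib h w1 * fib k0 w1 * inverse (fib h w1) \<noteq> 1"
    proof
      assume "fib h w1 * fib k0 w1 * inverse (fib h w1) = 1"
      then have "inverse (fib h w1) * (fib h w1 * fib k0 w1 * inverse (fib h w1)) * fib h w1 = 1" by simp
      then show False using w1(2) by (simp add: mult.assoc)
    qed
    ultimately show ?thesis using K_conj[OF h(1) k0(1)] by metis
  qed
  have pf: "partial_fibre S w = T" if w: "w \<in> \<Omega>" and S: "finite S" "S \<subseteq> \<Omega> - {w}" for S w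
    using S
  proof (induction S rule: finite_induct)
    case empty
    obtain s where s: "s \<in> \<Omega>" "s \<noteq> w"
      using k0(2,3) w1 by metis
    then show ?case using partial_fibre_empty[OF w] sep[OF w] by blast
  next
    case (insert s S)
    obtain g g' where g: "g \<in> T" "g' \<in> T" "g * g' \<noteq> g' * g" using T by (auto simp: nonabelian_simple_def)
    have "partial_fibre {s} w = T"
      using partial_fibre_full[OF w, of "{s}"] sep[OF w, of s] insert.prems by auto
    then obtain k where k: "k \<in> K" "fib k w = g" "fib k s = 1"
      using g(1) by (auto simp: partial_fibre_def)
    have "partial_fibre S w = T" using insert by auto
    then obtain k' where k': "k' \<in> K" "fib k' w = g'" "\<forall>x\<in>S. fib k' x = 1"
      using g(2) by (auto simp: partial_fibre_def)
    define c where "c = k * k' * inverse k * inverse k'"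
    have cK: "c \<in> K" using k k' K_closed by (simp add: c_def)
    have c: "fib c x = fib k x * fib k' x * inverse (fib k x) * inverse (fib k' x)" for x
      using k(1) k'(1) K_closed by (simp add: c_def del: wr_simps(3))
    have "fib c w \<noteq> 1"
    proof
      assume "fib c w = 1"
      then have "fib c w * g' * g = g' * g" by simp
      then show False using g(3) by (simp add: c k k' mult.assoc)
    qed
    moreover have "\<forall>x\<in>insert s S. fib c x = 1" using k k' by (simp add: c)
    ultimately show ?case using partial_fibre_full[OF w] cK by blast
  qed
  have "\<exists>k\<in>K. \<forall>w\<in>\<Omega>. fib k w = (if w \<in> A then f w else 1)" if "finite A" "A \<subseteq> \<Omega>" for A
    using that
  proof (induction A rule: finite_induct)
    case empty
    then show ?case using K_closed(1) by (intro bexI[of _ 1]) auto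
  next
    case (insert w A)
    then obtain k where k: "k \<in> K" "\<forall>v\<in>\<Omega>. fib k v = (if v \<in> A then f v else 1)" by auto
    have "partial_fibre (\<Omega> - {w}) w = T" using pf[of w "\<Omega> - {w}"] insert.prems finite_\<Omega> by auto
    then obtain k' where k': "k' \<in> K" "fib k' w = f w" "\<forall>x\<in>\<Omega> - {w}. fib k' x = 1"
      using f[of w] insert.prems by (fastforce simp: partial_fibre_def)
    show ?case
    proof (intro bexI ballI)
      show "k * k' \<in> K" using K_closed(2) k k' by blast
      show "fib (k * k') v = (if v \<in> insert w A then f v else 1)" if "v \<in> \<Omega>" for v
        using that k k' insert.hyps by (cases "v = w") (simp_all del: wr_simps(3))
    qed
  qed
  from this[OF finite_\<Omega> subset_refl] show ?thesis by auto
qed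

end

lemma conj_mult: "g * h * l * inverse (g * h) = g * (h * l * inverse h) * inverse g"
  for g h l :: "'a::group_mult"
  by (simp add: mult.assoc)

context fibred_group
begin

lemma faithful_inj:
  assumes "faithful_coordinates" "k \<in> K" "k' \<in> K" "w \<in> \<Omega>" "fib k w = fib k' w"
  shows "k = k'"
proof -
  have "inverse k' * k \<in> K" using assms K_closed by blast
  moreover have "fib (inverse k' * k) w = 1" using assms by (simp del: wr_simps(3))
  ultimately have "inverse k' * k = 1"
    using assms(1,4) by (auto simp: faithful_coordinates_def)
  then have "k' * (inverse k' * k) = k'" by simp
  then show ?thesis by simp
qed

lemma faithful_cases:
  assumes "faithful_coordinates"
  obtains "K = {1}" | "\<And>w t. w \<in> \<Omega> \<Longrightarrow> t \<in> T \<Longrightarrow> \<exists>k\<in>K. fib k w = t"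
proof (cases "K = {1}")
  case False
  then obtain k where k: "k \<in> K" "k \<noteq> 1" using K_closed(1) by blast
  have "partial_fibre {} w = T" if "w \<in> \<Omega>" for w
    using partial_fibre_empty[OF that] k assms that by (auto simp: faithful_coordinates_def)
  then have "\<exists>k\<in>K. fib k w = t" if "w \<in> \<Omega>" "t \<in> T" for w t
    using that by (force simp: partial_fibre_def)
  then show ?thesis using that(2) by blast
qed

text \<open>With trivial kernel the stabiliser of \<open>w\<close> is faithful on the base, hence simple, and so its
  homomorphism onto \<open>T\<close> is injective.\<close>

lemma card_of_trivial_kernel:
  assumes K1: "K = {1}" and w: "w \<in> \<Omega>"
    and A: "nonabelian_simple (top ` {h \<in> H. top h $ w = w})"
  shows "card T = card (top ` {h \<in> H. top h $ w = w})"
proof -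
  define S where "S = {h \<in> H. top h $ w = w}"
  have inj: "h = h'" if "h \<in> H" "h' \<in> H" "top h = top h'" for h h'
  proof -
    have "inverse h' * h \<in> K" using that H_closed by (intro KI) auto
    then have "h' * (inverse h' * h) = h'" using K1 by simp
    then show ?thesis by simp
  qed
  have S: "1 \<in> S" "g * h \<in> S" "inverse g \<in> S" if "g \<in> S" "h \<in> S" for g h
    using that H_closed apply_inj[of "top g" "inverse (top g) $ w" w]
    by (auto simp: S_def apply_times)
  have fibm: "fib (g * h) w = fib g w * fib h w" if "h \<in> S" for g h
    using that by (simp add: S_def)
  have fibi: "fib (inverse g) w = inverse (fib g w)" if "g \<in> S" for g
    using that fib_inverse'[of g w] by (simp add: S_def)
  define N where "N = top ` {h \<in> S. fib h w = 1}"
  have "subgrp N"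
    unfolding subgrp_def
  proof (intro conjI ballI)
    have "1 \<in> {h \<in> S. fib h w = 1}" using H_closed(1) by (simp add: S_def)
    from imageI[OF this, of top] show "1 \<in> N" by (simp add: N_def)
    show "a * b \<in> N" if ab: "a \<in> N" "b \<in> N" for a b
    proof -
      obtain g h where "g \<in> S" "fib g w = 1" "a = top g" "h \<in> S" "fib h w = 1" "b = top h"
        using ab by (auto simp: N_def)
      then have "a * b = top (g * h)" "g * h \<in> {h \<in> S. fib h w = 1}"
        using S(2) fibm by auto
      then show ?thesis unfolding N_def by blast
    qed
    show "inverse a \<in> N" if aN: "a \<in> N" for a
    proof -
      obtain g where "g \<in> S" "fib g w = 1" "a = top g"
        using aN by (auto simp: N_def)
      then have "inverse a = top (inverse g)" "inverse g \<in> {h \<in> S. fib h w = 1}"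
        using S(3) fibi by auto
      then show ?thesis unfolding N_def by blast
    qed
  qed
  moreover have "N \<subseteq> top ` S" by (auto simp: N_def)
  moreover have "t * a * inverse t \<in> N" if ta: "t \<in> top ` S" "a \<in> N" for t a
  proof -
    obtain g h where gh: "g \<in> S" "t = top g" "h \<in> S" "fib h w = 1" "a = top h"
      using ta by (auto simp: N_def)
    have "inverse g \<in> S" "g * h \<in> S" using S gh by auto
    then have "fib (g * h * inverse g) w = 1" "g * h * inverse g \<in> S"
      using S(2) fibm[of "inverse g" "g * h"] fibm[of h g] fibi[of g] gh by simp_all
    then show ?thesis unfolding N_def gh(2,5) by (force intro!: image_eqI[of _ _ "g * h * inverse g"])
  qed
  ultimately have "normal_in N (top ` S)" by (simp add: normal_in_def)
  then have "N = {1} \<or> N = top ` S" using A by (simp add: nonabelian_simple_def S_def)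
  moreover have "N \<noteq> top ` S"
  proof
    assume "N = top ` S"
    have "fib h w = 1" if h: "h \<in> S" for h
    proof -
      have "top h \<in> N" using h \<open>N = top ` S\<close> by blast
      then obtain h' where h': "h' \<in> S" "fib h' w = 1" "top h = top h'" by (auto simp: N_def)
      have "h = h'" by (rule inj) (use h h' in \<open>simp_all add: S_def\<close>)
      then show ?thesis using h' by simp
    qed
    then have "t = 1" if "t \<in> T" for t
      using stabiliser_onto[OF w that] unfolding S_def by blast
    then show False using T by (auto simp: nonabelian_simple_def)
  qed
  ultimately have N1: "N = {1}" by blast
  have "inj_on top S" using inj by (auto simp: inj_on_def S_def)
  moreover have "inj_on (\<lambda>h. fib h w) S"
  proof (rule inj_onI)
    fix g h assume gh: "g \<in> S" "h \<in> S" "fib g w = fib h w"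
    have "inverse g * h \<in> S" using S gh by blast
    moreover have "fib (inverse g * h) w = 1" using fibm[of h "inverse g"] fibi gh by simp
    ultimately have "top (inverse g * h) \<in> N" unfolding N_def by blast
    then have "inverse (top g) * top h = 1" using N1 by simp
    then have "top g * (inverse (top g) * top h) = top g" by simp
    then show "g = h" using inj gh by (simp add: S_def)
  qed
  moreover have "(\<lambda>h. fib h w) ` S = T"
    using stabiliser_onto[OF w] fib_in w by (auto simp: S_def image_iff)
  ultimately have "card T = card (top ` S)" by (metis card_image)
  then show ?thesis by (simp add: S_def)
qed

end

section \<open>Diagonal kernels\<close>

locale diagonal_group = fibred_group +
  fixes w0
  assumes faithful: "faithful_coordinates"
    and K_onto: "w \<in> \<Omega> \<Longrightarrow> t \<in> T \<Longrightarrow> \<exists>k\<in>K. fib k w = t"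
    and w0: "w0 \<in> \<Omega>"
begin

lemmas K_inj = faithful_inj[OF faithful]

definition C where "C = {c \<in> H. \<forall>k\<in>K. c * k = k * c}"

lemma CH: "c \<in> C \<Longrightarrow> c \<in> H" by (simp add: C_def)

lemma C_commute: "c \<in> C \<Longrightarrow> k \<in> K \<Longrightarrow> c * k = k * c" by (simp add: C_def)

lemma C_mult: "c * c' \<in> C" if "c \<in> C" "c' \<in> C"
proof -
  have "c * c' * k = k * (c * c')" if "k \<in> K" for k
  proof -
    have "c * (c' * k) = (c * k) * c'" using C_commute[OF \<open>c' \<in> C\<close> that] by (simp add: mult.assoc)
    then show ?thesis using C_commute[OF \<open>c \<in> C\<close> that] by (simp add: mult.assoc)
  qed
  then show ?thesis using that H_closed(2) CH unfolding C_def by blast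
qed

lemma C_inverse: "inverse c \<in> C" if c: "c \<in> C"
proof -
  have "inverse c * k = k * inverse c" if "k \<in> K" for k
  proof -
    have "inverse c * (c * k) * inverse c = inverse c * (k * c) * inverse c"
      using C_commute[OF c that] by simp
    then show ?thesis by (simp add: mult.assoc)
  qed
  then show ?thesis using c H_closed(3) CH unfolding C_def by blast
qed

text \<open>Some \<open>k \<in> K\<close> acts on the fibre of \<open>w\<close> as \<open>h\<close> does. Then \<open>k\<inverse> h\<close> commutes with \<open>K\<close> in the coordinate
  \<open>w\<close>, and one coordinate determines an element of \<open>K\<close>.\<close>

lemma stabiliser_decomposition:
  assumes h: "h \<in> H" and w: "w \<in> \<Omega>" "top h $ w = w"
  obtains k c where "k \<in> K" "c \<in> C" "h = k * c"
proof -
  obtain k where k: "k \<in> K" "fib k w = fib h w" using K_onto[OF w(1)] fib_in[OF h w(1)] by blast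
  define c where "c = inverse k * h"
  have cH: "c \<in> H" using h k KH H_closed by (simp add: c_def)
  have c: "top c $ w = w" "fib c w = 1"
    using w k KH by (simp_all add: c_def)
  have "c * l = l * c" if l: "l \<in> K" for l
  proof -
    have "fib (c * l * inverse c) w = fib l w"
      using fib_conj[OF l, of c w] c by simp
    then have "c * l * inverse c = l" using K_inj[OF K_conj[OF cH l] l w(1)] by simp
    then have "c * l * inverse c * c = l * c" by simp
    then show ?thesis by (simp add: mult.assoc)
  qed
  then have "c \<in> C" using cH by (simp add: C_def)
  moreover have "h = k * c" by (simp add: c_def)
  ultimately show ?thesis using that k(1) by blast
qed

text \<open>Point stabilisers generate a doubly transitive group on at least three points, and each of them
  lies in \<open>K C\<close>.\<close>

lemma decomposition:
  assumes h: "h \<in> H"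
  obtains k c where "k \<in> K" "c \<in> C" "h = k * c"
proof (cases "top h $ w0 = w0")
  case True
  then show ?thesis using stabiliser_decomposition[OF h w0] that by blast
next
  case False
  define w1 where "w1 = top h $ w0"
  have w1: "w1 \<in> \<Omega>" "w1 \<noteq> w0" using False top_in[OF h w0] by (simp_all add: w1_def)
  obtain w2 where w2: "w2 \<in> \<Omega>" "w2 \<noteq> w0" "w2 \<noteq> w1"
  proof -
    have "\<not> \<Omega> \<subseteq> {w0, w1}"
    proof
      assume "\<Omega> \<subseteq> {w0, w1}"
      then have "card \<Omega> \<le> card {w0, w1}" by (intro card_mono) auto
      then show False using card_\<Omega> card_insert_le_m1[of 2 "{w1}" w0] by simp
    qed
    then show ?thesis using that by blast
  qed
  obtain g where g: "g \<in> H" "top g $ w0 = w1" "top g $ w2 = w2"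
    using two_transitive[of w0 w2 w1 w2] w0 w1 w2 by auto
  define f where "f = inverse g * h"
  have f: "f \<in> H" using g h H_closed by (simp add: f_def)
  have "top f $ w0 = inverse (top g) $ (top g $ w0)"
    by (simp only: f_def wr_simps apply_times o_apply w1_def[symmetric] g(2))
  then have f': "top f $ w0 = w0" by simp
  obtain k c where kc: "k \<in> K" "c \<in> C" "g = k * c" using stabiliser_decomposition[OF g(1) w2(1) g(3)] .
  obtain k' c' where kc': "k' \<in> K" "c' \<in> C" "f = k' * c'" using stabiliser_decomposition[OF f w0 f'] .
  have "h = g * f" by (simp add: f_def)
  also have "\<dots> = k * (c * k') * c'" by (simp add: kc kc' mult.assoc)
  also have "\<dots> = (k * k') * (c * c')" by (simp add: C_commute[OF kc(2) kc'(1)] mult.assoc)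
  finally show ?thesis using that[of "k * k'" "c * c'"] C_mult kc kc' K_closed(2) by blast
qed

lemma C_transitive:
  assumes "w \<in> \<Omega>"
  shows "\<exists>c\<in>C. top c $ w0 = w"
proof -
  have "\<exists>h\<in>H. top h $ w0 = w"
  proof -
    have "\<Omega> - {w} \<noteq> {}" "\<Omega> - {w0} \<noteq> {}"
      using card_\<Omega> card_mono[of "{w}" \<Omega>] card_mono[of "{w0}" \<Omega>] by auto
    then obtain x y where "x \<in> \<Omega>" "x \<noteq> w0" "y \<in> \<Omega>" "y \<noteq> w" by blast
    then show ?thesis using two_transitive[of w0 x w y] w0 assms by blast
  qed
  then obtain h where "h \<in> H" "top h $ w0 = w" by blast
  moreover obtain k c where "k \<in> K" "c \<in> C" "h = k * c" using decomposition[OF \<open>h \<in> H\<close>] .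
  ultimately show ?thesis by (intro bexI[of _ c]) simp_all
qed

lemma C_stabiliser_trivial:
  assumes c: "c \<in> C" "w \<in> \<Omega>" "top c $ w = w"
  shows "fib c w = 1"
proof (rule nonabelian_simple_centre[OF T fib_in[OF CH[OF c(1)] c(2)]])
  fix t assume "t \<in> T"
  then obtain k where k: "k \<in> K" "fib k w = t" using K_onto c(2) by blast
  have "fib (c * k) w = fib (k * c) w" using C_commute[OF c(1) k(1)] by simp
  then show "fib c w * t = t * fib c w" using k c(3) by simp
qed

text \<open>An element of \<open>C\<close> that fixes \<open>w\<close> acts trivially on the fibre of \<open>w\<close>, so \<open>C\<close> identifies the fibres of
  \<open>w\<close> and \<open>w0\<close> in a unique way.\<close>

definition section_at :: "'a \<Rightarrow> 'b" where
  "section_at w = inverse (fib (SOME c. c \<in> C \<and> top c $ w0 = w) w0)"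

lemma fib_C: "fib c w0 = inverse (section_at (top c $ w0))" if c: "c \<in> C"
proof -
  define w where "w = top c $ w0"
  define d where "d = (SOME c. c \<in> C \<and> top c $ w0 = w)"
  have d: "d \<in> C" "top d $ w0 = w"
    using someI[of "\<lambda>c. c \<in> C \<and> top c $ w0 = w" c] c by (simp_all add: d_def w_def)
  have "inverse (top d) $ w = w0" using perm_inverse_apply(1)[of "top d" w0] d(2) by simp
  then have "top (inverse d * c) $ w0 = w0"
    by (simp add: apply_times w_def)
  then have "fib (inverse d * c) w0 = 1"
    using C_stabiliser_trivial C_mult C_inverse c d w0 by blast
  then have "inverse (fib d w0) * fib c w0 = 1"
    using fib_inverse'[of d w0] d(2) by (simp add: w_def)
  then have "fib d w0 * (inverse (fib d w0) * fib c w0) = fib d w0" by simp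
  then have "fib c w0 = fib d w0" by simp
  then show ?thesis unfolding section_at_def w_def[symmetric] d_def[symmetric] by simp
qed

text \<open>The projection of \<open>H = K C\<close> to \<open>K\<close>, read off in the coordinate \<open>w0\<close>.\<close>

definition constant_part :: "('a, 'b) wr \<Rightarrow> 'b \<Rightarrow> bool" where
  "constant_part h g \<longleftrightarrow> (\<exists>k\<in>K. \<exists>c\<in>C. h = k * c \<and> fib k w0 = g)"

text \<open>After identifying all fibres by means of \<open>C\<close>, an element of \<open>H\<close> acts in the same way on every
  fibre.\<close>

lemma constant_part_fib:
  assumes h: "constant_part h g" and w: "w \<in> \<Omega>"
  shows "section_at (top h $ w) * fib h w = g * section_at w"
proof -
  obtain k c' where kc: "k \<in> K" "c' \<in> C" "h = k * c'" "fib k w0 = g"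
    using h by (auto simp: constant_part_def)
  obtain c where c: "c \<in> C" "top c $ w0 = w" using C_transitive[OF w] by blast
  have "h * c = (c' * c) * k"
    using C_commute[OF C_mult[OF kc(2) c(1)] kc(1)] by (simp add: kc mult.assoc)
  then have "fib (h * c) w0 = fib ((c' * c) * k) w0" by simp
  moreover have "fib (h * c) w0 = fib h w * fib c w0" using c(2) by simp
  moreover have "fib ((c' * c) * k) w0 = fib (c' * c) w0 * g" using kc by (simp only: K_mult(1))
  ultimately have "fib h w * fib c w0 = fib (c' * c) w0 * g" by simp
  moreover have "fib (c' * c) w0 = inverse (section_at (top h $ w))"
    using fib_C[OF C_mult[OF kc(2) c(1)]] c(2) kc by (simp add: apply_times)
  moreover have "fib c w0 = inverse (section_at w)" using fib_C[OF c(1)] c(2) by simp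
  ultimately have "section_at (top h $ w) * (fib h w * inverse (section_at w)) * section_at w
     = section_at (top h $ w) * (inverse (section_at (top h $ w)) * g) * section_at w" by simp
  then show ?thesis by (simp add: mult.assoc)
qed

lemma constant_part_exists: "h \<in> H \<Longrightarrow> \<exists>g\<in>T. constant_part h g"
  using decomposition fib_in[OF KH w0] unfolding constant_part_def by metis

lemma constant_part_1: "constant_part 1 g \<Longrightarrow> g = 1"
proof -
  assume "constant_part 1 g"
  from constant_part_fib[OF this w0] have "g * section_at w0 = 1 * section_at w0" by simp
  then show "g = 1" by (simp only: group_cancel_right)
qed

lemma constant_part_mult: "constant_part (h * h') (g * g')" if hg: "constant_part h g" and hg': "constant_part h' g'"
proof -
  obtain k c where kc: "k \<in> K" "c \<in> C" "h = k * c" "fib k w0 = g"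
    using hg by (auto simp: constant_part_def)
  obtain k' c' where kc': "k' \<in> K" "c' \<in> C" "h' = k' * c'" "fib k' w0 = g'"
    using hg' by (auto simp: constant_part_def)
  have "h * h' = k * (c * k') * c'" by (simp add: kc kc' mult.assoc)
  also have "\<dots> = (k * k') * (c * c')" by (simp add: C_commute[OF kc(2) kc'(1)] mult.assoc)
  finally have "h * h' = (k * k') * (c * c')" .
  moreover have "fib (k * k') w0 = g * g'" using kc kc' by simp
  ultimately show ?thesis
    using C_mult K_closed(2) kc kc' unfolding constant_part_def by blast
qed

lemma constant_part_power: "constant_part (h ^ i) (g ^ i)" if "constant_part h g"
proof (induction i)
  case 0
  have "1 \<in> C" using H_closed(1) by (simp add: C_def)
  then show ?case using K_closed(1) unfolding constant_part_def
    by (auto intro!: bexI[of _ 1])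
next
  case (Suc i)
  then show ?case using constant_part_mult[OF that Suc] by simp
qed

lemma constant_part_conj:
  assumes h: "constant_part h g" and k: "k \<in> K"
  shows "h * k * inverse h \<in> K" "fib (h * k * inverse h) w0 = g * fib k w0 * inverse g"
proof -
  obtain l c where lc: "l \<in> K" "c \<in> C" "h = l * c" "fib l w0 = g"
    using h by (auto simp: constant_part_def)
  have "h \<in> H" using lc KH CH H_closed(2) by simp
  then show "h * k * inverse h \<in> K" using K_conj k by blast
  have "h * k * inverse h = l * (c * k) * inverse c * inverse l" by (simp add: lc mult.assoc)
  also have "\<dots> = l * k * inverse l" by (simp add: C_commute[OF lc(2) k] mult.assoc)
  finally show "fib (h * k * inverse h) w0 = g * fib k w0 * inverse g"
    using lc k fib_conj[OF k, of l w0] by simp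
qed

text \<open>The map \<open>section_at\<close> sends points to group elements. At a handle point \<open>e\<close> it conjugates the
  label of \<open>e\<close> to \<open>\<xi>\<close>, and the transport along a handle shows that \<open>\<tau>\<close>, the constant part of the power
  that joins its ends, inverts \<open>\<xi>\<close>. Away from the handle points \<open>section_at\<close> commutes with the
  generators, so that counting its fibres gives the functions \<open>N\<close>, \<open>N'\<close>, \<open>D\<close> of
  \<open>handle_pair_obstruction\<close>. Simplicity of \<open>T\<close> supplies the assumptions made there about the
  centre and about \<open>\<zeta>\<close>.\<close>

lemma handles_parallel:
  assumes XY: "X \<in> H" "Y \<in> H"
    and gen: "\<And>P h. P 1 \<Longrightarrow> (\<And>h. h \<in> H \<Longrightarrow> P h \<Longrightarrow> P (X * h)) \<Longrightarrow> (\<And>h. h \<in> H \<Longrightarrow> P h \<Longrightarrow> P (Y * h))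
               \<Longrightarrow> h \<in> H \<Longrightarrow> P h"
    and dist: "distinct [a, b, c, d]" and pts: "{a, b, c, d} \<subseteq> \<Omega>"
    and topX: "\<And>e. e \<in> {a, b, c, d} \<Longrightarrow> top X $ e = e"
    and fibX: "fib X a = \<alpha>" "fib X b = inverse \<alpha>" "fib X c = \<beta>" "fib X d = inverse \<beta>"
      "\<And>w. w \<in> \<Omega> - {a, b, c, d} \<Longrightarrow> fib X w = 1"
    and fibY: "\<And>w. w \<in> \<Omega> \<Longrightarrow> fib Y w = 1"
    and W: "top ((Y * X) ^ t) $ a = b" "fib ((Y * X) ^ t) a = \<alpha>"
      "top ((Y * X) ^ t) $ c = d" "fib ((Y * X) ^ t) c = \<beta>"
    and r: "(Y * X) ^ r = 1" "r > 0"
    and odd: "\<alpha> ^ (2 * k + 1) = 1"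
  shows "\<beta> = \<alpha> \<or> \<beta> = inverse \<alpha>"
proof -
  obtain \<xi> where \<xi>: "\<xi> \<in> T" "constant_part X \<xi>" using constant_part_exists XY by blast
  obtain \<eta> where \<eta>: "\<eta> \<in> T" "constant_part Y \<eta>" using constant_part_exists XY by blast
  define \<zeta> where "\<zeta> = \<eta> * \<xi>"
  have \<zeta>: "constant_part (Y * X) \<zeta>" "\<zeta> \<in> T"
    using constant_part_mult \<xi> \<eta> T_closed by (auto simp: \<zeta>_def)
  define \<tau> where "\<tau> = \<zeta> ^ t"
  have \<tau>: "constant_part ((Y * X) ^ t) \<tau>" using constant_part_power[OF \<zeta>(1)] by (simp add: \<tau>_def)
  define v where "v = section_at"
  note eq = constant_part_fib[folded v_def]
  have in\<Omega>: "a \<in> \<Omega>" "b \<in> \<Omega>" "c \<in> \<Omega>" "d \<in> \<Omega>" using pts by auto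
  have va: "v a * \<alpha> = \<xi> * v a" and vb: "v b * inverse \<alpha> = \<xi> * v b"
    and vc: "v c * \<beta> = \<xi> * v c" and vd: "v d * inverse \<beta> = \<xi> * v d"
    using eq[OF \<xi>(2) in\<Omega>(1)] eq[OF \<xi>(2) in\<Omega>(2)] eq[OF \<xi>(2) in\<Omega>(3)] eq[OF \<xi>(2) in\<Omega>(4)]
    by (simp_all add: topX fibX)
  have wb: "v b * \<alpha> = \<tau> * v a" and wd: "v d * \<beta> = \<tau> * v c"
    using eq[OF \<tau> in\<Omega>(1)] eq[OF \<tau> in\<Omega>(3)] by (simp_all add: W)
  have shift: "v e' = \<tau> * inverse \<xi> * v e" if "v e' * \<gamma> = \<tau> * v e" "v e * \<gamma> = \<xi> * v e" for e e' \<gamma>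
  proof -
    have "inverse \<xi> * (v e * \<gamma>) * inverse \<gamma> = inverse \<xi> * (\<xi> * v e) * inverse \<gamma>" by (simp only: that(2))
    then have *: "inverse \<xi> * v e = v e * inverse \<gamma>" by (simp add: mult.assoc)
    have "v e' * \<gamma> * inverse \<gamma> = \<tau> * v e * inverse \<gamma>" by (simp only: that(1))
    then show ?thesis by (simp add: mult.assoc *)
  qed
  have vb': "v b = \<tau> * inverse \<xi> * v a" and vd': "v d = \<tau> * inverse \<xi> * v c"
    using shift wb va wd vc by blast+
  have \<alpha>: "\<alpha> = inverse (v a) * \<xi> * v a" and \<beta>: "\<beta> = inverse (v c) * \<xi> * v c"
  proof -
    have "inverse (v a) * (v a * \<alpha>) = inverse (v a) * (\<xi> * v a)" by (simp only: va)
    then show "\<alpha> = inverse (v a) * \<xi> * v a" by (simp add: mult.assoc)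
    have "inverse (v c) * (v c * \<beta>) = inverse (v c) * (\<xi> * v c)" by (simp only: vc)
    then show "\<beta> = inverse (v c) * \<xi> * v c" by (simp add: mult.assoc)
  qed
  show ?thesis
  proof (cases "\<xi> = 1")
    case True
    then show ?thesis by (simp add: \<alpha> \<beta>)
  next
    case \<xi>1: False
    have \<tau>\<xi>: "\<tau> * \<xi> * inverse \<tau> = inverse \<xi>"
    proof -
      have "\<xi> * v b = \<tau> * inverse \<xi> * (v a * inverse \<alpha>)" using vb by (simp add: vb' mult.assoc)
      also have "v a * inverse \<alpha> = inverse \<xi> * v a"
      proof -
        have "inverse \<xi> * (v a * \<alpha>) * inverse \<alpha> = inverse \<xi> * (\<xi> * v a) * inverse \<alpha>" by (simp only: va)
        then show ?thesis by (simp add: mult.assoc)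
      qed
      finally have "\<xi> * (\<tau> * inverse \<xi> * v a) = \<tau> * inverse \<xi> * (inverse \<xi> * v a)" by (simp add: vb')
      then have "(\<xi> * \<tau>) * (inverse \<xi> * v a) = (\<tau> * inverse \<xi>) * (inverse \<xi> * v a)" by (simp add: mult.assoc)
      then have "\<xi> * \<tau> = \<tau> * inverse \<xi>" by (simp only: group_cancel_right)
      then have "inverse \<xi> * (\<xi> * \<tau>) * \<xi> * inverse \<tau> = inverse \<xi> * (\<tau> * inverse \<xi>) * \<xi> * inverse \<tau>" by simp
      then show ?thesis by (simp add: mult.assoc)
    qed
    have \<xi>\<alpha>: "\<xi> = v a * \<alpha> * inverse (v a)" by (simp add: \<alpha> mult.assoc)
    have odd\<xi>: "\<xi> ^ (2 * k + 1) = 1" unfolding \<xi>\<alpha> conj_power odd by simp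
    have \<zeta>r: "\<zeta> ^ r = 1" using constant_part_1 constant_part_power[OF \<zeta>(1), of r] r(1) by simp
    obtain kx where kx: "kx \<in> K" "fib kx w0 = \<xi>" using K_onto[OF w0 \<xi>(1)] by blast
    have fp: "fib (l ^ i) w0 = fib l w0 ^ i \<and> l ^ i \<in> K" if "l \<in> K" for l i
      using that K_closed by (induction i) (simp_all del: power_Suc add: power_Suc2)
    have Yconj: "Y * l * inverse Y = (Y * X) * l * inverse (Y * X)"
      if "X * l * inverse X = l" for l
    proof -
      have "(Y * X) * l * inverse (Y * X) = Y * (X * l * inverse X) * inverse Y" by (simp add: mult.assoc)
      then show ?thesis using that by simp
    qed
    have Xfix: "X * l * inverse X = l" if "l \<in> K" "\<xi> * fib l w0 = fib l w0 * \<xi>" for l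
      using constant_part_conj[OF \<xi>(2) that(1)] that by (intro K_inj[OF _ that(1) w0]) (simp_all add: mult.assoc)
    \<comment> \<open>An element of \<open>K\<close> whose coordinate commutes with \<open>\<xi>\<close> and \<open>\<zeta>\<close> commutes with both generators of
      \<open>H\<close>, hence with \<open>K\<close>.\<close>
    have centre: "\<zeta> ^ i = 1" if "\<zeta> ^ i * \<xi> = \<xi> * \<zeta> ^ i" for i
    proof -
      have "\<zeta> ^ i \<in> T" by (induction i) (simp_all add: T_closed \<zeta>)
      then obtain l where l: "l \<in> K" "fib l w0 = \<zeta> ^ i" using K_onto[OF w0] by blast
      have X: "X * l * inverse X = l" using Xfix[OF l(1)] l(2) that by simp
      have "fib ((Y * X) * l * inverse (Y * X)) w0 = \<zeta> * \<zeta> ^ i * inverse \<zeta>"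
        using constant_part_conj(2)[OF \<zeta>(1) l(1)] by (simp only: l(2))
      also have "\<dots> = fib l w0"
        by (simp only: power_commutes[symmetric] mult.assoc group_left_right_inverse mult_1_right l(2))
      finally have "(Y * X) * l * inverse (Y * X) = l"
        by (rule K_inj[OF constant_part_conj(1)[OF \<zeta>(1) l(1)] l(1) w0])
      then have Y: "Y * l * inverse Y = l" using Yconj[OF X] by simp
      have "h * l * inverse h = l" if "h \<in> H" for h
        using _ _ _ that
      proof (rule gen)
        show "1 * l * inverse 1 = l" by simp
        fix h assume "h * l * inverse h = l"
        then show "X * h * l * inverse (X * h) = l" "Y * h * l * inverse (Y * h) = l"
          unfolding conj_mult using X Y by simp_all
      qed
      then have l': "l' * l * inverse l' = l" if "l' \<in> K" for l' using KH that by blast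
      show ?thesis
      proof (rule nonabelian_simple_centre[OF T \<open>\<zeta> ^ i \<in> T\<close>])
        fix s assume "s \<in> T"
        then obtain l' where "l' \<in> K" "fib l' w0 = s" using K_onto[OF w0] by blast
        have "l' * l * inverse l' * l' = l * l'" using l'[OF \<open>l' \<in> K\<close>] by simp
        then have "l' * l = l * l'" by (simp add: mult.assoc)
        then have "fib (l' * l) w0 = fib (l * l') w0" by simp
        then show "\<zeta> ^ i * s = s * \<zeta> ^ i" using l \<open>l' \<in> K\<close> \<open>fib l' w0 = s\<close> by simp
      qed
    qed
    \<comment> \<open>Otherwise the cyclic group of \<open>\<xi>\<close> would be normal.\<close>
    have not_inv: "\<zeta> * \<xi> * inverse \<zeta> \<noteq> inverse \<xi>"
    proof
      assume inv: "\<zeta> * \<xi> * inverse \<zeta> = inverse \<xi>"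
      have "\<xi> ^ (2 * k) * \<xi> = 1" using odd\<xi> by (simp add: power_commutes)
      then have "\<xi> ^ (2 * k) * \<xi> * inverse \<xi> = inverse \<xi>" by simp
      then have ik: "inverse \<xi> = \<xi> ^ (2 * k)" by (simp add: mult.assoc)
      have X: "X * kx * inverse X = kx" using Xfix[OF kx(1)] kx(2) by simp
      have "fib ((Y * X) * kx * inverse (Y * X)) w0 = fib (kx ^ (2 * k)) w0"
        using constant_part_conj(2)[OF \<zeta>(1) kx(1)] fp[OF kx(1), of "2 * k"] by (simp only: kx(2) inv ik)
      then have "(Y * X) * kx * inverse (Y * X) = kx ^ (2 * k)"
        using fp[OF kx(1)] by (intro K_inj[OF constant_part_conj(1)[OF \<zeta>(1) kx(1)] _ w0]) auto
      then have Y: "Y * kx * inverse Y = kx ^ (2 * k)" using Yconj[OF X] by simp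
      have comp: "\<exists>i. g * h * kx * inverse (g * h) = kx ^ i"
        if gi: "g * kx * inverse g = kx ^ j" and hi: "h * kx * inverse h = kx ^ i" for g h i j
      proof -
        have "g * h * kx * inverse (g * h) = g * (h * kx * inverse h) * inverse g" by (simp add: mult.assoc)
        also have "\<dots> = (kx ^ j) ^ i" by (simp only: hi conj_power[symmetric] gi)
        finally show ?thesis by (auto simp flip: power_mult)
      qed
      have nrm: "\<exists>i. h * kx * inverse h = kx ^ i" if "h \<in> H" for h
        using _ _ _ that
      proof (rule gen)
        show "\<exists>i. 1 * kx * inverse 1 = kx ^ i" by (intro exI[of _ 1]) simp
        fix h assume "\<exists>i. h * kx * inverse h = kx ^ i"
        then obtain i where i: "h * kx * inverse h = kx ^ i" ..
        show "\<exists>i. X * h * kx * inverse (X * h) = kx ^ i"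
          by (rule comp[OF _ i, of _ 1]) (simp add: X)
        show "\<exists>i. Y * h * kx * inverse (Y * h) = kx ^ i" by (rule comp[OF Y i])
      qed
      have "\<xi> = 1"
      proof (rule nonabelian_simple_no_normal_cyclic[OF T \<xi>(1) odd\<xi>])
        fix s assume "s \<in> T"
        then obtain l where l: "l \<in> K" "fib l w0 = s" using K_onto[OF w0] by blast
        obtain i where i: "l * kx * inverse l = kx ^ i" using nrm KH[OF l(1)] by blast
        have "fib (l * kx * inverse l) w0 = s * \<xi> * inverse s"
          using fib_conj[OF kx(1), of l w0] l kx by simp
        then have "s * \<xi> * inverse s = \<xi> ^ i" using i fp[OF kx(1), of i] kx(2) by metis
        then show "\<exists>i. s * \<xi> * inverse s = \<xi> ^ i" ..
      qed simp
      then show False using \<xi>1 by simp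
    qed
    \<comment> \<open>Right translation by \<open>v a\<close> moves the corner of the first handle to \<open>1\<close>.\<close>
    define u where "u = v c * inverse (v a)"
    define M where "M S g = int (card {w \<in> S. v w = g * v a})" for S g
    define N where "N = M \<Omega>"
    define N' where "N' = M (\<Omega> - {a, b, c, d})"
    define D where "D = M {a, b, c, d}"
    have move: "M S (\<gamma> * g) = M S g"
      if h: "h \<in> H" and S: "\<And>w. w \<in> \<Omega> \<Longrightarrow> top h $ w \<in> S \<longleftrightarrow> w \<in> S" "S \<subseteq> \<Omega>"
        and v: "\<And>w. w \<in> S \<Longrightarrow> v (top h $ w) = \<gamma> * v w" for S h \<gamma> g
    proof -
      have "bij_betw (\<lambda>w. top h $ w) {w \<in> S. v w = g * v a} {w \<in> S. v w = \<gamma> * g * v a}"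
      proof (rule bij_betwI')
        show "top h $ x = top h $ y \<longleftrightarrow> x = y" for x y by (rule apply_inj)
        show "top h $ x \<in> {w \<in> S. v w = \<gamma> * g * v a}" if "x \<in> {w \<in> S. v w = g * v a}" for x
          using that S v by (auto simp: mult.assoc)
        fix y assume y: "y \<in> {w \<in> S. v w = \<gamma> * g * v a}"
        define x where "x = inverse (top h) $ y"
        have yx: "y = top h $ x" by (simp add: x_def)
        have "x \<in> \<Omega>" using top_in[OF H_closed(3)[OF h], of y] y S(2) by (auto simp: x_def)
        then have "x \<in> S" using S(1) y yx by auto
        then have "v x = g * v a" using v y yx by (auto simp: mult.assoc)
        then show "\<exists>x\<in>{w \<in> S. v w = g * v a}. y = top h $ x" using yx \<open>x \<in> S\<close> by blast
      qed
      then show ?thesis unfolding M_def by (simp add: bij_betw_same_card)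
    qed
    have "inverse u * \<xi> * u = \<xi> \<or> inverse u * \<xi> * u = inverse \<xi>"
    proof (rule handle_pair_obstruction[OF \<zeta>_def _ _ _ _ \<tau>_def \<tau>\<xi> odd\<xi> \<xi>1 \<zeta>r r(2) centre not_inv])
      show "N (\<eta> * g) = N g" for g
        unfolding N_def using eq[OF \<eta>(2)] fibY top_in[OF XY(2)] by (intro move[OF XY(2)]) auto
      show "N' (\<xi> * g) = N' g" for g
        unfolding N'_def
      proof (rule move[OF XY(1)])
        show "top X $ w \<in> \<Omega> - {a, b, c, d} \<longleftrightarrow> w \<in> \<Omega> - {a, b, c, d}" if "w \<in> \<Omega>" for w
        proof -
          have "top X $ w = e \<longleftrightarrow> w = e" if "e \<in> {a, b, c, d}" for e
            using topX[OF that] apply_inj[of "top X" w e] by metis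
          then show ?thesis using top_in[OF XY(1) that] that by auto
        qed
        show "v (top X $ w) = \<xi> * v w" if "w \<in> \<Omega> - {a, b, c, d}" for w
          using eq[OF \<xi>(2), of w] fibX(5)[OF that] that by simp
      qed auto
      show "N g = N' g + D g" for g
      proof -
        have "{w \<in> \<Omega>. v w = g * v a} = {w \<in> \<Omega> - {a, b, c, d}. v w = g * v a} \<union> {w \<in> {a, b, c, d}. v w = g * v a}"
          using pts by blast
        then show ?thesis unfolding N_def N'_def D_def M_def
          using finite_\<Omega> by (simp only:, subst card_Un_disjoint) auto
      qed
      show "D g = of_bool (g = 1) + of_bool (g = \<tau> * inverse \<xi>) + of_bool (g = u) + of_bool (g = \<tau> * inverse \<xi> * u)" for g
      proof -
        have gu: "v e = g * v a \<longleftrightarrow> g = v e * inverse (v a)" for e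
          by (metis mult.assoc group_left_right_inverse mult_1_right)
        have "D g = (\<Sum>e\<in>{a, b, c, d}. of_bool (v e = g * v a))"
          by (simp add: D_def M_def Int_def)
        also have "\<dots> = of_bool (v a = g * v a) + of_bool (v b = g * v a) + of_bool (v c = g * v a) + of_bool (v d = g * v a)"
          using dist by simp
        finally show ?thesis unfolding gu by (simp add: vb' vd' u_def mult.assoc)
      qed
    qed
    moreover have "\<beta> = inverse (v a) * (inverse u * \<xi> * u) * v a" by (simp add: \<beta> u_def mult.assoc)
    moreover have "inverse \<alpha> = inverse (v a) * inverse \<xi> * v a" by (simp add: \<alpha> mult.assoc)
    ultimately show ?thesis using \<alpha> by metis
  qed
qed

end

section \<open>Alternating groups\<close>

definition alt_perms :: "'a set \<Rightarrow> 'a perm set" where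
  "alt_perms X = {g. affected g \<subseteq> X \<and> evenperm (apply g)}"

lemma permutation_apply: "permutation (apply g)"
  by (simp add: permutation affected.rep_eq[symmetric])

lemma apply_outside: "affected g \<subseteq> X \<Longrightarrow> w \<notin> X \<Longrightarrow> g $ w = w"
  by (auto simp: in_affected subset_iff)

lemma apply_permutes: "apply g permutes X" if "affected g \<subseteq> X"
  using bij_apply[of g] apply_outside[OF that] unfolding permutes_def bij_iff by blast

lemma apply_inside: "affected g \<subseteq> X \<Longrightarrow> w \<in> X \<Longrightarrow> g $ w \<in> X"
  by (metis apply_affected in_affected subset_iff)

lemma alt_perms_closed:
  "1 \<in> alt_perms X" "g \<in> alt_perms X \<Longrightarrow> h \<in> alt_perms X \<Longrightarrow> g * h \<in> alt_perms X"
  "g \<in> alt_perms X \<Longrightarrow> inverse g \<in> alt_perms X"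
proof -
  show "g * h \<in> alt_perms X" if "g \<in> alt_perms X" "h \<in> alt_perms X"
    using that order.trans[OF affected_times[of g h], of X]
    by (simp add: alt_perms_def apply_times evenperm_comp permutation_apply)
qed (simp_all add: alt_perms_def apply_inverse evenperm_inv permutation_apply)

lemma subgrp_alt_perms: "subgrp (alt_perms X)"
  by (simp add: subgrp_def alt_perms_closed)

lemma affected_swap_subset: "a \<in> X \<Longrightarrow> b \<in> X \<Longrightarrow> affected (Perm.swap a b) \<subseteq> X"
  by (cases "a = b") (auto simp: affected_swap)

lemma odd_swap: "a \<noteq> b \<Longrightarrow> \<not> evenperm (apply (Perm.swap a b))"
  by (simp add: swap.rep_eq evenperm_swap)

text \<open>Three transpositions move the points one after the other; a transposition of two further points
  repairs the sign.\<close>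

lemma alt_perms_three_transitive:
  assumes X: "finite X" "card X \<ge> 5"
    and abc: "distinct [a, b, c]" "{a, b, c} \<subseteq> X" and abc': "distinct [a', b', c']" "{a', b', c'} \<subseteq> X"
  shows "\<exists>g\<in>alt_perms X. g $ a = a' \<and> g $ b = b' \<and> g $ c = c'"
proof -
  define g1 where "g1 = Perm.swap a a'"
  define g2 where "g2 = Perm.swap (g1 $ b) b' * g1"
  define g3 where "g3 = Perm.swap (g2 $ c) c' * g2"
  have 1: "affected g1 \<subseteq> X" "g1 $ a = a'"
    using abc abc' affected_swap_subset[of a X a'] by (simp_all add: g1_def)
  have n1: "g1 $ b \<noteq> a'" using apply_inj[of g1 b a] 1 abc(1) by auto
  have 2: "affected g2 \<subseteq> X" "g2 $ a = a'" "g2 $ b = b'"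
    using affected_swap_subset[of "g1 $ b" X b'] affected_times[of "Perm.swap (g1 $ b) b'" g1] 1
      apply_inside[OF 1(1), of b] abc abc' n1
    unfolding g2_def by (blast, auto simp: apply_times swap.rep_eq transpose_def)
  have n2: "g2 $ c \<noteq> a'" "g2 $ c \<noteq> b'" using apply_inj[of g2 c a] apply_inj[of g2 c b] 2 abc(1) by auto
  have 3: "affected g3 \<subseteq> X" "g3 $ a = a'" "g3 $ b = b'" "g3 $ c = c'"
    using affected_swap_subset[of "g2 $ c" X c'] affected_times[of "Perm.swap (g2 $ c) c'" g2] 2
      apply_inside[OF 2(1), of c] abc abc' n2
    unfolding g3_def by (blast, auto simp: apply_times swap.rep_eq transpose_def)
  have "\<not> card (X - {a', b', c'}) \<le> 1"
    using X abc' by (simp add: card_Diff_subset)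
  then obtain x y where xy: "x \<in> X - {a', b', c'}" "y \<in> X - {a', b', c'}" "x \<noteq> y"
    using X(1) by (metis card_le_Suc0_iff_eq finite_Diff One_nat_def)
  define g4 where "g4 = Perm.swap x y * g3"
  have 4: "affected g4 \<subseteq> X" "g4 $ a = a'" "g4 $ b = b'" "g4 $ c = c'"
    using affected_swap_subset[of x X y] affected_times[of "Perm.swap x y" g3] 3 xy
    unfolding g4_def by (blast, auto simp: apply_times swap.rep_eq transpose_def)
  have "evenperm (apply g4) \<longleftrightarrow> \<not> evenperm (apply g3)"
    using odd_swap[OF xy(3)] by (simp add: g4_def apply_times evenperm_comp permutation_apply)
  then show ?thesis using 3 4 by (auto simp: alt_perms_def)
qed

lemma alt_perms_two_transitive:
  assumes X: "finite X" "card X \<ge> 5"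
    and ab: "a \<noteq> b" "{a, b} \<subseteq> X" and ab': "a' \<noteq> b'" "{a', b'} \<subseteq> X"
  shows "\<exists>g\<in>alt_perms X. g $ a = a' \<and> g $ b = b'"
proof -
  have "\<exists>c\<in>X. c \<notin> {a, b}" if "{a, b} \<subseteq> X" for a b
  proof (rule ccontr)
    assume "\<not> ?thesis"
    then have "card X \<le> card {a, b}" using that by (intro card_mono) auto
    then show False using X card_insert_le_m1[of 2 "{b}" a] by simp
  qed
  then obtain c c' where "c \<in> X" "c \<notin> {a, b}" "c' \<in> X" "c' \<notin> {a', b'}" using ab ab' by metis
  then show ?thesis using alt_perms_three_transitive[OF X, of a b c a' b' c'] ab ab' by auto
qed

definition three_cycle :: "'a \<Rightarrow> 'a \<Rightarrow> 'a \<Rightarrow> 'a perm" where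
  "three_cycle a b c = Perm.swap a b * Perm.swap b c"

lemma apply_three_cycle:
  "distinct [a, b, c] \<Longrightarrow> three_cycle a b c $ x = (if x = a then b else if x = b then c else if x = c then a else x)"
  by (auto simp: three_cycle_def apply_times swap.rep_eq transpose_def)

lemma three_cycle_in_alt_perms:
  assumes "distinct [a, b, c]" "{a, b, c} \<subseteq> X"
  shows "three_cycle a b c \<in> alt_perms X"
proof -
  have "affected (three_cycle a b c) \<subseteq> X"
    using assms by (auto simp: in_affected apply_three_cycle split: if_splits)
  then show ?thesis
    using assms by (simp add: alt_perms_def three_cycle_def apply_times evenperm_comp permutation_apply odd_swap)
qed

lemma inverse_three_cycle: "distinct [a, b, c] \<Longrightarrow> inverse (three_cycle a b c) = three_cycle c b a"
proof -
  assume d: "distinct [a, b, c]"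
  have "three_cycle a b c * three_cycle c b a = 1"
    using d by (intro perm_eqI) (auto simp: apply_times apply_three_cycle split: if_splits)
  then have "inverse (three_cycle a b c) * (three_cycle a b c * three_cycle c b a) = inverse (three_cycle a b c)"
    by simp
  then show ?thesis by simp
qed

lemma conj_three_cycle:
  assumes "distinct [a, b, c]"
  shows "g * three_cycle a b c * inverse g = three_cycle (g $ a) (g $ b) (g $ c)"
proof (rule perm_eqI)
  fix x
  define y where "y = inverse g $ x"
  have x: "x = g $ y" by (simp add: y_def)
  have "distinct [g $ a, g $ b, g $ c]" using assms by (simp add: apply_inj)
  then show "(g * three_cycle a b c * inverse g) $ x = three_cycle (g $ a) (g $ b) (g $ c) $ x"
    unfolding x using assms by (simp add: apply_times apply_three_cycle apply_inj)
qed

text \<open>The commutator of \<open>g\<close> with a 3-cycle is the product of two 3-cycles and lies in every normal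
  subgroup that contains \<open>g\<close>. The next lemmas choose the 3-cycle according to the shape of \<open>g\<close>.\<close>

lemma three_cycle_commutator:
  assumes N: "normal_in N (alt_perms X)" and g: "g \<in> N" and abc: "distinct [a, b, c]" "{a, b, c} \<subseteq> X"
  shows "three_cycle (g $ a) (g $ b) (g $ c) * three_cycle c b a \<in> N"
proof -
  define t where "t = three_cycle a b c"
  have t: "t \<in> alt_perms X" using three_cycle_in_alt_perms[OF abc] by (simp add: t_def)
  have sN: "subgrp N" using N by (simp add: normal_in_def)
  have "t * inverse g * inverse t \<in> N" using N t g subgrpD(3)[OF sN] by (simp add: normal_in_def)
  then have "g * (t * inverse g * inverse t) \<in> N" using subgrpD(2)[OF sN] g by blast
  moreover have "g * (t * inverse g * inverse t) = (g * t * inverse g) * inverse t" by (simp add: mult.assoc)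
  ultimately show ?thesis
    using conj_three_cycle[OF abc(1), of g] inverse_three_cycle[OF abc(1)] by (simp add: t_def)
qed

lemma normal_contains_three_cycle_of_path:
  assumes N: "normal_in N (alt_perms X)" and g: "g \<in> N"
    and path: "g $ i = j" "g $ j = k" "g $ k = l" and d: "distinct [i, j, k, l]"
  shows "\<exists>a b c. distinct [a, b, c] \<and> {a, b, c} \<subseteq> X \<and> three_cycle a b c \<in> N"
proof -
  have gX: "affected g \<subseteq> X" using N g by (auto simp: normal_in_def alt_perms_def)
  have X: "i \<in> X" "j \<in> X" "k \<in> X" using gX path d by (auto simp: subset_iff in_affected)
  then have "l \<in> X" using apply_inside[OF gX, of k] path by simp
  have "three_cycle j k l * three_cycle k j i \<in> N"
    using three_cycle_commutator[OF N g, of i j k] X d path by simp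
  also have "three_cycle j k l * three_cycle k j i = three_cycle i l j"
    using d by (intro perm_eqI) (auto simp: apply_times apply_three_cycle)
  finally show ?thesis using d X \<open>l \<in> X\<close> by (intro exI[of _ i] exI[of _ l] exI[of _ j]) auto
qed

text \<open>If \<open>g\<close> is not itself a 3-cycle, a commutator has a cycle of length five and the previous lemma
  applies.\<close>

lemma normal_contains_three_cycle_of_triangle:
  assumes N: "normal_in N (alt_perms X)" and g: "g \<in> N"
    and path: "g $ i = j" "g $ j = k" "g $ k = i" and d: "distinct [i, j, k]"
  shows "\<exists>a b c. distinct [a, b, c] \<and> {a, b, c} \<subseteq> X \<and> three_cycle a b c \<in> N"
proof (cases "\<exists>l. l \<notin> {i, j, k} \<and> g $ l \<noteq> l")
  case True
  then obtain l where l: "l \<notin> {i, j, k}" "g $ l \<noteq> l" by blast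
  define l' where "l' = g $ l"
  have l': "l' \<notin> {i, j, k, l}" using l path apply_inj[of g l i] apply_inj[of g l j] apply_inj[of g l k]
    unfolding l'_def by simp
  have gX: "affected g \<subseteq> X" using N g by (auto simp: normal_in_def alt_perms_def)
  have X: "i \<in> X" "j \<in> X" "l \<in> X" using gX path d l by (auto simp: subset_iff in_affected)
  define h where "h = three_cycle j k l' * three_cycle l j i"
  have h: "h \<in> N"
    using three_cycle_commutator[OF N g, of i j l] X d path l by (auto simp: h_def l'_def)
  show ?thesis
    by (rule normal_contains_three_cycle_of_path[OF N h, of i l k l'])
      (use d l l' in \<open>auto simp: h_def apply_times apply_three_cycle\<close>)
next
  case False
  then have "g $ x = three_cycle i j k $ x" for x
    using path d by (auto simp: apply_three_cycle)
  then have "g = three_cycle i j k" by (intro perm_eqI)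
  moreover have "{i, j, k} \<subseteq> X"
  proof -
    have "affected g \<subseteq> X" using N g by (auto simp: normal_in_def alt_perms_def)
    then show ?thesis using path d by (auto simp: subset_iff in_affected)
  qed
  ultimately show ?thesis using g d by blast
qed

text \<open>What remains are involutions. One with a fixed point yields a 3-cycle at once, and one without
  has at least three 2-cycles on five or more points, from which a commutator makes a cycle of
  length three.\<close>

lemma normal_contains_three_cycle:
  assumes X: "finite X" "card X \<ge> 5" and N: "normal_in N (alt_perms X)" "N \<noteq> {1}"
  shows "\<exists>a b c. distinct [a, b, c] \<and> {a, b, c} \<subseteq> X \<and> three_cycle a b c \<in> N"
proof -
  have "1 \<in> N" using N by (simp add: normal_in_def subgrp_def)
  then obtain g where g: "g \<in> N" "g \<noteq> 1" using N(2) by blast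
  have gX: "affected g \<subseteq> X" using N g by (auto simp: normal_in_def alt_perms_def)
  show ?thesis
  proof (cases "\<exists>i. g $ (g $ i) \<noteq> i")
    case True
    then obtain i where i: "g $ (g $ i) \<noteq> i" by blast
    define j k l where "j = g $ i" "k = g $ j" "l = g $ k"
    have ij: "i \<noteq> j" "j \<noteq> k" "i \<noteq> k" "k \<noteq> l" "j \<noteq> l"
      using i apply_inj[of g] unfolding j_k_l_def by metis+
    show ?thesis
    proof (cases "l = i")
      case True
      then show ?thesis
        using normal_contains_three_cycle_of_triangle[OF N(1) g(1), of i j k] ij j_k_l_def by auto
    next
      case False
      then show ?thesis
        using normal_contains_three_cycle_of_path[OF N(1) g(1), of i j k l] ij j_k_l_def by auto
    qed
  next
    case False
    then have inv: "g $ (g $ i) = i" for i by blast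
    obtain i where i: "g $ i \<noteq> i" using g(2) by (auto simp: perm_eq_iff)
    define i' where "i' = g $ i"
    have iX: "i \<in> X" "i' \<in> X" using gX i apply_affected[of g i] by (auto simp: subset_iff in_affected i'_def)
    show ?thesis
    proof (cases "\<exists>k\<in>X. g $ k = k")
      case True
      then obtain k where k: "k \<in> X" "g $ k = k" by blast
      have d: "distinct [i, i', k]" using i k inv[of i] by (auto simp: i'_def)
      have "three_cycle i' i k * three_cycle k i' i \<in> N"
        using three_cycle_commutator[OF N(1) g(1), of i i' k] d iX k inv[of i] by (simp add: i'_def)
      also have "three_cycle i' i k * three_cycle k i' i = three_cycle i i' k"
        using d by (intro perm_eqI) (auto simp: apply_times apply_three_cycle)
      finally show ?thesis using d iX k by (intro exI[of _ i] exI[of _ i'] exI[of _ k]) auto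
    next
      case False
      have fresh: "\<exists>j\<in>X. j \<notin> set xs" if "length xs < 5" for xs
      proof (rule ccontr)
        assume "\<not> ?thesis"
        then have "card X \<le> card (set xs)" by (intro card_mono) auto
        then show False using card_length[of xs] X that by simp
      qed
      obtain j where j: "j \<in> X" "j \<notin> {i, i'}" using fresh[of "[i, i']"] by auto
      define j' where "j' = g $ j"
      obtain k where k: "k \<in> X" "k \<notin> {i, i', j, j'}" using fresh[of "[i, i', j, j']"] by auto
      define k' where "k' = g $ k"
      have "i \<noteq> i'" "j \<noteq> j'" "k \<noteq> k'" using False iX j k by (auto simp: i'_def j'_def k'_def)
      have g': "g $ i = i'" "g $ i' = i" "g $ j = j'" "g $ j' = j" "g $ k = k'" "g $ k' = k"
        by (simp_all add: i'_def j'_def k'_def inv)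
      have d: "distinct [i, i', j, j', k, k']"
      proof -
        have "j' \<notin> {i, i'}" using j g'(1,2,4) by auto
        moreover have "k' \<notin> {i, i', j, j'}" using k g'(1-4,6) by auto
        ultimately show ?thesis using \<open>i \<noteq> i'\<close> \<open>j \<noteq> j'\<close> \<open>k \<noteq> k'\<close> j k by auto
      qed
      define h where "h = three_cycle i' j' k' * three_cycle k j i"
      have dd: "distinct [i, j, k]" "distinct [k, j, i]" "distinct [i', j', k']" "distinct [i, k, j]"
        using d by auto
      have h: "h \<in> N"
        using three_cycle_commutator[OF N(1) g(1), of i j k] dd iX j k by (simp add: h_def g')
      have "h $ i = k" "h $ k = j" "h $ j = i"
        using d by (auto simp: h_def apply_times apply_three_cycle[OF dd(2)] apply_three_cycle[OF dd(3)])
      then show ?thesis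
        using normal_contains_three_cycle_of_triangle[OF N(1) h _ _ _ dd(4)] by blast
    qed
  qed
qed

lemma three_cycle_generation:
  assumes N: "subgrp N" and tc: "\<And>a b c. distinct [a, b, c] \<Longrightarrow> {a, b, c} \<subseteq> {1..m} \<Longrightarrow> three_cycle a b c \<in> N"
  shows "alt_perms {1..m::nat} \<subseteq> N"
proof
  fix g assume g: "g \<in> alt_perms {1..m}"
  have car: "apply g \<in> carrier (alt_group m)"
    using g by (simp add: alt_perms_def alt_group_carrier apply_permutes)
  have "\<exists>h\<in>N. apply h = f" if "f \<in> generate (alt_group m) (three_cycles m)" for f
    using that
  proof induction
    case one
    show ?case using subgrpD(1)[OF N] by (intro bexI[of _ 1]) (simp_all add: alt_group_one)
  next
    case (incl f)
    then obtain cs where cs: "f = cycle_of_list cs" "distinct cs" "length cs = 3" "set cs \<subseteq> {1..m}" by blast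
    then obtain a b c where "cs = [a, b, c]" using stupid_lemma by metis
    then show ?case using cs tc[of a b c]
      by (intro bexI[of _ "three_cycle a b c"]) (auto simp: three_cycle_def apply_times swap.rep_eq)
  next
    case (inv f)
    then obtain cs where cs: "f = cycle_of_list cs" "distinct cs" "length cs = 3" "set cs \<subseteq> {1..m}" by blast
    then obtain a b c where abc: "cs = [a, b, c]" using stupid_lemma by metis
    have f: "f = apply (three_cycle a b c)" using cs abc
      by (simp add: three_cycle_def apply_times swap.rep_eq)
    have "inv\<^bsub>alt_group m\<^esub> f = inv' f" using inv three_cycles_incl by (intro alt_group_inv_equality) blast
    then show ?case using cs abc tc[of a b c] f subgrpD(3)[OF N]
      by (intro bexI[of _ "inverse (three_cycle a b c)"]) (auto simp: apply_inverse)
  next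
    case (eng f1 f2)
    then obtain h1 h2 where "h1 \<in> N" "apply h1 = f1" "h2 \<in> N" "apply h2 = f2" by blast
    then show ?case using subgrpD(2)[OF N]
      by (intro bexI[of _ "h1 * h2"]) (simp_all add: alt_group_mult apply_times)
  qed
  then obtain h where "h \<in> N" "apply h = apply g"
    using car alt_group_carrier_as_three_cycles by metis
  then show "g \<in> N" by (metis apply_inject)
qed

theorem nonabelian_simple_alt_perms:
  assumes m: "m \<ge> 5"
  shows "nonabelian_simple (alt_perms {1..m::nat})"
  unfolding nonabelian_simple_def
proof (intro conjI allI impI subgrp_alt_perms)
  define p q where "p = three_cycle 1 2 (3::nat)" and "q = three_cycle 1 2 (4::nat)"
  have "p \<in> alt_perms {1..m}" "q \<in> alt_perms {1..m}"
    unfolding p_def q_def by (rule three_cycle_in_alt_perms; use m in simp)+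
  moreover have "p * q \<noteq> q * p"
  proof
    assume "p * q = q * p"
    then have "(p * q) $ 1 = (q * p) $ 1" by simp
    then show False by (simp add: p_def q_def apply_times apply_three_cycle)
  qed
  ultimately show "\<exists>a\<in>alt_perms {1..m}. \<exists>b\<in>alt_perms {1..m}. a * b \<noteq> b * a" by blast
next
  fix N assume N: "normal_in N (alt_perms {1..m})"
  show "N = {1} \<or> N = alt_perms {1..m}"
  proof (cases "N = {1}")
    case False
    obtain a b c where abc: "distinct [a, b, c]" "{a, b, c} \<subseteq> {1..m}" "three_cycle a b c \<in> N"
      using normal_contains_three_cycle[OF _ _ N False] m by auto
    have "alt_perms {1..m} \<subseteq> N"
    proof (rule three_cycle_generation)
      show "subgrp N" using N by (simp add: normal_in_def)
      fix a' b' c' :: nat assume abc': "distinct [a', b', c']" "{a', b', c'} \<subseteq> {1..m}"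
      obtain g where g: "g \<in> alt_perms {1..m}" "g $ a = a'" "g $ b = b'" "g $ c = c'"
        using alt_perms_three_transitive[of "{1..m}" a b c a' b' c'] abc abc' m by auto
      have "g * three_cycle a b c * inverse g \<in> N" using N g(1) abc(3) by (simp add: normal_in_def)
      then show "three_cycle a' b' c' \<in> N" using conj_three_cycle[OF abc(1), of g] g by simp
    qed
    then show ?thesis using N by (auto simp: normal_in_def)
  qed simp
qed

section \<open>Generated submonoids\<close>

text \<open>The submonoid rather than the subgroup generated by \<open>S\<close>: for generators of finite order the two
  agree, and inductions have one kind of step.\<close>

inductive_set mgen :: "'a::monoid_mult set \<Rightarrow> 'a set" for S where
  one: "1 \<in> mgen S"
| step: "s \<in> S \<Longrightarrow> g \<in> mgen S \<Longrightarrow> s * g \<in> mgen S"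

lemma mgen_generator: "s \<in> S \<Longrightarrow> s \<in> mgen S"
  using mgen.step[OF _ mgen.one] by fastforce

lemma mgen_mult: "g \<in> mgen S \<Longrightarrow> h \<in> mgen S \<Longrightarrow> g * h \<in> mgen S"
  by (induction rule: mgen.induct) (auto simp: mult.assoc intro: mgen.step)

lemma mgen_power: "g \<in> mgen S \<Longrightarrow> g ^ i \<in> mgen S"
  by (induction i) (auto intro: mgen.one mgen_mult)

lemma mgen_subset: "mgen S \<subseteq> T" if "S \<subseteq> T" "1 \<in> T" "\<And>a b. a \<in> T \<Longrightarrow> b \<in> T \<Longrightarrow> a * b \<in> T"
proof
  fix g assume "g \<in> mgen S" then show "g \<in> T" by induction (use that in auto)
qed

lemma inverse_eq_power:
  fixes g :: "'a::group_mult"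
  assumes "g ^ n = 1" "n > 0" shows "inverse g = g ^ (n - 1)"
proof -
  have "g * g ^ (n - 1) = 1" using assms by (simp add: power_eq_if)
  then have "inverse g * (g * g ^ (n - 1)) = inverse g" by simp
  then show ?thesis by simp
qed

lemma subgrp_mgen:
  fixes S :: "'a::group_mult set"
  assumes "\<And>s. s \<in> S \<Longrightarrow> \<exists>n>0. s ^ n = 1"
  shows "subgrp (mgen S)"
proof -
  have "inverse g \<in> mgen S" if "g \<in> mgen S" for g
    using that
  proof induction
    case one show ?case using mgen.one by simp
  next
    case (step s g)
    obtain n where "n > 0" "s ^ n = 1" using assms[OF step(1)] by blast
    then have "inverse s \<in> mgen S" using inverse_eq_power mgen_power[OF mgen_generator[OF step(1)]] by metis
    then show ?case using step.IH mgen_mult by simp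
  qed
  then show ?thesis by (auto simp: subgrp_def mgen.one mgen_mult)
qed

lemma finite_subgrp_order:
  fixes g :: "'a::group_mult"
  assumes "finite T" "subgrp T" "g \<in> T"
  shows "\<exists>n>0. g ^ n = 1"
proof -
  have "g ^ i \<in> T" for i using assms by (induction i) (auto simp: subgrpD)
  then have "range (\<lambda>i::nat. g ^ i) \<subseteq> T" by blast
  then have "finite (range (\<lambda>i::nat. g ^ i))" using assms(1) finite_subset by blast
  then have "\<not> inj (\<lambda>i::nat. g ^ i)" using range_inj_infinite by blast
  then obtain i j :: nat where "g ^ i = g ^ j" "i < j"
    by (auto simp: inj_def) (metis linorder_neqE_nat)
  then have "g ^ (j - i) = 1" "j - i > 0"
    using power_add_exponent_cancel[of g i "j - i"] by auto
  then show ?thesis by blast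
qed

text \<open>Two involutions generate a dihedral group, in which their product spans a cyclic normal
  subgroup.\<close>

lemma generating_involutions_equal:
  assumes T: "nonabelian_simple T" "finite T" and gen: "mgen {\<alpha>, \<beta>} = T"
    and inv: "\<alpha> * \<alpha> = 1" "\<beta> * \<beta> = (1 :: 'a::group_mult)"
  shows "\<alpha> = \<beta>"
proof -
  have ab: "\<alpha> \<in> T" "\<beta> \<in> T" using gen mgen_generator by blast+
  have sT: "subgrp T" using T by (simp add: nonabelian_simple_def)
  define \<rho> where "\<rho> = \<alpha> * \<beta>"
  have \<rho>: "\<rho> \<in> T" using ab subgrpD(2)[OF sT] by (simp add: \<rho>_def)
  obtain n where n: "n > 0" "\<rho> ^ n = 1" using finite_subgrp_order[OF T(2) sT \<rho>] by blast
  have ia: "inverse \<alpha> = \<alpha>" "inverse \<beta> = \<beta>"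
    using inv by (metis mult_inverse_cancel(1) mult_1_right)+
  have conj: "s * \<rho> * inverse s = \<rho> ^ (n - 1)" if "s \<in> {\<alpha>, \<beta>}" for s
    using that inverse_eq_power[OF n(2,1)] inv by (auto simp: \<rho>_def ia mult.assoc simp flip: mult.assoc[of \<alpha> \<alpha>])
  have "\<rho> = 1"
  proof (rule nonabelian_simple_no_normal_cyclic[OF T(1) \<rho> n(2,1)])
    fix t assume "t \<in> T"
    then have "t \<in> mgen {\<alpha>, \<beta>}" by (simp add: gen)
    then show "\<exists>i. t * \<rho> * inverse t = \<rho> ^ i"
    proof induction
      case one show ?case by (intro exI[of _ 1]) simp
    next
      case (step s g)
      then obtain i where "g * \<rho> * inverse g = \<rho> ^ i" by blast
      then have "s * g * \<rho> * inverse (s * g) = (\<rho> ^ (n - 1)) ^ i"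
        unfolding conj_mult by (simp only: conj_power[symmetric] conj[OF step(1)])
      then show ?case by (metis power_mult)
    qed
  qed
  then have "\<alpha> * (\<alpha> * \<beta>) = \<alpha>" by (simp add: \<rho>_def)
  then show ?thesis by (simp add: inv flip: mult.assoc)
qed

lemma nonabelian_not_generated_by_inverse_pair:
  assumes T: "nonabelian_simple T" and gen: "mgen {\<alpha>, \<beta>} = T"
    and fin: "\<alpha> ^ n = 1" "n > 0"
  shows "\<beta> \<noteq> \<alpha>" "\<beta> \<noteq> inverse (\<alpha> :: 'a::group_mult)"
proof -
  have "\<not> (\<beta> = \<alpha> ^ j)" for j
  proof
    assume \<beta>: "\<beta> = \<alpha> ^ j"
    have "\<exists>i. t = \<alpha> ^ i" if "t \<in> mgen {\<alpha>, \<beta>}" for t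
      using that
    proof induction
      case one show ?case by (metis power_0)
    next
      case (step s g)
      then show ?case using \<beta> by (metis insertE power_Suc power_add singletonD)
    qed
    then have "a * b = b * a" if "a \<in> T" "b \<in> T" for a b
      using that gen by (metis add.commute power_add)
    then show False using T by (auto simp: nonabelian_simple_def)
  qed
  then show "\<beta> \<noteq> \<alpha>" "\<beta> \<noteq> inverse \<alpha>"
    using inverse_eq_power[OF fin] by (metis power_one_right, metis)
qed

section \<open>Arcs of a cycle\<close>

text \<open>The points after \<open>a\<close> up to \<open>b\<close> on the cycle of \<open>z\<close>. A step of \<open>z\<close> enters this set only at \<open>a\<close> and leaves it
  only at \<open>b\<close>.\<close>

definition half_open_arc :: "('a \<Rightarrow> 'a) \<Rightarrow> 'a \<Rightarrow> 'a \<Rightarrow> 'a set" where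
  "half_open_arc z a b = insert b (open_arc z a b)"

lemma half_open_arc_step:
  assumes inj: "inj z" and ab: "a \<noteq> b" "(z ^^ t) a = b"
  shows "a \<notin> half_open_arc z a b" "z a \<in> half_open_arc z a b"
    "b \<in> half_open_arc z a b" "z b \<notin> half_open_arc z a b"
    "w \<noteq> a \<Longrightarrow> w \<noteq> b \<Longrightarrow> z w \<in> half_open_arc z a b \<longleftrightarrow> w \<in> half_open_arc z a b"
proof -
  define k where "k = (LEAST k. (z ^^ k) a = b)"
  have k: "(z ^^ k) a = b" using LeastI[of "\<lambda>k. (z ^^ k) a = b"] ab(2) by (simp add: k_def)
  have least: "k \<le> i" if "(z ^^ i) a = b" for i
    using that by (simp add: k_def Least_le)
  have k0: "k > 0" using k ab(1) by (cases k) auto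
  have A: "half_open_arc z a b = {(z ^^ j) a | j. 0 < j \<and> j \<le> k}"
  proof -
    have *: "(\<forall>i. 0 < i \<and> i \<le> j \<longrightarrow> (z ^^ i) a \<noteq> b) \<longleftrightarrow> j < k" for j
    proof
      assume "\<forall>i. 0 < i \<and> i \<le> j \<longrightarrow> (z ^^ i) a \<noteq> b"
      then show "j < k" using k k0 by (metis linorder_not_less)
    next
      assume "j < k"
      then show "\<forall>i. 0 < i \<and> i \<le> j \<longrightarrow> (z ^^ i) a \<noteq> b" using least by fastforce
    qed
    have "open_arc z a b = {(z ^^ j) a | j. 0 < j \<and> j < k}" by (simp only: open_arc_def *)
    then show ?thesis unfolding half_open_arc_def using k k0 by (auto simp: le_less)
  qed
  have dist: "i = j" if "(z ^^ i) a = (z ^^ j) a" "i \<le> j" "j \<le> k" for i j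
  proof (rule ccontr)
    assume "i \<noteq> j"
    have per: "(z ^^ (j - i)) a = a" using funpow_diff[OF inj, of i j a] that(1,2) by simp
    have "(z ^^ (k - (j - i) + (j - i))) a = (z ^^ (k - (j - i))) a"
      by (simp only: funpow_add o_apply per)
    then have "(z ^^ k) a = (z ^^ (k - (j - i))) a" using that(2,3) by simp
    then show False using least[of "k - (j - i)"] k k0 \<open>i \<noteq> j\<close> that(2,3) by simp
  qed
  show "b \<in> half_open_arc z a b" by (simp add: half_open_arc_def)
  show "a \<notin> half_open_arc z a b" using dist[of 0] by (auto simp: A)
  show "z a \<in> half_open_arc z a b" using k0 by (auto simp: A intro!: exI[of _ 1])
  show "z b \<notin> half_open_arc z a b"
  proof
    assume "z b \<in> half_open_arc z a b"
    then obtain j where j: "z b = (z ^^ j) a" "0 < j" "j \<le> k" by (auto simp: A)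
    then have "z ((z ^^ k) a) = z ((z ^^ (j - 1)) a)" using k by (cases j) auto
    then have "(z ^^ (j - 1)) a = (z ^^ k) a" using inj by (simp add: inj_eq)
    then have "j - 1 = k" using dist[of "j - 1" k] j(3) by simp
    then show False using j(2,3) by linarith
  qed
  assume w: "w \<noteq> a" "w \<noteq> b"
  show "z w \<in> half_open_arc z a b \<longleftrightarrow> w \<in> half_open_arc z a b"
  proof
    assume "z w \<in> half_open_arc z a b"
    then obtain j where j: "z w = (z ^^ j) a" "0 < j" "j \<le> k" by (auto simp: A)
    then have "z w = z ((z ^^ (j - 1)) a)" by (cases j) auto
    then have "w = (z ^^ (j - 1)) a" using inj by (simp add: inj_eq)
    moreover have "j - 1 > 0" using w(1) calculation by (cases "j - 1") auto
    ultimately show "w \<in> half_open_arc z a b" using j by (auto simp: A intro!: exI[of _ "j - 1"])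
  next
    assume "w \<in> half_open_arc z a b"
    then obtain j where j: "w = (z ^^ j) a" "0 < j" "j \<le> k" by (auto simp: A)
    then have "j < k" using w(2) k by (cases "j = k") auto
    then show "z w \<in> half_open_arc z a b" using j by (auto simp: A intro!: exI[of _ "Suc j"])
  qed
qed

text \<open>The sum over \<open>\<Omega>\<close> of the product of the two indicator functions does not change when the
  functions are shifted by \<open>z\<close>. The shift contributes the values of one indicator at the ends of the
  other arc, with opposite signs at the two ends.\<close>

lemma unlinked_symmetric:
  assumes fin: "finite \<Omega>" "{a, b, c, d} \<subseteq> \<Omega>" and z: "bij_betw z \<Omega> \<Omega>" "inj z"
    and d: "distinct [a, b, c, d]" and ab: "(z ^^ t) a = b" and cd: "(z ^^ s) c = d"
    and cA: "c \<in> half_open_arc z a b \<longleftrightarrow> d \<in> half_open_arc z a b"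
  shows "a \<in> half_open_arc z c d \<longleftrightarrow> b \<in> half_open_arc z c d"
proof -
  define A where "A = half_open_arc z a b"
  define C where "C = half_open_arc z c d"
  have dab: "a \<noteq> b" and dcd: "c \<noteq> d" using d by auto
  note A = half_open_arc_step[OF z(2) dab ab, folded A_def]
  note C = half_open_arc_step[OF z(2) dcd cd, folded C_def]
  define f where "f w = (of_bool (w \<in> A \<and> w \<in> C) :: int)" for w
  have "(\<Sum>w\<in>\<Omega>. f (z w)) = (\<Sum>w\<in>\<Omega>. f w)" by (rule sum.reindex_bij_betw[OF z(1)])
  then have "0 = (\<Sum>w\<in>\<Omega>. f (z w) - f w)" by (simp add: sum_subtractf)
  also have "\<dots> = (\<Sum>w\<in>{a, b, c, d}. f (z w) - f w)"
    by (rule sum.mono_neutral_right) (use fin A(5) C(5) in \<open>auto simp: f_def\<close>)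
  also have "\<dots> = (f (z a) - f a) + (f (z b) - f b) + (f (z c) - f c) + (f (z d) - f d)"
    using d by simp
  also have "\<dots> = of_bool (a \<in> C) - of_bool (b \<in> C) + of_bool (c \<in> A) - of_bool (d \<in> A)"
  proof -
    have "z a \<in> C \<longleftrightarrow> a \<in> C" "z b \<in> C \<longleftrightarrow> b \<in> C" "z c \<in> A \<longleftrightarrow> c \<in> A" "z d \<in> A \<longleftrightarrow> d \<in> A"
      using d A(5) C(5) by auto
    then show ?thesis using A(1-4) C(1-4) by (simp add: f_def)
  qed
  finally show ?thesis using cA by (auto simp: A_def C_def split: if_splits)
qed


section \<open>A pair of handles\<close>

definition handle_label :: "'w \<Rightarrow> 'w \<Rightarrow> 'w \<Rightarrow> 'w \<Rightarrow> 'a::group_mult \<Rightarrow> 'a \<Rightarrow> 'w \<Rightarrow> 'a" where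
  "handle_label a b c d \<alpha> \<beta> w =
     (if w = a then \<alpha> else if w = b then inverse \<alpha> else if w = c then \<beta> else if w = d then inverse \<beta> else 1)"

locale handle_pair =
  fixes \<Omega> :: "'w set" and x y :: "'w perm" and a b c d :: 'w and t :: nat
    and \<alpha> \<beta> :: "'a::group_mult" and X Y :: "('w, 'a) wr"
  assumes finite_\<Omega>: "finite \<Omega>" and x\<Omega>: "affected x \<subseteq> \<Omega>" and y\<Omega>: "affected y \<subseteq> \<Omega>"
    and dist: "distinct [a, b, c, d]" and pts: "{a, b, c, d} \<subseteq> \<Omega>"
    and fixed: "\<And>e. e \<in> {a, b, c, d} \<Longrightarrow> x $ e = e"
    and ab: "((y * x) ^ t) $ a = b" and cd: "((y * x) ^ t) $ c = d"
    and unlinked: "unlinked (apply (y * x)) a b c d"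
    and X: "X = Wr (handle_label a b c d \<alpha> \<beta>) x" and Y: "Y = Wr (\<lambda>_. 1) y"
begin

abbreviation z where "z \<equiv> y * x"
abbreviation A where "A \<equiv> half_open_arc (apply z) a b"
abbreviation C where "C \<equiv> half_open_arc (apply z) c d"

lemma label_simps [simp]:
  "handle_label a b c d \<alpha> \<beta> a = \<alpha>" "handle_label a b c d \<alpha> \<beta> b = inverse \<alpha>"
  "handle_label a b c d \<alpha> \<beta> c = \<beta>" "handle_label a b c d \<alpha> \<beta> d = inverse \<beta>"
  using dist by (auto simp: handle_label_def)

lemma label_other [simp]: "w \<notin> {a, b, c, d} \<Longrightarrow> handle_label a b c d \<alpha> \<beta> w = 1"
  by (auto simp: handle_label_def)

lemma label_cases:
  obtains "w = a" | "w = b" | "w = c" | "w = d" | "w \<notin> {a, b, c, d}" by blast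

lemma inj_z: "inj (apply z)" using bij_apply bij_is_inj by blast

lemma ab_neq: "a \<noteq> b" "c \<noteq> d" using dist by auto

lemma ab': "((apply z) ^^ t) a = b" "((apply z) ^^ t) c = d"
  using ab cd by (simp_all add: apply_power)

lemmas arc_ab = half_open_arc_step[OF inj_z ab_neq(1) ab'(1)]
lemmas arc_cd = half_open_arc_step[OF inj_z ab_neq(2) ab'(2)]

lemma unlinked_ab: "c \<in> A \<longleftrightarrow> d \<in> A"
  using unlinked dist by (auto simp: unlinked_def half_open_arc_def)

lemma unlinked_cd: "a \<in> C \<longleftrightarrow> b \<in> C"
proof (rule unlinked_symmetric[OF finite_\<Omega> pts _ inj_z dist ab' unlinked_ab])
  have "affected z \<subseteq> \<Omega>" using affected_times[of y x] x\<Omega> y\<Omega> by blast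
  then show "bij_betw (apply z) \<Omega> \<Omega>" by (intro permutes_imp_bij apply_permutes)
qed

text \<open>A relabelling of the fibres that trivialises \<open>Y * X\<close>. Along a cycle of \<open>z\<close> the label \<open>\<alpha>\<close> is switched on
  at \<open>a\<close> and off at \<open>b\<close>, and likewise \<open>\<beta>\<close> between \<open>c\<close> and \<open>d\<close>. Labels multiply from the left, so at \<open>c\<close>
  and \<open>d\<close> the \<open>\<alpha>\<close>-factor has to be trivial; as \<open>c\<close> and \<open>d\<close> are both inside or both outside the arc
  of \<open>a\<close> and \<open>b\<close>, a shift of the exponent achieves this.\<close>

definition gauge :: "'w \<Rightarrow> 'a" where
  "gauge w = (if c \<in> A then if w \<in> A then 1 else inverse \<alpha> else if w \<in> A then \<alpha> else 1)
     * (if w \<in> C then \<beta> else 1)"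

lemma gauge_step: "gauge (z $ w) = handle_label a b c d \<alpha> \<beta> w * gauge w"
proof (cases rule: label_cases[of w])
  case 1
  have "z $ a \<in> C \<longleftrightarrow> a \<in> C" using arc_cd(5)[of a] dist by auto
  then show ?thesis using 1 arc_ab by (simp add: gauge_def)
next
  case 2
  have "z $ b \<in> C \<longleftrightarrow> b \<in> C" using arc_cd(5)[of b] dist by auto
  then show ?thesis using 2 arc_ab by (simp add: gauge_def)
next
  case 3
  have "z $ c \<in> A \<longleftrightarrow> c \<in> A" using arc_ab(5)[of c] dist by auto
  then show ?thesis using 3 arc_cd by (simp add: gauge_def)
next
  case 4
  have "z $ d \<in> A \<longleftrightarrow> c \<in> A" using arc_ab(5)[of d] dist unlinked_ab by auto
  then show ?thesis using 4 arc_cd unlinked_ab by (simp add: gauge_def)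
next
  case 5
  then have "z $ w \<in> A \<longleftrightarrow> w \<in> A" "z $ w \<in> C \<longleftrightarrow> w \<in> C" using arc_ab(5)[of w] arc_cd(5)[of w] by auto
  then show ?thesis using 5 by (simp add: gauge_def)
qed

lemma top_XY [simp]: "top X = x" "top Y = y" by (simp_all add: X Y)

lemma fib_XY [simp]: "fib X w = handle_label a b c d \<alpha> \<beta> w" "fib Y w = 1" by (simp_all add: X Y)

lemma top_power: "top (h ^ i) = top h ^ i" for h :: "('w, 'a) wr" by (induction i) simp_all

lemma fib_z_power: "fib ((Y * X) ^ i) w = gauge ((z ^ i) $ w) * inverse (gauge w)"
proof (induction i)
  case (Suc i)
  have "fib ((Y * X) ^ Suc i) w = fib (Y * X) ((z ^ i) $ w) * fib ((Y * X) ^ i) w"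
    by (simp add: top_power del: fib_XY)
  also have "\<dots> = handle_label a b c d \<alpha> \<beta> ((z ^ i) $ w) * gauge ((z ^ i) $ w) * inverse (gauge w)"
    using Suc by (simp add: mult.assoc)
  also have "\<dots> = gauge (z $ ((z ^ i) $ w)) * inverse (gauge w)"
    by (simp only: gauge_step)
  finally show ?case by (simp add: apply_times)
qed simp

text \<open>At \<open>a\<close> and \<open>b\<close> the \<open>\<beta>\<close>-factors have to cancel; this is the symmetric form of being unlinked.\<close>

lemma handle_transport: "fib ((Y * X) ^ t) a = \<alpha>" "fib ((Y * X) ^ t) c = \<beta>"
  using unlinked_ab unlinked_cd arc_ab arc_cd
  by (auto simp: fib_z_power ab cd gauge_def mult.assoc)

lemma z_power_eq_1: "(Y * X) ^ r = 1" if "z ^ r = 1"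
  using that by (intro wr_eqI) (simp_all add: top_power fib_z_power)

lemma Y_power_eq_1: "Y ^ q = 1" if "y ^ q = 1"
proof (rule wr_eqI)
  show "fib (Y ^ q) w = fib 1 w" for w
    by (induction q) simp_all
qed (simp add: top_power that)

lemma fib_X_power: "fib (X ^ i) w = handle_label a b c d \<alpha> \<beta> w ^ i"
proof (induction i arbitrary: w)
  case (Suc i)
  have "handle_label a b c d \<alpha> \<beta> (x $ w) = handle_label a b c d \<alpha> \<beta> w"
  proof (cases "w \<in> {a, b, c, d}")
    case False
    then have "x $ w \<notin> {a, b, c, d}" using fixed apply_inj[of x w] by (metis)
    then show ?thesis using False by (metis label_other)
  qed (use fixed in auto)
  then show ?case using Suc by (simp add: power_Suc2 del: power_Suc)
qed simp

lemma X_power_eq_1: "X ^ p = 1" if "x ^ p = 1" "\<alpha> ^ p = 1" "\<beta> ^ p = 1"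
proof (rule wr_eqI)
  have "inverse \<alpha> ^ p = 1" "inverse \<beta> ^ p = 1" using that by (simp_all flip: inverse_power_group)
  then show "fib (X ^ p) w = fib 1 w" for w
    using that by (auto simp: fib_X_power handle_label_def)
qed (simp add: top_power that)

end


section \<open>Generation of the wreath product\<close>

lemma finite_alt_perms: "finite (alt_perms {1..m::nat})" and card_alt_perms: "m \<ge> 2 \<Longrightarrow> 2 * card (alt_perms {1..m}) = fact m"
proof -
  have inj: "inj_on apply (alt_perms {1..m})" by (auto simp: inj_on_def apply_inject)
  have im: "apply ` alt_perms {1..m} = carrier (alt_group m)"
  proof (intro equalityI subsetI)
    fix f assume "f \<in> carrier (alt_group m)"
    then have f: "f permutes {1..m}" "evenperm f" by (simp_all add: alt_group_carrier)
    then have "f \<in> {f. bij f \<and> finite {a. f a \<noteq> a}}"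
      using permutation permutation_permutes by blast
    then have Pf: "apply (Perm f) = f" by (rule Perm_inverse)
    moreover have "affected (Perm f) \<subseteq> {1..m}"
      using permutes_not_in[OF f(1)] unfolding subset_iff in_affected Pf by blast
    ultimately have "Perm f \<in> alt_perms {1..m}" using f(2) Pf by (simp add: alt_perms_def)
    then show "f \<in> apply ` alt_perms {1..m}" using Pf by (metis imageI)
  qed (auto simp: alt_perms_def alt_group_carrier apply_permutes)
  have "finite (carrier (alt_group m))"
    by (rule finite_subset[OF _ finite_permutations[of "{1..m}"]]) (auto simp: alt_group_carrier)
  then show "finite (alt_perms {1..m})" using finite_imageD[OF _ inj] im by simp
  show "2 * card (alt_perms {1..m}) = fact m" if "m \<ge> 2"
    using alt_group_card_carrier[OF that] card_image[OF inj] im by simp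
qed

text \<open>Trivial values outside \<open>{1..n}\<close> make \<open>alt_wreath m n\<close> isomorphic to the wreath product, with no
  spurious coordinates.\<close>

definition alt_wreath :: "nat \<Rightarrow> nat \<Rightarrow> (nat, nat perm) wr set" where
  "alt_wreath m n = {h. top h \<in> alt_perms {1..n} \<and> (\<forall>w\<in>{1..n}. fib h w \<in> alt_perms {1..m})
     \<and> (\<forall>w. w \<notin> {1..n} \<longrightarrow> fib h w = 1)}"

lemma subgrp_alt_wreath: "subgrp (alt_wreath m n)"
  unfolding subgrp_def
proof (intro conjI ballI)
  show "1 \<in> alt_wreath m n" by (simp add: alt_wreath_def alt_perms_closed)
  have in\<Omega>: "top h $ w \<in> {1..n} \<longleftrightarrow> w \<in> {1..n}" if "h \<in> alt_wreath m n" for h w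
  proof -
    have "affected (top h) \<subseteq> {1..n}" using that by (simp add: alt_wreath_def alt_perms_def)
    then show ?thesis by (rule permutes_in_image[OF apply_permutes])
  qed
  show "g * h \<in> alt_wreath m n" if "g \<in> alt_wreath m n" "h \<in> alt_wreath m n" for g h
    using that in\<Omega>[OF that(2)] by (auto simp: alt_wreath_def alt_perms_closed simp del: atLeastAtMost_iff)
  show "inverse g \<in> alt_wreath m n" if g: "g \<in> alt_wreath m n" for g
  proof -
    have "inverse (top g) $ w \<in> {1..n} \<longleftrightarrow> w \<in> {1..n}" for w
      using in\<Omega>[OF g, of "inverse (top g) $ w"] by simp
    then show ?thesis using g by (auto simp: alt_wreath_def alt_perms_closed fib_inverse simp del: atLeastAtMost_iff)
  qed
qed

theorem handles_generate_wreath_product: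
  fixes n m p q r t a b c d :: nat
  assumes n: "n > 6" and m: "m \<ge> 5" "m \<noteq> n - 1" and p: "prime p"
    and hp: "handle_pair {1..n} x y a b c d t \<alpha> \<beta> X Y"
    and x: "x ^ p = 1" and y: "y ^ q = 1" "q > 0" and z: "(y * x) ^ r = 1" "r > 0"
    and top_gen: "mgen {x, y} = alt_perms {1..n}"
    and \<alpha>: "\<alpha> ^ p = 1" and \<beta>: "\<beta> ^ p = 1" and fib_gen: "mgen {\<alpha>, \<beta>} = alt_perms {1..m}"
  shows "mgen {X, Y} = alt_wreath m n"
proof -
  note One_nat_def [simp del]
  interpret handle_pair "{1..n}" x y a b c d t \<alpha> \<beta> X Y by (rule hp)
  define \<Omega> where "\<Omega> = {1..n}"
  define H where "H = mgen {X, Y}"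
  define T where "T = alt_perms {1..m}"
  have T: "nonabelian_simple T" using nonabelian_simple_alt_perms[OF m(1)] by (simp add: T_def)
  then have sT: "subgrp T" by (simp add: nonabelian_simple_def)
  have p0: "p > 0" using p prime_gt_0_nat by blast
  have \<alpha>\<beta>T: "\<alpha> \<in> T" "\<beta> \<in> T" using mgen_generator[of \<alpha> "{\<alpha>, \<beta>}"] mgen_generator[of \<beta> "{\<alpha>, \<beta>}"] fib_gen by (simp_all add: T_def)
  have xyA: "x \<in> alt_perms \<Omega>" "y \<in> alt_perms \<Omega>" using mgen_generator[of x "{x, y}"] mgen_generator[of y "{x, y}"] top_gen by (simp_all add: \<Omega>_def)
  have abcd\<Omega>: "a \<in> \<Omega>" "b \<in> \<Omega>" "c \<in> \<Omega>" "d \<in> \<Omega>" using pts by (auto simp: \<Omega>_def)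
  have fin\<Omega>: "finite \<Omega>" "card \<Omega> = n" by (simp_all add: \<Omega>_def)
  have XYH: "X \<in> H" "Y \<in> H" using mgen_generator[of X "{X, Y}"] mgen_generator[of Y "{X, Y}"] by (simp_all add: H_def)
  have Hs: "subgrp H"
    unfolding H_def
  proof (rule subgrp_mgen)
    fix s assume "s \<in> {X, Y}"
    then show "\<exists>n>0. s ^ n = 1" using X_power_eq_1[OF x \<alpha> \<beta>] Y_power_eq_1[OF y(1)] p0 y(2) by blast
  qed
  have XYW: "X \<in> alt_wreath m n" "Y \<in> alt_wreath m n"
  proof -
    have "fib X w = 1" if "w \<notin> {1..n}" for w using that pts by (subst fib_XY, intro label_other) auto
    moreover have "fib X w \<in> alt_perms {1..m}" for w
      using \<alpha>\<beta>T subgrpD[OF sT] by (auto simp: handle_label_def T_def[symmetric])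
    ultimately show "X \<in> alt_wreath m n" using xyA by (simp add: alt_wreath_def \<Omega>_def del: fib_XY)
    show "Y \<in> alt_wreath m n" using xyA by (simp add: alt_wreath_def \<Omega>_def alt_perms_closed)
  qed
  have HW: "H \<subseteq> alt_wreath m n"
    unfolding H_def using XYW subgrpD[OF subgrp_alt_wreath] by (intro mgen_subset) auto
  have top_onto: "\<exists>h\<in>H. top h = s" if "s \<in> alt_perms \<Omega>" for s
  proof -
    have "s \<in> mgen {x, y}" using that top_gen by (simp add: \<Omega>_def)
    then show ?thesis
    proof induction
      case one show ?case using subgrpD(1)[OF Hs] by (intro bexI[of _ 1]) simp_all
    next
      case (step s g)
      then obtain h where "h \<in> H" "top h = g" by blast
      moreover obtain k where "k \<in> H" "top k = s" using step(1) XYH top_XY by auto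
      ultimately show ?case using subgrpD(2)[OF Hs] by (intro bexI[of _ "k * h"]) simp_all
    qed
  qed
  have two: "\<exists>h\<in>H. top h $ e = e' \<and> top h $ f = f'"
    if "e \<in> \<Omega>" "f \<in> \<Omega>" "e' \<in> \<Omega>" "f' \<in> \<Omega>" "e \<noteq> f" "e' \<noteq> f'" for e f e' f'
    using alt_perms_two_transitive[of \<Omega> e f e' f'] that fin\<Omega> n top_onto by fastforce
  \<comment> \<open>A word that leads from \<open>w\<close> to \<open>w'\<close> may skip \<open>x\<close> whenever it stands at a handle point, since \<open>x\<close> fixes it.\<close>
  have transport: "\<exists>h\<in>H. top h $ w = w' \<and> fib h w = 1" if w: "w \<in> \<Omega>" "w' \<in> \<Omega>" for w w'
  proof -
    have "\<exists>s\<in>alt_perms \<Omega>. s $ w = w'"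
    proof -
      obtain f f' where "f \<in> \<Omega>" "f \<noteq> w" "f' \<in> \<Omega>" "f' \<noteq> w'"
        using pts dist unfolding \<Omega>_def by (metis distinct_length_2_or_more insert_subset)
      then show ?thesis using alt_perms_two_transitive[of \<Omega> w f w' f'] w fin\<Omega> n by auto
    qed
    then obtain s where s: "s \<in> mgen {x, y}" "s $ w = w'" using top_gen by (auto simp: \<Omega>_def)
    from s(1) have "\<exists>h\<in>H. top h $ w = s $ w \<and> fib h w = 1"
    proof induction
      case one show ?case using subgrpD(1)[OF Hs] by (intro bexI[of _ 1]) simp_all
    next
      case (step s g)
      then obtain h where h: "h \<in> H" "top h $ w = g $ w" "fib h w = 1" by blast
      show ?case
      proof (cases "s = x \<and> g $ w \<in> {a, b, c, d}")
        case True
        then show ?thesis using h fixed by (intro bexI[of _ h]) (simp_all add: apply_times)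
      next
        case False
        then consider "s = x" "g $ w \<notin> {a, b, c, d}" | "s = y" using step(1) by blast
        then show ?thesis
        proof cases
          case 1
          then show ?thesis using h XYH(1) subgrpD(2)[OF Hs]
            by (intro bexI[of _ "X * h"]) (simp_all add: apply_times)
        next
          case 2
          then show ?thesis using h XYH(2) subgrpD(2)[OF Hs]
            by (intro bexI[of _ "Y * h"]) (simp_all add: apply_times)
        qed
      qed
    qed
    then show ?thesis using s(2) by simp
  qed
  \<comment> \<open>The stabiliser of the fibre over \<open>a\<close> sees \<open>\<alpha>\<close> there and, by transport, \<open>\<beta>\<close> from the fibre over \<open>c\<close>.\<close>
  define St where "St w = {fib h w | h. h \<in> H \<and> top h $ w = w}" for w
  have St_conj: "St w \<subseteq> St w'" if w: "w \<in> \<Omega>" "w' \<in> \<Omega>" for w w'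
  proof
    fix g assume "g \<in> St w"
    then obtain h where h: "h \<in> H" "top h $ w = w" "fib h w = g" by (auto simp: St_def)
    obtain k where k: "k \<in> H" "top k $ w = w'" "fib k w = 1" using transport[OF w] by blast
    have kw: "inverse (top k) $ w' = w" using perm_inverse_apply(1)[of "top k" w] k(2) by simp
    have "fib (k * h * inverse k) w' = g" "top (k * h * inverse k) $ w' = w'"
      using h k kw fib_inverse'[of k w] by (simp_all add: apply_times)
    moreover have "k * h * inverse k \<in> H" using h k subgrpD[OF Hs] by simp
    ultimately show "g \<in> St w'" unfolding St_def by blast
  qed
  have St: "St w = T" if w: "w \<in> \<Omega>" for w
  proof
    show "St w \<subseteq> T" using HW w by (auto simp: St_def T_def alt_wreath_def \<Omega>_def)
    have "fib X a \<in> St a" "fib X c \<in> St c"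
      unfolding St_def using XYH(1) fixed[of a] fixed[of c] top_XY(1) by (metis (mono_tags, lifting) CollectI insertCI)+
    then have "\<alpha> \<in> St a" "\<beta> \<in> St c" by simp_all
    then have "\<alpha> \<in> St w" "\<beta> \<in> St w" using St_conj abcd\<Omega> w by blast+
    moreover have "1 \<in> St w" unfolding St_def using subgrpD(1)[OF Hs] by (intro CollectI exI[of _ 1]) simp
    moreover have "g * h \<in> St w" if gh: "g \<in> St w" "h \<in> St w" for g h
    proof -
      obtain k l where "k \<in> H" "top k $ w = w" "g = fib k w" "l \<in> H" "top l $ w = w" "h = fib l w"
        using gh by (auto simp: St_def)
      then show ?thesis unfolding St_def using subgrpD(2)[OF Hs]
        by (intro CollectI exI[of _ "k * l"]) (simp add: apply_times)
    qed
    ultimately have "mgen {\<alpha>, \<beta>} \<subseteq> St w" by (intro mgen_subset) auto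
    then show "T \<subseteq> St w" by (simp add: fib_gen T_def)
  qed
  interpret fibred_group \<Omega> T H
  proof
    show "subgrp H" "finite \<Omega>" "3 \<le> card \<Omega>" "nonabelian_simple T" using Hs fin\<Omega> n T by simp_all
    fix h w assume h: "h \<in> H"
    then have aff: "affected (top h) \<subseteq> \<Omega>" using HW by (auto simp: alt_wreath_def alt_perms_def \<Omega>_def)
    show "top h $ w \<in> \<Omega>" if "w \<in> \<Omega>" using apply_inside[OF aff that] .
    show "top h $ w = w" if "w \<notin> \<Omega>" using apply_outside[OF aff that] .
    show "fib h w \<in> T" if "w \<in> \<Omega>" using h HW that by (auto simp: alt_wreath_def T_def \<Omega>_def)
    show "fib h w = 1" if "w \<notin> \<Omega>" using h HW that by (auto simp: alt_wreath_def \<Omega>_def)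
  next
    show "\<exists>h\<in>H. top h $ w = w \<and> fib h w = t" if "w \<in> \<Omega>" "t \<in> T" for w t
      using St[OF that(1)] that(2) by (auto simp: St_def)
  qed (rule two)
  have "\<not> faithful_coordinates"
  proof
    assume fc: "faithful_coordinates"
    then show False
    proof (cases rule: faithful_cases)
      assume K1: "K = {1}"
      have n\<Omega>: "n \<in> \<Omega>" using n by (simp add: \<Omega>_def)
      have st: "top ` {h \<in> H. top h $ n = n} = alt_perms {1..n - 1}"
      proof (intro equalityI subsetI)
        fix s assume "s \<in> top ` {h \<in> H. top h $ n = n}"
        then have s: "s \<in> alt_perms {1..n}" "s $ n = n" using HW by (auto simp: alt_wreath_def)
        have "{1..n} - {n} = {1..n - 1}" using n by auto
        moreover have "affected s \<subseteq> {1..n} - {n}" using s by (auto simp: alt_perms_def in_affected)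
        ultimately show "s \<in> alt_perms {1..n - 1}" using s(1) by (simp add: alt_perms_def)
      next
        fix s assume s: "s \<in> alt_perms {1..n - 1}"
        have "{1..n - 1} \<subseteq> \<Omega>" by (auto simp: \<Omega>_def)
        then have "s \<in> alt_perms \<Omega>" using s by (auto simp: alt_perms_def simp del: atLeastAtMost_iff)
        then obtain h where "h \<in> H" "top h = s" using top_onto by blast
        moreover have "s $ n = n" using s n by (intro apply_outside[of s "{1..n - 1}"]) (auto simp: alt_perms_def)
        ultimately show "s \<in> top ` {h \<in> H. top h $ n = n}" by blast
      qed
      have "card T = card (alt_perms {1..n - 1})"
        using card_of_trivial_kernel[OF K1 n\<Omega>] nonabelian_simple_alt_perms[of "n - 1"] n by (simp add: st)
      then have "(fact m :: nat) = fact (n - 1)"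
        using card_alt_perms[of m] card_alt_perms[of "n - 1"] m n by (simp add: T_def)
      moreover have "m < n - 1 \<or> n - 1 < m" using m(2) by linarith
      ultimately show False
        using fact_less_mono_nat[of m "n - 1"] fact_less_mono_nat[of "n - 1" m] m n by auto
    next
      assume onto: "\<And>w t. w \<in> \<Omega> \<Longrightarrow> t \<in> T \<Longrightarrow> \<exists>k\<in>K. fib k w = t"
      interpret D: diagonal_group \<Omega> T H a
        by unfold_locales (use fc onto abcd\<Omega> in auto)
      have "\<beta> = \<alpha> \<or> \<beta> = inverse \<alpha>"
      proof (cases "odd p")
        case True
        then obtain k where k: "p = 2 * k + 1" by (elim oddE)
        show ?thesis
        proof (rule D.handles_parallel[OF XYH, of a b c d \<alpha> \<beta> t r k])
          fix P h assume P: "P 1" "\<And>h. h \<in> H \<Longrightarrow> P h \<Longrightarrow> P (X * h)" "\<And>h. h \<in> H \<Longrightarrow> P h \<Longrightarrow> P (Y * h)"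
            and h: "h \<in> H"
          have "h \<in> H \<and> P h"
            using h unfolding H_def
          proof induction
            case (step s g)
            then show ?case using P(2,3)[of g] XYH subgrpD(2)[OF Hs] by (auto simp: H_def)
          qed (use P mgen.one in auto)
          then show "P h" by blast
        next
          show "fib X w = 1" if "w \<in> \<Omega> - {a, b, c, d}" for w using that by simp
        qed (use dist pts fixed ab cd handle_transport z_power_eq_1[OF z(1)] z(2) \<alpha> k in \<open>simp_all add: \<Omega>_def top_power\<close>)
      next
        case False
        then have "p = 2" using p primes_dvd_imp_eq[OF two_is_prime_nat, of p] by simp
        then have "\<alpha> * \<alpha> = 1" "\<beta> * \<beta> = 1" using \<alpha> \<beta> by (simp_all add: power2_eq_square)
        then show ?thesis
          using generating_involutions_equal[OF T _ fib_gen[folded T_def]] finite_alt_perms by (simp add: T_def)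
      qed
      then show False
        using nonabelian_not_generated_by_inverse_pair[OF T fib_gen[folded T_def] \<alpha> p0] by blast
    qed
  qed
  note full = unfaithful_imp_full[OF this]
  have "alt_wreath m n \<subseteq> H"
  proof
    fix g assume g: "g \<in> alt_wreath m n"
    then obtain h where h: "h \<in> H" "top h = top g" using top_onto[of "top g"] by (auto simp: alt_wreath_def \<Omega>_def)
    define f where "f = g * inverse h"
    have f: "f \<in> alt_wreath m n" using g h HW subgrpD[OF subgrp_alt_wreath] by (auto simp: f_def)
    have tf: "top f = 1" by (simp add: f_def h)
    have "\<exists>k\<in>K. \<forall>w\<in>\<Omega>. fib k w = fib f w"
      using f by (intro full) (auto simp: alt_wreath_def T_def \<Omega>_def)
    then obtain k where k: "k \<in> K" "\<forall>w\<in>\<Omega>. fib k w = fib f w" by blast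
    have "k = f"
    proof (rule wr_eqI)
      show "top k = top f" using k(1) tf by simp
      show "fib k w = fib f w" for w
        using k(2) f fib_out[OF KH[OF k(1)], of w] by (cases "w \<in> \<Omega>") (auto simp: alt_wreath_def \<Omega>_def)
    qed
    then have "f * h \<in> H" using k(1) KH h(1) subgrpD(2)[OF Hs] by blast
    then show "g \<in> H" by (simp add: f_def mult.assoc)
  qed
  then show ?thesis using HW by (simp add: H_def)
qed

section \<open>Homomorphisms from a presented group\<close>

fun eval_word :: "('k, 'c) monoid_scheme \<Rightarrow> ('a \<Rightarrow> 'k) \<Rightarrow> 'a word \<Rightarrow> 'k" where
  "eval_word K \<gamma> [] = \<one>\<^bsub>K\<^esub>"
| "eval_word K \<gamma> ((s, e) # w) = (if e then \<gamma> s else inv\<^bsub>K\<^esub> \<gamma> s) \<otimes>\<^bsub>K\<^esub> eval_word K \<gamma> w"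

context group
begin

lemma eval_word_closed: "(\<And>s. \<gamma> s \<in> carrier G) \<Longrightarrow> eval_word G \<gamma> w \<in> carrier G"
  by (induction w) auto

lemma eval_word_append:
  assumes "\<And>s. \<gamma> s \<in> carrier G"
  shows "eval_word G \<gamma> (u @ v) = eval_word G \<gamma> u \<otimes> eval_word G \<gamma> v"
proof -
  have "eval_word G \<gamma> w \<in> carrier G" for w by (rule eval_word_closed) (rule assms)
  then show ?thesis by (induction u) (auto simp: m_assoc assms)
qed

lemma eval_word_pres_rel:
  assumes \<gamma>: "\<And>s. \<gamma> s \<in> carrier G" and R: "\<And>w. w \<in> R \<Longrightarrow> eval_word G \<gamma> w = \<one>"
    and uv: "(u, v) \<in> pres_rel R"
  shows "eval_word G \<gamma> u = eval_word G \<gamma> v"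
  using uv
proof induction
  case (cancel u s e v)
  have "eval_word G \<gamma> [(s, e), (s, \<not> e)] = \<one>" using \<gamma> by (cases e) auto
  then show ?case
    using eval_word_append[of \<gamma> u "[(s, e), (s, \<not> e)] @ v"] eval_word_append[of \<gamma> "[(s, e), (s, \<not> e)]" v]
      eval_word_append[of \<gamma> u v] eval_word_closed[of \<gamma>] \<gamma> by simp
next
  case (relator w u v)
  then show ?case
    using R eval_word_append[of \<gamma> u "w @ v"] eval_word_append[of \<gamma> w v]
      eval_word_append[of \<gamma> u v] eval_word_closed[of \<gamma>] \<gamma> by simp
qed auto

end

lemma presented_group_carrier: "carrier (presented_group R) = {pres_rel R `` {w} | w. True}"
  by (auto simp: presented_group_def quotient_def)

lemma presented_group_one: "\<one>\<^bsub>presented_group R\<^esub> = pres_rel R `` {[]}"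
  by (simp add: presented_group_def)

lemma pres_gen_closed: "pres_gen R s \<in> carrier (presented_group R)"
  by (auto simp: presented_group_carrier pres_gen_def)

lemma presented_group_hom_exists:
  assumes K: "group K" and \<gamma>: "\<And>s. \<gamma> s \<in> carrier K" and R: "\<And>w. w \<in> R \<Longrightarrow> eval_word K \<gamma> w = \<one>\<^bsub>K\<^esub>"
  shows "\<exists>\<phi>\<in>hom (presented_group R) K. \<forall>s. \<phi> (pres_gen R s) = \<gamma> s"
proof -
  interpret K: group K by (rule K)
  define \<phi> where "\<phi> A = eval_word K \<gamma> (SOME u. u \<in> A)" for A
  have \<phi>: "\<phi> (pres_rel R `` {w}) = eval_word K \<gamma> w" for w
  proof -
    have "w \<in> pres_rel R `` {w}" by (simp add: pres_rel.refl)
    then have "(SOME u. u \<in> pres_rel R `` {w}) \<in> pres_rel R `` {w}" by (rule someI)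
    then show ?thesis unfolding \<phi>_def using K.eval_word_pres_rel[OF \<gamma> R] by (metis Image_singleton_iff)
  qed
  have "\<phi> \<in> hom (presented_group R) K"
    by (rule homI) (auto simp: presented_group_carrier presented_group_mult \<phi> K.eval_word_closed \<gamma> K.eval_word_append)
  moreover have "\<phi> (pres_gen R s) = \<gamma> s" for s
    using \<gamma>[of s] by (simp add: pres_gen_def \<phi>)
  ultimately show ?thesis by blast
qed

lemma hom_presented_group_eval:
  assumes K: "group K" and \<phi>: "\<phi> \<in> hom (presented_group R) K"
  shows "\<phi> (pres_rel R `` {w}) = eval_word K (\<lambda>s. \<phi> (pres_gen R s)) w"
proof -
  interpret group_hom "presented_group R" K \<phi>
    using K \<phi> group_presented_group by (simp add: group_hom_def group_hom_axioms_def)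
  have letter: "\<phi> (pres_rel R `` {[(s, e)]}) = (if e then \<phi> (pres_gen R s) else inv\<^bsub>K\<^esub> \<phi> (pres_gen R s))" for s e
  proof (cases e)
    case False
    have "pres_rel R `` {[(s, False)]} \<otimes>\<^bsub>presented_group R\<^esub> pres_gen R s = \<one>\<^bsub>presented_group R\<^esub>"
      unfolding pres_gen_def presented_group_mult presented_group_one
      using pres_rel.cancel[of "[]" s False "[]" R] by (intro equiv_class_eq[OF equiv_pres_rel]) simp
    then have "inv\<^bsub>presented_group R\<^esub> (pres_gen R s) = pres_rel R `` {[(s, False)]}"
      using pres_gen_closed by (intro G.inv_equality) (auto simp: presented_group_carrier)
    then show ?thesis using False hom_inv[OF pres_gen_closed[of R s]] by simp
  qed (simp add: pres_gen_def)
  show ?thesis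
  proof (induction w)
    case Nil
    show ?case using hom_one by (simp add: presented_group_one)
  next
    case (Cons l w)
    obtain s e where l: "l = (s, e)" by force
    have "\<phi> (pres_rel R `` {l # w}) = \<phi> (pres_rel R `` {[l]} \<otimes>\<^bsub>presented_group R\<^esub> pres_rel R `` {w})"
      by (simp add: presented_group_mult)
    also have "\<dots> = \<phi> (pres_rel R `` {[l]}) \<otimes>\<^bsub>K\<^esub> \<phi> (pres_rel R `` {w})"
      by (rule hom_mult) (auto simp: presented_group_carrier)
    finally show ?case by (simp add: l letter Cons)
  qed
qed

lemma hom_presented_group_relator:
  assumes K: "group K" and \<phi>: "\<phi> \<in> hom (presented_group R) K" and w: "w \<in> R"
  shows "eval_word K (\<lambda>s. \<phi> (pres_gen R s)) w = \<one>\<^bsub>K\<^esub>"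
proof -
  interpret group_hom "presented_group R" K \<phi>
    using K \<phi> group_presented_group by (simp add: group_hom_def group_hom_axioms_def)
  have "pres_rel R `` {w} = \<one>\<^bsub>presented_group R\<^esub>"
    unfolding presented_group_one
    using pres_rel.relator[OF w, of "[]" "[]"] by (intro equiv_class_eq[OF equiv_pres_rel]) simp
  then show ?thesis using hom_presented_group_eval[OF K \<phi>, of w] hom_one by simp
qed

section \<open>Groups of permutations acting on the right\<close>

lemma perm_group_simps:
  "carrier (perm_group X) = {f. f permutes X}" "f \<otimes>\<^bsub>perm_group X\<^esub> g = g \<circ> f" "\<one>\<^bsub>perm_group X\<^esub> = id"
  by (simp_all add: perm_group_def)

lemma perm_group_inv: "f permutes X \<Longrightarrow> inv\<^bsub>perm_group X\<^esub> f = inv' f"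
  using group.inv_equality[OF group_perm_group[of X], of "inv' f" f]
  by (simp add: perm_group_simps permutes_inv permutes_inv_o)

lemma perm_group_pow: "f [^]\<^bsub>perm_group X\<^esub> (k::nat) = f ^^ k"
  by (induction k) (simp_all add: perm_group_simps nat_pow_def monoid.nat_pow_Suc fun_eq_iff funpow_swap1)

lemma Perm_apply: "f permutes X \<Longrightarrow> finite X \<Longrightarrow> apply (Perm f) = f"
  by (rule Perm_inverse) (use permutation permutation_permutes in blast)

lemma affected_Perm: "f permutes X \<Longrightarrow> finite X \<Longrightarrow> affected (Perm f) \<subseteq> X"
  using permutes_not_in by (fastforce simp: subset_iff in_affected Perm_apply)

lemma apply_eq_imp_eq: "apply f = apply g \<Longrightarrow> f = g" by (simp add: apply_inject)

text \<open>If \<open>g \<notin> S\<close> then the coset \<open>g S\<close> is the complement of \<open>S\<close>, and it does not contain \<open>g\<^sup>2\<close>.\<close>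

lemma index_two_contains_squares:
  assumes G: "group G" and fin: "finite (carrier G)" and S: "subgroup S G" "2 * card S = card (carrier G)"
    and g: "g \<in> carrier G"
  shows "g \<otimes>\<^bsub>G\<^esub> g \<in> S"
proof (cases "g \<in> S")
  case True
  then show ?thesis using subgroup.m_closed[OF S(1)] by blast
next
  case False
  interpret G: group G by (rule G)
  interpret S: subgroup S G by (rule S(1))
  define gS where "gS = (\<lambda>s. g \<otimes>\<^bsub>G\<^esub> s) ` S"
  have "inj_on (\<lambda>s. g \<otimes>\<^bsub>G\<^esub> s) S" using g by (auto simp: inj_on_def)
  then have "card gS = card S" by (simp add: gS_def card_image)
  moreover have "S \<inter> gS = {}"
  proof (rule ccontr)
    assume "S \<inter> gS \<noteq> {}"
    then obtain s where s: "s \<in> S" "g \<otimes>\<^bsub>G\<^esub> s \<in> S" by (auto simp: gS_def)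
    then have "g \<otimes>\<^bsub>G\<^esub> s \<otimes>\<^bsub>G\<^esub> inv\<^bsub>G\<^esub> s \<in> S" by blast
    then show False using g s False by (simp add: G.m_assoc)
  qed
  moreover have fS: "finite S" "finite gS" using finite_subset[OF S.subset fin] by (auto simp: gS_def)
  ultimately have "card (S \<union> gS) = card (carrier G)" using S(2) by (simp add: card_Un_disjoint)
  moreover have "S \<union> gS \<subseteq> carrier G" using S.subset g by (auto simp: gS_def)
  ultimately have "S \<union> gS = carrier G" using fin by (simp add: card_subset_eq)
  then have "g \<otimes>\<^bsub>G\<^esub> g \<in> S \<union> gS" using g by simp
  then show ?thesis
  proof
    assume "g \<otimes>\<^bsub>G\<^esub> g \<in> gS"
    then obtain s where "s \<in> S" "g \<otimes>\<^bsub>G\<^esub> g = g \<otimes>\<^bsub>G\<^esub> s" by (auto simp: gS_def)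
    then have "g = s" using g S.subset by auto
    then show ?thesis using False \<open>s \<in> S\<close> by simp
  qed
qed

text \<open>An isomorphic copy of \<open>A\<^sub>n\<close> has index two, hence contains every square; a 3-cycle is the square of a
  square.\<close>

lemma iso_alt_group_imp_alternating:
  assumes n: "n \<ge> 2" and S: "subgroup S (perm_group {1..n})" and iso: "perm_subgroup {1..n} S \<cong> alt_group n"
  shows "Perm ` S = alt_perms {1..n}"
proof -
  interpret S: subgroup S "perm_group {1..n}" by (rule S)
  have sub: "f permutes {1..n}" if "f \<in> S" for f using S.subset that by (auto simp: perm_group_simps)
  have cardS: "card S = card (carrier (alt_group n))" using iso_same_card[OF iso] by simp
  have c2: "2 * card S = card (carrier (perm_group {1..n}))"
    using alt_group_card_carrier[OF n] cardS card_permutations[of "{1..n}" n] by (simp add: perm_group_simps)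
  have finc: "finite (carrier (perm_group {1..n}))" by (simp add: perm_group_simps finite_permutations)
  define N where "N = {g :: nat perm. apply g \<in> S}"
  have sq: "g * g \<in> N" if "affected g \<subseteq> {1..n}" for g
    using index_two_contains_squares[OF group_perm_group finc S c2, of "apply g"] apply_permutes[OF that]
    by (simp add: N_def perm_group_simps apply_times)
  have "subgrp N"
    using S.m_closed S.one_closed S.m_inv_closed perm_group_inv[OF sub]
    by (auto simp: subgrp_def N_def perm_group_simps apply_times apply_inverse)
  moreover have "three_cycle e f g \<in> N" if d: "distinct [e, f, g]" and X: "{e, f, g} \<subseteq> {1..n}" for e f g
  proof -
    define s where "s = three_cycle e f g"
    have "affected s \<subseteq> {1..n}" using three_cycle_in_alt_perms[OF d X] by (simp add: s_def alt_perms_def)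
    then have "affected (s * s) \<subseteq> {1..n}" using affected_times[of s s] by blast
    then have "(s * s) * (s * s) \<in> N" by (rule sq)
    moreover have "(s * s) * (s * s) = s"
      unfolding s_def using d by (intro perm_eqI) (auto simp: apply_times apply_three_cycle)
    ultimately show ?thesis by (simp add: s_def)
  qed
  ultimately have "alt_perms {1..n} \<subseteq> N" by (rule three_cycle_generation)
  moreover have PN: "Perm ` S = N"
  proof (intro equalityI subsetI)
    fix g assume "g \<in> N"
    then have g: "apply g \<in> S" by (simp add: N_def)
    then have "g = Perm (apply g)" using Perm_apply[OF sub[OF g]] by (intro apply_eq_imp_eq) simp
    then show "g \<in> Perm ` S" using g by blast
  next
    fix g assume "g \<in> Perm ` S"
    then show "g \<in> N" using Perm_apply[OF sub] by (auto simp: N_def)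
  qed
  moreover have "card (Perm ` S) = card (alt_perms {1..n})"
  proof -
    have "inj_on Perm S" using Perm_apply[OF sub] by (intro inj_onI) (metis finite_atLeastAtMost)
    then show ?thesis using card_alt_perms[OF n] c2 card_permutations[of "{1..n}" n]
      by (simp add: card_image perm_group_simps)
  qed
  moreover have "finite (Perm ` S)" using finite_subset[OF S.subset finc] by simp
  ultimately show ?thesis by (metis card_subset_eq)
qed

section \<open>The wreath product as a group of permutations of the copies\<close>

lemma copy_pt_range: "i \<in> {1..m} \<Longrightarrow> w \<in> {1..n} \<Longrightarrow> copy_pt n i w \<in> {1..m * n}"
proof -
  assume i: "i \<in> {1..m}" and w: "w \<in> {1..n}"
  have "(i - 1) * n + n = i * n" using i by (cases i) auto
  moreover have "i * n \<le> m * n" using i by simp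
  ultimately show ?thesis using w unfolding copy_pt_def atLeastAtMost_iff by linarith
qed

definition block_of :: "nat \<Rightarrow> nat \<Rightarrow> nat" where "block_of n u = (u - 1) div n + 1"
definition pos_of :: "nat \<Rightarrow> nat \<Rightarrow> nat" where "pos_of n u = (u - 1) mod n + 1"

lemma block_pos_copy_pt [simp]:
  assumes "i \<ge> 1" "w \<in> {1..n}"
  shows "block_of n (copy_pt n i w) = i" "pos_of n (copy_pt n i w) = w"
proof -
  obtain k where k: "i = Suc k" using assms(1) by (cases i) auto
  obtain v where v: "w = Suc v" "v < n" using assms(2) by (cases w) auto
  show "block_of n (copy_pt n i w) = i" "pos_of n (copy_pt n i w) = w"
    using v by (simp_all add: block_of_def pos_of_def copy_pt_def k)
qed

lemma copy_pt_eq_iff: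
  assumes "i \<ge> 1" "j \<ge> 1" "w \<in> {1..n}" "v \<in> {1..n}"
  shows "copy_pt n i w = copy_pt n j v \<longleftrightarrow> i = j \<and> w = v"
  using block_pos_copy_pt[OF assms(1,3)] block_pos_copy_pt[OF assms(2,4)] by metis

lemma copy_pt_cases:
  assumes "u \<in> {1..m * n}"
  obtains i w where "i \<in> {1..m}" "w \<in> {1..n}" "u = copy_pt n i w"
proof -
  have n: "n > 0" using assms by (cases n) auto
  have "u - 1 < m * n" using assms by auto
  then have "block_of n u \<in> {1..m}" by (simp add: block_of_def less_mult_imp_div_less Suc_leI)
  moreover have "pos_of n u \<in> {1..n}" using n by (simp add: pos_of_def Suc_leI)
  moreover have "u = copy_pt n (block_of n u) (pos_of n u)"
    using assms by (simp add: copy_pt_def block_of_def pos_of_def)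
  ultimately show ?thesis using that by blast
qed

definition realize :: "nat \<Rightarrow> nat \<Rightarrow> (nat, nat perm) wr \<Rightarrow> nat \<Rightarrow> nat" where
  "realize m n h u = (if u \<in> {1..m * n}
     then copy_pt n (fib h (pos_of n u) $ (block_of n u)) (top h $ (pos_of n u)) else u)"

lemma realize_copy_pt:
  "i \<in> {1..m} \<Longrightarrow> w \<in> {1..n} \<Longrightarrow> realize m n h (copy_pt n i w) = copy_pt n (fib h w $ i) (top h $ w)"
  using copy_pt_range[of i m w n] by (simp add: realize_def)

lemma realize_outside: "u \<notin> {1..m * n} \<Longrightarrow> realize m n h u = u"
  by (auto simp: realize_def)

lemma alt_wreath_top: "h \<in> alt_wreath m n \<Longrightarrow> w \<in> {1..n} \<Longrightarrow> top h $ w \<in> {1..n}"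
  by (rule apply_inside) (auto simp: alt_wreath_def alt_perms_def)

lemma alt_wreath_fib: "h \<in> alt_wreath m n \<Longrightarrow> w \<in> {1..n} \<Longrightarrow> i \<in> {1..m} \<Longrightarrow> fib h w $ i \<in> {1..m}"
  by (rule apply_inside) (auto simp: alt_wreath_def alt_perms_def)

lemma realize_mult:
  assumes h: "h \<in> alt_wreath m n"
  shows "realize m n (g * h) = realize m n g \<circ> realize m n h"
proof
  fix u
  show "realize m n (g * h) u = (realize m n g \<circ> realize m n h) u"
  proof (cases "u \<in> {1..m * n}")
    case True
    then obtain i w where iw: "i \<in> {1..m}" "w \<in> {1..n}" "u = copy_pt n i w" by (rule copy_pt_cases)
    then show ?thesis
      using alt_wreath_top[OF h iw(2)] alt_wreath_fib[OF h iw(2,1)]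
      by (simp add: realize_copy_pt apply_times del: atLeastAtMost_iff)
  qed (simp add: realize_outside del: atLeastAtMost_iff)
qed

lemma realize_1: "realize m n 1 = id"
proof
  fix u
  show "realize m n 1 u = id u"
  proof (cases "u \<in> {1..m * n}")
    case True
    then obtain i w where iw: "i \<in> {1..m}" "w \<in> {1..n}" "u = copy_pt n i w" by (rule copy_pt_cases)
    then show ?thesis by (simp add: realize_copy_pt del: atLeastAtMost_iff)
  qed (simp add: realize_outside del: atLeastAtMost_iff)
qed

lemma realize_permutes: "realize m n h permutes {1..m * n}" if h: "h \<in> alt_wreath m n"
proof -
  have h': "inverse h \<in> alt_wreath m n" using subgrpD(3)[OF subgrp_alt_wreath h] .
  have "realize m n h \<circ> realize m n (inverse h) = id" "realize m n (inverse h) \<circ> realize m n h = id"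
    using realize_mult[OF h, of "inverse h"] realize_mult[OF h', of h] by (simp_all add: realize_1)
  then have "bij (realize m n h)" by (metis o_bij)
  then show ?thesis using realize_outside by (auto simp: permutes_def bij_iff)
qed

lemma realize_inj:
  assumes g: "g \<in> alt_wreath m n" and h: "h \<in> alt_wreath m n" and m: "m \<ge> 1"
    and eq: "realize m n g = realize m n h"
  shows "g = h"
proof -
  have *: "fib g w $ i = fib h w $ i \<and> top g $ w = top h $ w" if iw: "i \<in> {1..m}" "w \<in> {1..n}" for i w
  proof -
    have "copy_pt n (fib g w $ i) (top g $ w) = copy_pt n (fib h w $ i) (top h $ w)"
      using fun_cong[OF eq, of "copy_pt n i w"] iw by (simp add: realize_copy_pt del: atLeastAtMost_iff)
    then show ?thesis
      using alt_wreath_top[OF g iw(2)] alt_wreath_fib[OF g iw(2,1)] alt_wreath_top[OF h iw(2)] alt_wreath_fib[OF h iw(2,1)]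
      by (subst (asm) copy_pt_eq_iff) auto
  qed
  show ?thesis
  proof (rule wr_eqI)
    have aff: "affected (top f) \<subseteq> {1..n}" if "f \<in> alt_wreath m n" for f
      using that by (simp add: alt_wreath_def alt_perms_def)
    show "top g = top h"
    proof (rule perm_eqI)
      fix w
      show "top g $ w = top h $ w"
      proof (cases "w \<in> {1..n}")
        case True
        then show ?thesis using *[of 1 w] m by simp
      next
        case False
        then show ?thesis using apply_outside[OF aff[OF g]] apply_outside[OF aff[OF h]] by metis
      qed
    qed
    fix w
    show "fib g w = fib h w"
    proof (cases "w \<in> {1..n}")
      case True
      have aff: "affected (fib f w) \<subseteq> {1..m}" if "f \<in> alt_wreath m n" for f
        using that True by (simp add: alt_wreath_def alt_perms_def del: atLeastAtMost_iff)
      show ?thesis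
      proof (rule perm_eqI)
        fix i
        show "fib g w $ i = fib h w $ i"
        proof (cases "i \<in> {1..m}")
          case i: True
          then show ?thesis using * True by blast
        next
          case False
          then show ?thesis using apply_outside[OF aff[OF g]] apply_outside[OF aff[OF h]] by metis
        qed
      qed
    next
      case False
      then show ?thesis using g h by (auto simp: alt_wreath_def)
    qed
  qed
qed

section \<open>Products of permutations of the copies\<close>

lemma perm_prod_Nil [simp]: "perm_prod [] = id" by (simp add: perm_prod_def)

lemma perm_prod_Cons [simp]: "perm_prod (f # fs) = perm_prod fs \<circ> f"
proof -
  have "fold (\<circ>) fs g = fold (\<circ>) fs id \<circ> g" for g :: "'b \<Rightarrow> 'a" and fs :: "('a \<Rightarrow> 'a) list"
    by (induction fs arbitrary: g rule: rev_induct) (simp_all add: comp_assoc)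
  then show ?thesis by (simp add: perm_prod_def)
qed

lemma perm_prod_append [simp]: "perm_prod (fs @ gs) = perm_prod gs \<circ> perm_prod fs"
  by (induction fs) (simp_all add: comp_assoc)

lemma perm_prod_fixes: "(\<And>f. f \<in> set fs \<Longrightarrow> f u = u) \<Longrightarrow> perm_prod fs u = u"
proof (induction fs)
  case (Cons f fs)
  have "f u = u" "perm_prod fs u = u" using Cons by simp_all
  then show ?case by simp
qed simp

lemma copy_perm_copy_pt:
  assumes "i \<ge> 1" "j \<ge> 1" "w \<in> {1..n}"
  shows "copy_perm n j f (copy_pt n i w) = (if i = j then copy_pt n i (f w) else copy_pt n i w)"
proof (cases "i = j")
  case True
  have "copy_pt n i w \<in> {(i - 1) * n + 1..i * n}"
    using assms by (cases i) (auto simp: copy_pt_def)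
  then show ?thesis using True by (simp add: copy_perm_def copy_pt_def)
next
  case False
  have "copy_pt n i w \<notin> {(j - 1) * n + 1..j * n}"
  proof
    assume u: "copy_pt n i w \<in> {(j - 1) * n + 1..j * n}"
    define v where "v = copy_pt n i w - (j - 1) * n"
    have "j * n = (j - 1) * n + n" using assms(2) by (cases j) auto
    then have "v \<in> {1..n}" using u by (auto simp: v_def)
    moreover have "copy_pt n i w = copy_pt n j v" using u by (simp add: v_def copy_pt_def)
    ultimately show False using copy_pt_eq_iff[of i j w n v] assms False by blast
  qed
  then show ?thesis using False by (simp only: copy_perm_def if_False)
qed

lemma all_copies_copy_pt:
  assumes f: "f permutes {1..n}" and iw: "i \<in> {1..m}" "w \<in> {1..n}"
  shows "perm_prod (all_copies m n f) (copy_pt n i w) = copy_pt n i (f w)"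
proof -
  have "perm_prod (map (\<lambda>i. copy_perm n i f) js) (copy_pt n i w)
      = (if i \<in> set js then copy_pt n i (f w) else copy_pt n i w)"
    if "distinct js" "\<forall>j\<in>set js. j \<ge> 1" "w \<in> {1..n}" for js w
    using that
  proof (induction js arbitrary: w)
    case (Cons j js)
    have "f w \<in> {1..n}" using permutes_in_image[OF f] Cons.prems(3) by blast
    moreover have "copy_perm n j f (copy_pt n i w) = (if i = j then copy_pt n i (f w) else copy_pt n i w)"
      by (rule copy_perm_copy_pt) (use iw(1) Cons.prems in auto)
    ultimately show ?case using Cons.IH[of w] Cons.IH[of "f w"] Cons.prems by auto
  qed simp
  from this[of "[1..<Suc m]" w] show ?thesis using iw by (auto simp: all_copies_def)
qed

lemma all_copies_outside:
  assumes "u \<notin> {1..m * n}"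
  shows "perm_prod (all_copies m n f) u = u"
proof (rule perm_prod_fixes)
  fix g assume "g \<in> set (all_copies m n f)"
  then obtain j where j: "j \<in> {1..m}" "g = copy_perm n j f" by (fastforce simp: all_copies_def simp del: upt_Suc)
  have "j * n \<le> m * n" using j by simp
  then have "{(j - 1) * n + 1..j * n} \<subseteq> {1..m * n}" by auto
  then have "u \<notin> {(j - 1) * n + 1..j * n}" using assms by blast
  then show "g u = u" by (simp only: j(2) copy_perm_def if_False)
qed

lemma cycle_of_list_in: "i \<in> set c \<Longrightarrow> cycle_of_list c i \<in> set c"
  by (simp only: permutes_in_image[OF cycle_permutes])

lemma cycle_of_list_nth:
  assumes "distinct c" "j < length c"
  shows "cycle_of_list c (c ! j) = c ! (Suc j mod length c)"
proof -
  have "map (cycle_of_list c) c ! j = rotate1 c ! j"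
    using cyclic_rotation[OF assms(1), of 1] by simp
  then show ?thesis using assms(2) by (simp add: nth_rotate1)
qed

lemma cycle_of_list_rev:
  assumes "distinct c"
  shows "cycle_of_list (rev c) (cycle_of_list c i) = i"
proof (cases "i \<in> set c")
  case True
  then obtain j where j: "j < length c" "i = c ! j" by (auto simp: in_set_conv_nth)
  define l where "l = length c"
  have i: "cycle_of_list c i = c ! (Suc j mod l)" using cycle_of_list_nth[OF assms j(1)] j(2) by (simp add: l_def)
  have rv: "cycle_of_list (rev c) (rev c ! k) = rev c ! (Suc k mod l)" if "k < l" for k
    using cycle_of_list_nth[of "rev c" k] assms that by (simp add: l_def)
  show ?thesis
  proof (cases "Suc j = l")
    case True
    have "cycle_of_list c i = rev c ! j" using i True j(1) by (simp add: rev_nth l_def)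
    moreover have "rev c ! 0 = c ! j"
    proof -
      have "0 < length c" "length c - Suc 0 = j" using True unfolding l_def by linarith+
      then show ?thesis using rev_nth[of 0 c] by simp
    qed
    ultimately show ?thesis using rv[of j] True j by (simp add: l_def)
  next
    case False
    then have jl: "Suc j < l" using j(1) by (simp add: l_def)
    define k where "k = l - Suc (Suc j)"
    have k: "k < l" "Suc k < l" using jl by (auto simp: k_def)
    have "cycle_of_list c i = rev c ! k" using i jl k by (simp add: rev_nth l_def k_def)
    then show ?thesis using rv[of k] k jl j(2) by (simp add: rev_nth l_def k_def Suc_diff_Suc)
  qed
next
  case False
  then show ?thesis by (simp add: id_outside_supp)
qed

lemma cycle_of_list_map:
  assumes "inj_on f (insert i (set c))"
  shows "cycle_of_list (map f c) (f i) = f (cycle_of_list c i)"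
  using assms
proof (induction c rule: cycle_of_list.induct)
  case (1 k j cs)
  have "inj_on f (insert i (set (j # cs)))" by (rule inj_on_subset[OF 1(2)]) auto
  then have IH: "cycle_of_list (map f (j # cs)) (f i) = f (cycle_of_list (j # cs) i)" by (rule 1(1))
  define v where "v = cycle_of_list (j # cs) i"
  have v: "v \<in> insert i (set (k # j # cs))"
  proof (cases "i \<in> set (j # cs)")
    case True then show ?thesis using cycle_of_list_in[OF True] by (auto simp: v_def)
  next
    case False then show ?thesis using id_outside_supp[OF False] by (simp add: v_def)
  qed
  have "cycle_of_list (map f (k # j # cs)) (f i) = transpose (f k) (f j) (f v)"
    using IH by (simp add: v_def)
  also have "\<dots> = f (transpose k j v)"
    using inj_onD[OF 1(2), of v k] inj_onD[OF 1(2), of v j] v by (auto simp: transpose_def)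
  finally show ?case by (simp add: v_def)
qed auto

lemma disjoint_cycles_fixes:
  assumes "i \<notin> \<Union> (set ` set cs)" "\<And>c. set (f c) = set c"
  shows "perm_prod (map (\<lambda>c. cycle_of_list (f c)) cs) i = i"
  using assms by (intro perm_prod_fixes) (auto intro: id_outside_supp)

lemma disjoint_cycles_apply:
  assumes "distinct (concat cs)" "c \<in> set cs" "i \<in> set c" and f: "\<And>c. set (f c) = set c"
  shows "perm_prod (map (\<lambda>c. cycle_of_list (f c)) cs) i = cycle_of_list (f c) i"
  using assms(1-3)
proof (induction cs)
  case (Cons c0 cs)
  show ?case
  proof (cases "i \<in> set c0")
    case True
    have "c = c0" using Cons.prems True by auto
    moreover have "cycle_of_list (f c0) i \<in> set c0" using cycle_of_list_in[of i "f c0"] True f by simp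
    then have "cycle_of_list (f c0) i \<notin> \<Union> (set ` set cs)" using Cons.prems(1) by auto
    ultimately show ?thesis using disjoint_cycles_fixes[OF _ f] by simp
  next
    case False
    then have "c \<in> set cs" using Cons.prems by auto
    moreover have "cycle_of_list (f c0) i = i" using id_outside_supp[of i "f c0"] False f by simp
    ultimately show ?thesis using Cons by simp
  qed
qed simp

lemma disjoint_p_cycles_permutes:
  assumes "disjoint_p_cycles p X cs \<alpha>"
  shows "\<alpha> permutes X"
proof -
  have "perm_prod (map cycle_of_list cs) permutes X" if "\<forall>c\<in>set cs. set c \<subseteq> X" for cs
    using that
  proof (induction cs)
    case (Cons c cs)
    have "cycle_of_list c permutes X"
      by (rule permutes_subset[OF cycle_permutes]) (use Cons.prems in simp)
    moreover have "perm_prod (map cycle_of_list cs) permutes X" using Cons by simp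
    ultimately show ?case unfolding list.map perm_prod_Cons by (rule permutes_compose)
  qed (simp add: permutes_id)
  then show ?thesis using assms by (simp add: disjoint_p_cycles_def)
qed

lemma disjoint_p_cycles_power:
  assumes "disjoint_p_cycles p X cs \<alpha>"
  shows "\<alpha> ^^ p = id"
proof
  fix i
  have \<alpha>: "\<alpha> = perm_prod (map (\<lambda>c. cycle_of_list (id c)) cs)" and d: "distinct (concat cs)"
    using assms by (simp_all add: disjoint_p_cycles_def)
  show "(\<alpha> ^^ p) i = id i"
  proof (cases "i \<in> \<Union> (set ` set cs)")
    case True
    then obtain c where c: "c \<in> set cs" "i \<in> set c" by blast
    have dc: "distinct c" "length c = p" using assms c(1) by (auto simp: disjoint_p_cycles_def distinct_concat_iff)
    have "(\<alpha> ^^ k) i = (cycle_of_list c ^^ k) i \<and> (\<alpha> ^^ k) i \<in> set c" for k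
    proof (induction k)
      case (Suc k)
      then show ?case using disjoint_cycles_apply[OF d c(1), of "(\<alpha> ^^ k) i" id, folded \<alpha>] cycle_of_list_in by auto
    qed (use c in auto)
    then show ?thesis using cycle_is_id_root[OF dc(1)] dc(2) by metis
  next
    case False
    have "\<alpha> i = i" unfolding \<alpha> by (rule disjoint_cycles_fixes[OF False]) simp
    then have "(\<alpha> ^^ k) i = i" for k by (induction k) auto
    then show ?thesis by simp
  qed
qed

text \<open>Inverting the cycles one by one inverts \<open>\<alpha>\<close>, without reversing their order, as they are disjoint.
  This is the change of copy at the second point of a handle.\<close>

lemma disjoint_p_cycles_inverse:
  assumes "disjoint_p_cycles p X cs \<alpha>"
  shows "perm_prod (map (\<lambda>c. cycle_of_list (rev c)) cs) = inv' \<alpha>"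
proof -
  have \<alpha>: "\<alpha> = perm_prod (map (\<lambda>c. cycle_of_list (id c)) cs)" and d: "distinct (concat cs)"
    using assms by (simp_all add: disjoint_p_cycles_def)
  define \<beta> where "\<beta> = perm_prod (map (\<lambda>c. cycle_of_list (rev c)) cs)"
  have "\<beta> (\<alpha> i) = i" for i
  proof (cases "i \<in> \<Union> (set ` set cs)")
    case True
    then obtain c where c: "c \<in> set cs" "i \<in> set c" by blast
    have dc: "distinct c" using assms c(1) by (auto simp: disjoint_p_cycles_def distinct_concat_iff)
    have "\<alpha> i = cycle_of_list c i" unfolding \<alpha> using disjoint_cycles_apply[OF d c, of id] by simp
    moreover have "\<beta> (cycle_of_list c i) = cycle_of_list (rev c) (cycle_of_list c i)"
      unfolding \<beta>_def using disjoint_cycles_apply[OF d c(1) cycle_of_list_in[OF c(2)], of rev] by simp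
    ultimately show ?thesis using cycle_of_list_rev[OF dc] by simp
  next
    case False
    have "\<alpha> i = i" unfolding \<alpha> by (rule disjoint_cycles_fixes[OF False]) simp
    moreover have "\<beta> i = i" unfolding \<beta>_def by (rule disjoint_cycles_fixes[OF False]) simp
    ultimately show ?thesis by simp
  qed
  then have "\<beta> \<circ> \<alpha> = id" by (simp add: fun_eq_iff)
  moreover have "bij \<alpha>" using disjoint_p_cycles_permutes[OF assms] permutes_bij by blast
  ultimately show ?thesis unfolding \<beta>_def by (metis bij_is_surj comp_assoc comp_id id_comp surj_iff)
qed

lemma handle_join_apply:
  assumes c: "set c \<subseteq> {1..m}" and ab: "a \<in> {1..n}" "b \<in> {1..n}" "a \<noteq> b" and i: "i \<in> {1..m}" and w: "w \<in> {1..n}"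
  shows "handle_join n a b c (copy_pt n i w)
     = copy_pt n (if w = a then cycle_of_list c i else if w = b then cycle_of_list (rev c) i else i) w"
proof -
  have inj: "inj_on (\<lambda>i. copy_pt n i v) {1..m}" if "v \<in> {1..n}" for v
    using copy_pt_eq_iff that by (auto intro!: inj_onI simp del: atLeastAtMost_iff) (meson atLeastAtMost_iff)
  have at: "cycle_of_list (map (\<lambda>i. copy_pt n i v) e) (copy_pt n i v) = copy_pt n (cycle_of_list e i) v"
    if "v \<in> {1..n}" "set e \<subseteq> {1..m}" "i \<in> {1..m}" for v e i
    by (rule cycle_of_list_map[OF inj_on_subset[OF inj[OF that(1)]]]) (use that in blast)
  have off: "cycle_of_list (map (\<lambda>i. copy_pt n i v) e) (copy_pt n i v') = copy_pt n i v'"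
    if "v \<in> {1..n}" "v' \<in> {1..n}" "v \<noteq> v'" "set e \<subseteq> {1..m}" "i \<in> {1..m}" for v v' e i
  proof (rule id_outside_supp)
    have "copy_pt n i v' \<noteq> copy_pt n j v" if "j \<in> set e" for j
      using copy_pt_eq_iff[of i j v' n v] that \<open>i \<in> {1..m}\<close> \<open>set e \<subseteq> {1..m}\<close> \<open>v \<noteq> v'\<close> \<open>v \<in> {1..n}\<close> \<open>v' \<in> {1..n}\<close> by auto
    then show "copy_pt n i v' \<notin> set (map (\<lambda>i. copy_pt n i v) e)" by auto
  qed
  have ci: "cycle_of_list c i \<in> {1..m}"
    using i by (simp only: permutes_in_image[OF permutes_subset[OF cycle_permutes c]])
  have rc: "set (rev c) \<subseteq> {1..m}" using c by simp
  note unf = handle_join_def rev_map perm_prod_Cons perm_prod_Nil o_apply id_apply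
  consider "w = a" | "w = b" "w \<noteq> a" | "w \<noteq> a" "w \<noteq> b" by blast
  then show ?thesis
  proof cases
    case 1
    then show ?thesis unfolding unf using at[OF ab(1) c i] off[OF ab(2,1) _ rc ci] ab(3) by simp
  next
    case 2
    then show ?thesis unfolding unf using off[OF ab(1,2) _ c i] at[OF ab(2) rc i] ab(3) by simp
  next
    case 3
    then show ?thesis unfolding unf using off[OF ab(1) w _ c i] off[OF ab(2) w _ rc i] by simp
  qed
qed

lemma handle_join_outside:
  assumes "set c \<subseteq> {1..m}" "a \<in> {1..n}" "b \<in> {1..n}" "u \<notin> {1..m * n}"
  shows "handle_join n a b c u = u"
proof -
  have "u \<noteq> copy_pt n i v" if "i \<in> set c" "v \<in> {1..n}" for i v
    using copy_pt_range[of i m v n] that assms(1,4) by auto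
  then have "u \<notin> set (map (\<lambda>i. copy_pt n i a) c)" "u \<notin> set (rev (map (\<lambda>i. copy_pt n i b) c))"
    using assms(2,3) unfolding set_rev set_map by blast+
  then have "cycle_of_list (map (\<lambda>i. copy_pt n i a) c) u = u"
    "cycle_of_list (rev (map (\<lambda>i. copy_pt n i b) c)) u = u"
    by (blast intro: id_outside_supp)+
  then show ?thesis by (simp add: handle_join_def)
qed

lemma handle_joins_apply:
  assumes \<alpha>: "disjoint_p_cycles p {1..m} cs \<alpha>" and ab: "a \<in> {1..n}" "b \<in> {1..n}" "a \<noteq> b"
    and i: "i \<in> {1..m}" and w: "w \<in> {1..n}"
  shows "perm_prod (map (handle_join n a b) cs) (copy_pt n i w)
     = copy_pt n (if w = a then \<alpha> i else if w = b then inv' \<alpha> i else i) w"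
proof -
  have "perm_prod (map (handle_join n a b) cs) (copy_pt n i w)
     = copy_pt n (if w = a then perm_prod (map cycle_of_list cs) i
         else if w = b then perm_prod (map (\<lambda>c. cycle_of_list (rev c)) cs) i else i) w"
    if "\<forall>c\<in>set cs. set c \<subseteq> {1..m}" "i \<in> {1..m}" for cs i
    using that
  proof (induction cs arbitrary: i)
    case (Cons c cs)
    have in_m: "cycle_of_list e i \<in> {1..m}" if "set e \<subseteq> {1..m}" for e
      using Cons.prems(2) by (simp only: permutes_in_image[OF permutes_subset[OF cycle_permutes that]])
    show ?case
      using handle_join_apply[OF _ ab Cons.prems(2) w, of c] Cons in_m[of c] in_m[of "rev c"]
      by (simp del: atLeastAtMost_iff)
  qed simp
  moreover have "\<forall>c\<in>set cs. set c \<subseteq> {1..m}" "\<alpha> = perm_prod (map cycle_of_list cs)"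
    using \<alpha> by (auto simp: disjoint_p_cycles_def)
  ultimately show ?thesis using i disjoint_p_cycles_inverse[OF \<alpha>] by simp
qed

declare One_nat_def [simp del]

lemma handle_joins_outside:
  assumes \<alpha>: "disjoint_p_cycles p {1..m} cs \<alpha>" and ab: "a \<in> {1..n}" "b \<in> {1..n}" and u: "u \<notin> {1..m * n}"
  shows "perm_prod (map (handle_join n a b) cs) u = u"
proof (rule perm_prod_fixes)
  fix f assume "f \<in> set (map (handle_join n a b) cs)"
  then obtain c where c: "c \<in> set cs" "f = handle_join n a b c" by auto
  then have "set c \<subseteq> {1..m}" using \<alpha> by (simp add: disjoint_p_cycles_def)
  then show "f u = u" unfolding c(2) using ab u by (rule handle_join_outside)
qed

lemma realize_handles:
  assumes f: "f permutes {1..n}" and \<alpha>: "disjoint_p_cycles p {1..m} \<alpha>s \<alpha>" and \<beta>: "disjoint_p_cycles p {1..m} \<beta>s \<beta>"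
    and dist: "distinct [a, b, c, d]" and pts: "{a, b, c, d} \<subseteq> {1..n}"
    and fixed: "\<And>e. e \<in> {a, b, c, d} \<Longrightarrow> f e = e"
  shows "perm_prod (all_copies m n f @ map (handle_join n a b) \<alpha>s @ map (handle_join n c d) \<beta>s)
    = realize m n (Wr (handle_label a b c d (Perm \<alpha>) (Perm \<beta>)) (Perm f))" (is "?L = ?R")
proof
  fix u
  have ap: "apply (Perm \<alpha>) = \<alpha>" "apply (Perm \<beta>) = \<beta>" "apply (Perm f) = f"
    using disjoint_p_cycles_permutes[OF \<alpha>] disjoint_p_cycles_permutes[OF \<beta>] f by (simp_all add: Perm_apply)
  have in\<Omega>: "a \<in> {1..n}" "b \<in> {1..n}" "c \<in> {1..n}" "d \<in> {1..n}" using pts by auto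
  have ne: "a \<noteq> b" "c \<noteq> d" using dist by auto
  show "?L u = ?R u"
  proof (cases "u \<in> {1..m * n}")
    case False
    then show ?thesis
      using all_copies_outside[OF False, of f] handle_joins_outside[OF \<alpha> in\<Omega>(1,2) False]
        handle_joins_outside[OF \<beta> in\<Omega>(3,4) False] realize_outside[OF False]
      by (simp del: atLeastAtMost_iff)
  next
    case True
    then obtain i w where iw: "i \<in> {1..m}" "w \<in> {1..n}" "u = copy_pt n i w" by (rule copy_pt_cases)
    have fw: "f w \<in> {1..n}" using iw(2) by (simp only: permutes_in_image[OF f])
    have fe: "f w = e \<longleftrightarrow> w = e" if "e \<in> {a, b, c, d}" for e
      using fixed[OF that] permutes_inj[OF f] by (metis injD)
    define j where "j = (if w = a then \<alpha> i else if w = b then inv' \<alpha> i else i)"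
    have j: "j \<in> {1..m}"
      using iw(1) permutes_in_image[OF disjoint_p_cycles_permutes[OF \<alpha>]]
        permutes_in_image[OF permutes_inv[OF disjoint_p_cycles_permutes[OF \<alpha>]]] unfolding j_def by presburger
    have "?L u = perm_prod (map (handle_join n c d) \<beta>s) (perm_prod (map (handle_join n a b) \<alpha>s) (copy_pt n i (f w)))"
      using all_copies_copy_pt[OF f iw(1,2)] by (simp add: iw(3))
    also have "perm_prod (map (handle_join n a b) \<alpha>s) (copy_pt n i (f w)) = copy_pt n j (f w)"
      using handle_joins_apply[OF \<alpha> in\<Omega>(1,2) ne(1) iw(1) fw] fe[of a] fe[of b] by (simp only: j_def insert_iff simp_thms)
    also have "perm_prod (map (handle_join n c d) \<beta>s) (copy_pt n j (f w))
        = copy_pt n (if w = c then \<beta> j else if w = d then inv' \<beta> j else j) (f w)"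
      using handle_joins_apply[OF \<beta> in\<Omega>(3,4) ne(2) j fw] fe[of c] fe[of d] by (simp only: insert_iff simp_thms)
    also have "\<dots> = copy_pt n (handle_label a b c d (Perm \<alpha>) (Perm \<beta>) w $ i) (f w)"
      using dist by (auto simp: j_def handle_label_def apply_inverse ap)
    also have "\<dots> = ?R u"
      using realize_copy_pt[OF iw(1,2)] by (simp add: iw(3) ap)
    finally show ?thesis .
  qed
qed

lemma realize_copies:
  assumes f: "f permutes {1..n}"
  shows "perm_prod (all_copies m n f) = realize m n (Wr (\<lambda>_. 1) (Perm f))" (is "?L = ?R")
proof
  fix u
  show "?L u = ?R u"
  proof (cases "u \<in> {1..m * n}")
    case False
    then show ?thesis using all_copies_outside[OF False, of f] realize_outside[OF False] by metis
  next
    case True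
    then obtain i w where iw: "i \<in> {1..m}" "w \<in> {1..n}" "u = copy_pt n i w" by (rule copy_pt_cases)
    then show ?thesis
      using all_copies_copy_pt[OF f iw(1,2)] realize_copy_pt[OF iw(1,2)] by (simp add: Perm_apply[OF f])
  qed
qed

section \<open>Joining the copies\<close>

lemma (in group) eval_word_relators:
  assumes "\<And>s. \<gamma> s \<in> carrier G"
  shows "eval_word G \<gamma> (replicate k (s, True)) = \<gamma> s [^] k"
    "eval_word G \<gamma> (concat (replicate k [(s, True), (s', True)])) = (\<gamma> s \<otimes> \<gamma> s') [^] k"
proof -
  show "eval_word G \<gamma> (replicate k (s, True)) = \<gamma> s [^] k"
  proof (induction k)
    case (Suc k)
    then show ?case using nat_pow_Suc2[of "\<gamma> s" k] assms by simp
  qed simp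
  show "eval_word G \<gamma> (concat (replicate k [(s, True), (s', True)])) = (\<gamma> s \<otimes> \<gamma> s') [^] k"
  proof (induction k)
    case (Suc k)
    then show ?case using nat_pow_Suc2[of "\<gamma> s \<otimes> \<gamma> s'" k] assms by (simp add: m_assoc)
  qed simp
qed

lemma eval_word_perm_group:
  assumes X: "finite X" and M: "subgrp M" and \<gamma>: "\<And>s. \<gamma> s permutes X" "\<And>s. Perm (\<gamma> s) \<in> M"
  shows "eval_word (perm_group X) \<gamma> w permutes X \<and> Perm (eval_word (perm_group X) \<gamma> w) \<in> M"
proof (induction w)
  case Nil
  have "Perm id = (1 :: 'a perm)" by (rule apply_eq_imp_eq) (simp add: Perm_apply[OF permutes_id X])
  then show ?case using subgrpD(1)[OF M] by (simp only: eval_word.simps perm_group_simps permutes_id simp_thms)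
next
  case (Cons l w)
  obtain s e where l: "l = (s, e)" by force
  define g where "g = (if e then \<gamma> s else inv\<^bsub>perm_group X\<^esub> \<gamma> s)"
  have "g permutes X \<and> Perm g \<in> M"
  proof (cases e)
    case False
    have "Perm (inv' (\<gamma> s)) = inverse (Perm (\<gamma> s))"
      by (rule apply_eq_imp_eq)
        (simp only: apply_inverse Perm_apply[OF \<gamma>(1) X] Perm_apply[OF permutes_inv[OF \<gamma>(1)] X])
    then show ?thesis
      using False \<gamma> subgrpD(3)[OF M] by (simp add: g_def perm_group_inv permutes_inv)
  qed (simp add: g_def \<gamma>)
  moreover define v where "v = eval_word (perm_group X) \<gamma> w"
  moreover have "Perm (v \<circ> g) = Perm v * Perm g" if "v permutes X" "g permutes X"
    by (rule apply_eq_imp_eq)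
      (simp only: apply_times Perm_apply[OF that(1) X] Perm_apply[OF that(2) X] Perm_apply[OF permutes_compose[OF that(2,1)] X])
  ultimately have "v \<circ> g permutes X \<and> Perm (v \<circ> g) \<in> M"
    using Cons subgrpD(2)[OF M] by (simp only: permutes_compose simp_thms)
  then show ?case by (simp only: l eval_word.simps perm_group_simps(2) g_def v_def)
qed

text \<open>Permutations multiply in opposite order in \<open>perm_group\<close> and in \<open>alt_wreath_alt\<close>, so the isomorphism
  inverts all components. The fibre at which an element starts is the one at which its inverse
  arrives, and \<open>alt_wreath_alt\<close> indexes the coordinates by the latter.\<close>

lemma alt_wreath_iso:
  assumes m: "m \<ge> 1"
  shows "perm_subgroup {1..m * n} (realize m n ` alt_wreath m n) \<cong> alt_wreath_alt m n"
proof -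
  define W where "W = alt_wreath m n"
  define \<theta> where "\<theta> h = (\<lambda>i\<in>{1..n}. apply (inverse (fib h i)), apply (inverse (top h)))" for h :: "(nat, nat perm) wr"
  define unreal where "unreal = inv_into W (realize m n)"
  have inj: "inj_on (realize m n) W" using realize_inj[OF _ _ m] by (auto simp: inj_on_def W_def)
  then have unreal: "unreal (realize m n h) = h" if "h \<in> W" for h using that by (simp add: unreal_def)
  have W_mult: "g * h \<in> W" if "g \<in> W" "h \<in> W" for g h using that subgrpD(2)[OF subgrp_alt_wreath] by (simp add: W_def)
  have alt_apply: "g \<in> alt_perms {1..k} \<longleftrightarrow> apply g \<in> carrier (alt_group k)" for g k
  proof
    assume "apply g \<in> carrier (alt_group k)"
    then have g: "apply g permutes {1..k}" "evenperm (apply g)" by (simp_all add: alt_group_carrier)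
    have "affected g \<subseteq> {1..k}" using permutes_not_in[OF g(1)] unfolding subset_iff in_affected by blast
    then show "g \<in> alt_perms {1..k}" using g by (simp add: alt_perms_def)
  qed (simp add: alt_perms_def alt_group_carrier apply_permutes)
  have car: "\<theta> h \<in> carrier (alt_wreath_alt m n)" if "h \<in> W" for h
  proof -
    have "apply (inverse (fib h i)) \<in> carrier (alt_group m)" if "i \<in> {1..n}" for i
      using \<open>h \<in> W\<close> that alt_perms_closed(3) unfolding W_def alt_wreath_def alt_apply[symmetric] by blast
    moreover have "apply (inverse (top h)) \<in> carrier (alt_group n)"
      using that alt_perms_closed(3) unfolding W_def alt_wreath_def alt_apply[symmetric] by blast
    ultimately show ?thesis by (simp add: \<theta>_def alt_wreath_alt_def semidirect_product_def)
  qed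
  have mult: "\<theta> (h' * h) = \<theta> h \<otimes>\<^bsub>alt_wreath_alt m n\<^esub> \<theta> h'" if h: "h \<in> W" for h h'
  proof -
    have "inv' (apply (inverse (top h))) = apply (top h)" by (simp add: apply_inverse inv_inv_eq)
    then show ?thesis
      using alt_wreath_top[OF h[unfolded W_def]]
      by (auto simp: \<theta>_def alt_wreath_alt_def semidirect_product_def alt_group_mult apply_times restrict_def fun_eq_iff)
  qed
  have bij: "bij_betw \<theta> W (carrier (alt_wreath_alt m n))"
  proof (rule bij_betwI')
    show "\<theta> h = \<theta> h' \<longleftrightarrow> h = h'" if hh: "h \<in> W" "h' \<in> W" for h h'
    proof
      assume eq: "\<theta> h = \<theta> h'"
      show "h = h'"
      proof (rule wr_eqI)
        have "apply (inverse (top h)) = apply (inverse (top h'))" using eq by (simp add: \<theta>_def)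
        then show "top h = top h'" using apply_eq_imp_eq inverse_eq_swap mg.inverse_inverse by metis
        fix i
        show "fib h i = fib h' i"
        proof (cases "i \<in> {1..n}")
          case True
          have "fst (\<theta> h) i = fst (\<theta> h') i" using eq by simp
          then have "apply (inverse (fib h i)) = apply (inverse (fib h' i))" using True by (simp add: \<theta>_def)
          then show ?thesis using apply_eq_imp_eq mg.inverse_inverse by metis
        next
          case False
          then show ?thesis using hh by (simp add: W_def alt_wreath_def)
        qed
      qed
    qed simp
    show "\<theta> h \<in> carrier (alt_wreath_alt m n)" if "h \<in> W" for h using car that .
    fix FS assume FS: "FS \<in> carrier (alt_wreath_alt m n)"
    obtain F S where fs: "FS = (F, S)" by force
    have F: "F \<in> (\<Pi>\<^sub>E i\<in>{1..n}. carrier (alt_group m))" and S: "S \<in> carrier (alt_group n)"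
      using FS by (simp_all add: fs alt_wreath_alt_def semidirect_product_def)
    have ap: "apply (Perm f) = f" if "f \<in> carrier (alt_group k)" for f k
      using that Perm_apply[of f "{1..k}"] by (simp add: alt_group_carrier)
    define h where "h = Wr (\<lambda>i. if i \<in> {1..n} then inverse (Perm (F i)) else 1) (inverse (Perm S))"
    have Fi: "F i \<in> carrier (alt_group m)" if "i \<in> {1..n}" for i using F that by (rule PiE_mem)
    have "inverse (Perm S) \<in> alt_perms {1..n}" using S ap[OF S] by (intro alt_perms_closed(3)) (simp add: alt_apply)
    moreover have "inverse (Perm (F i)) \<in> alt_perms {1..m}" if "i \<in> {1..n}" for i
      using Fi[OF that] ap[OF Fi[OF that]] by (intro alt_perms_closed(3)) (simp add: alt_apply)
    ultimately have "h \<in> W" by (simp add: h_def W_def alt_wreath_def del: atLeastAtMost_iff)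
    moreover have "\<theta> h = FS"
    proof -
      have "(\<lambda>i\<in>{1..n}. apply (inverse (fib h i))) = F"
      proof
        fix i
        show "(\<lambda>i\<in>{1..n}. apply (inverse (fib h i))) i = F i"
        proof (cases "i \<in> {1..n}")
          case True
          then show ?thesis by (simp add: h_def ap[OF Fi[OF True]] del: atLeastAtMost_iff)
        next
          case False
          then show ?thesis using PiE_arb[OF F False] by (simp only: restrict_apply if_False)
        qed
      qed
      then show ?thesis by (simp add: \<theta>_def fs h_def ap[OF S])
    qed
    ultimately show "\<exists>h\<in>W. FS = \<theta> h" by blast
  qed
  have "(\<theta> \<circ> unreal) \<in> iso (perm_subgroup {1..m * n} (realize m n ` W)) (alt_wreath_alt m n)"
  proof (rule isoI)
    show "\<theta> \<circ> unreal \<in> hom (perm_subgroup {1..m * n} (realize m n ` W)) (alt_wreath_alt m n)"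
    proof (rule homI)
      show "(\<theta> \<circ> unreal) f \<in> carrier (alt_wreath_alt m n)" if "f \<in> carrier (perm_subgroup {1..m * n} (realize m n ` W))" for f
        using that unreal car by auto
      fix f f' assume "f \<in> carrier (perm_subgroup {1..m * n} (realize m n ` W))"
        "f' \<in> carrier (perm_subgroup {1..m * n} (realize m n ` W))"
      then obtain h h' where h: "h \<in> W" "h' \<in> W" "f = realize m n h" "f' = realize m n h'" by auto
      have "f \<otimes>\<^bsub>perm_subgroup {1..m * n} (realize m n ` W)\<^esub> f' = realize m n (h' * h)"
        using realize_mult h by (simp add: W_def perm_group_def)
      then show "(\<theta> \<circ> unreal) (f \<otimes>\<^bsub>perm_subgroup {1..m * n} (realize m n ` W)\<^esub> f')
         = (\<theta> \<circ> unreal) f \<otimes>\<^bsub>alt_wreath_alt m n\<^esub> (\<theta> \<circ> unreal) f'"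
        using h unreal W_mult mult by simp
    qed
    have "bij_betw unreal (realize m n ` W) W"
      unfolding unreal_def by (rule bij_betw_inv_into) (use inj in \<open>simp add: bij_betw_def\<close>)
    then show "bij_betw (\<theta> \<circ> unreal) (carrier (perm_subgroup {1..m * n} (realize m n ` W))) (carrier (alt_wreath_alt m n))"
      using bij bij_betw_trans by auto
  qed
  then show ?thesis by (auto simp: is_iso_def W_def)
qed

lemma iso_alt_group_subgroup_generators:
  assumes n: "n \<ge> 2" and S: "subgroup S (perm_group {1..n})" "perm_subgroup {1..n} S \<cong> alt_group n"
    and fg: "f \<in> S" "g \<in> S" "f ^^ k = id" "g ^^ l = id" "k > 0" "l > 0"
    and gen: "\<And>M h. subgrp M \<Longrightarrow> Perm f \<in> M \<Longrightarrow> Perm g \<in> M \<Longrightarrow> h \<in> S \<Longrightarrow> Perm h \<in> M"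
  shows "mgen {Perm f, Perm g} = alt_perms {1..n}"
proof
  have alt: "Perm ` S = alt_perms {1..n}" by (rule iso_alt_group_imp_alternating[OF n S])
  have perm: "h permutes {1..n}" if "h \<in> S" for h
    using subgroup.subset[OF S(1)] that by (auto simp: perm_group_simps)
  show "mgen {Perm f, Perm g} \<subseteq> alt_perms {1..n}"
    using alt fg alt_perms_closed(1,2) by (intro mgen_subset) blast+
  have "Perm h ^ k = 1" if "h \<in> S" "h ^^ k = id" for h k
    by (rule apply_eq_imp_eq) (simp add: apply_power Perm_apply[OF perm[OF that(1)]] that(2))
  then have "subgrp (mgen {Perm f, Perm g})"
    using fg by (intro subgrp_mgen) blast
  then have "Perm h \<in> mgen {Perm f, Perm g}" if "h \<in> S" for h
    by (rule gen[OF _ _ _ that]) (simp_all add: mgen_generator)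
  then show "alt_perms {1..n} \<subseteq> mgen {Perm f, Perm g}"
    unfolding alt[symmetric] by (rule image_subsetI)
qed

lemma generate_perm_group_in:
  assumes X: "finite X" and M: "subgrp M" and f: "\<And>f. f \<in> A \<Longrightarrow> f permutes X \<and> Perm f \<in> M"
    and h: "h \<in> generate (perm_group X) A"
  shows "h permutes X \<and> Perm h \<in> M"
  using h
proof induction
  case one
  have "Perm id = (1 :: 'a perm)" by (rule apply_eq_imp_eq) (simp add: Perm_apply[OF permutes_id X])
  then show ?case using subgrpD(1)[OF M] by (simp only: perm_group_simps permutes_id simp_thms)
next
  case (incl f)
  then show ?case by (rule f)
next
  case (inv g)
  then have g: "g permutes X" "Perm g \<in> M" using f by blast+
  have "Perm (inv' g) = inverse (Perm g)"
    by (rule apply_eq_imp_eq) (simp only: apply_inverse Perm_apply[OF g(1) X] Perm_apply[OF permutes_inv[OF g(1)] X])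
  then show ?case using g subgrpD(3)[OF M] permutes_inv by (simp add: perm_group_inv)
next
  case (eng g h)
  have "Perm (h \<circ> g) = Perm h * Perm g"
    using eng.IH by (intro apply_eq_imp_eq) (simp only: apply_times Perm_apply[OF _ X] permutes_compose)
  then show ?case using eng subgrpD(2)[OF M] by (simp only: perm_group_simps permutes_compose simp_thms)
qed

theorem theorem5p3:
  fixes p q r n m :: nat and t :: int and a b c d :: nat
    and \<pi> :: "tri_gen word set \<Rightarrow> nat \<Rightarrow> nat"
    and \<alpha> \<beta> :: "nat \<Rightarrow> nat" and \<alpha>s \<beta>s :: "nat list list"
  defines "G \<equiv> triangle_group p q r"
    and "x \<equiv> tri_x p q r"
    and "y \<equiv> tri_y p q r"
  assumes p: "prime p" and pqr: "p \<le> q" "q \<le> r"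
    and n: "n > 6"
    and rep: "\<pi> \<in> hom G (perm_group {1..n})"
    and trans: "transitive_on {1..n} (\<pi> ` carrier G)"
    and alt: "perm_subgroup {1..n} (\<pi> ` carrier G) \<cong> alt_group n"
    and handle_ab: "t_handle {1..n} (\<pi> x) (\<pi> y) t a b"
    and handle_cd: "t_handle {1..n} (\<pi> x) (\<pi> y) t c d"
    and disj: "{a, b} \<inter> {c, d} = {}"
    and unlink: "unlinked (\<pi> x \<otimes>\<^bsub>perm_group {1..n}\<^esub> \<pi> y) a b c d"
    and m: "m \<ge> 5" "m \<noteq> n - 1"
    and \<alpha>: "disjoint_p_cycles p {1..m} \<alpha>s \<alpha>"
    and \<beta>: "disjoint_p_cycles p {1..m} \<beta>s \<beta>"
    and trans_m: "transitive_on {1..m} (generate (perm_group {1..m}) {\<alpha>, \<beta>})"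
    and alt_m: "perm_subgroup {1..m} (generate (perm_group {1..m}) {\<alpha>, \<beta>}) \<cong> alt_group m"
  defines "is_\<phi> \<equiv> (\<lambda>\<phi>. \<phi> \<in> hom G (perm_group {1..m * n}) \<and>
      \<phi> x = perm_prod (all_copies m n (\<pi> x) @ map (handle_join n a b) \<alpha>s
                          @ map (handle_join n c d) \<beta>s) \<and>
      \<phi> y = perm_prod (all_copies m n (\<pi> y)))"
  shows "(\<exists>\<phi>. is_\<phi> \<phi>) \<and>
    (\<forall>\<phi>. is_\<phi> \<phi> \<longrightarrow> perm_subgroup {1..m * n} (\<phi> ` carrier G) \<cong> alt_wreath_alt m n)"
proof -
  define R where "R = triangle_relators p q r"
  have Gx: "G = presented_group R" "x = pres_gen R Gen_x" "y = pres_gen R Gen_y"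
    by (simp_all add: G_def x_def y_def triangle_group_def tri_x_def tri_y_def R_def)
  have relators: "R = {replicate p (Gen_x, True), replicate q (Gen_y, True),
      concat (replicate r [(Gen_x, True), (Gen_y, True)])}"
    by (simp add: R_def triangle_relators_def)
  have pos: "p > 0" "q > 0" "r > 0" using prime_gt_0_nat[OF p] pqr by auto
  interpret Pn: group "perm_group {1..n}" by (rule group_perm_group)
  interpret Pm: group "perm_group {1..m}" by (rule group_perm_group)
  interpret PN: group "perm_group {1..m * n}" by (rule group_perm_group)
  interpret \<pi>: group_hom G "perm_group {1..n}" \<pi>
    using rep unfolding Gx(1) by (intro group_hom.intro group_hom_axioms.intro group_presented_group group_perm_group)
  define \<gamma> where "\<gamma> s = \<pi> (pres_gen R s)" for s
  have \<gamma>_eq: "(\<lambda>s. \<pi> (pres_gen R s)) = \<gamma>" by (simp add: \<gamma>_def fun_eq_iff)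
  have \<gamma>xy: "\<gamma> Gen_x = \<pi> x" "\<gamma> Gen_y = \<pi> y" by (simp_all add: \<gamma>_def Gx)
  have \<gamma>c: "\<gamma> s \<in> carrier (perm_group {1..n})" for s
    unfolding \<gamma>_def by (rule \<pi>.hom_closed) (simp only: Gx(1) pres_gen_closed)
  then have \<gamma>p: "\<gamma> s permutes {1..n}" for s by (simp add: perm_group_simps)
  then have xyp: "\<pi> x permutes {1..n}" "\<pi> y permutes {1..n}" using \<gamma>xy by metis+
  have rel: "eval_word (perm_group {1..n}) \<gamma> w = id" if "w \<in> R" for w
    using hom_presented_group_relator[OF group_perm_group rep[unfolded Gx(1)] that]
    by (simp only: \<gamma>_eq perm_group_simps)
  have xyz: "\<pi> x ^^ p = id" "\<pi> y ^^ q = id" "(\<pi> y \<circ> \<pi> x) ^^ r = id"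
    using rel[of "replicate p (Gen_x, True)"] rel[of "replicate q (Gen_y, True)"]
      rel[of "concat (replicate r [(Gen_x, True), (Gen_y, True)])"]
    by (simp_all add: relators Pn.eval_word_relators[OF \<gamma>c] \<gamma>xy perm_group_pow perm_group_simps(2))
  define px py where "px = Perm (\<pi> x)" and "py = Perm (\<pi> y)"
  have ap: "apply px = \<pi> x" "apply py = \<pi> y" by (simp_all add: px_def py_def Perm_apply[OF xyp(1)] Perm_apply[OF xyp(2)])
  have pp: "px ^ p = 1" "py ^ q = 1" "(py * px) ^ r = 1"
    by (rule apply_eq_imp_eq; simp add: apply_power apply_times ap xyz)+
  have sub\<pi>: "subgroup (\<pi> ` carrier G) (perm_group {1..n})" by (rule \<pi>.img_is_subgroup)
  have xyG: "x \<in> carrier G" "y \<in> carrier G" using pres_gen_closed by (simp_all add: Gx)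
  have top_gen: "mgen {px, py} = alt_perms {1..n}"
    unfolding px_def py_def
  proof (rule iso_alt_group_subgroup_generators[OF _ sub\<pi> alt _ _ xyz(1,2) pos(1,2)])
    fix M h assume M: "subgrp M" "Perm (\<pi> x) \<in> M" "Perm (\<pi> y) \<in> M" and "h \<in> \<pi> ` carrier G"
    then obtain w where "h = \<pi> (pres_rel R `` {w})" by (auto simp: Gx presented_group_carrier)
    then have h: "h = eval_word (perm_group {1..n}) \<gamma> w"
      using hom_presented_group_eval[OF group_perm_group rep[unfolded Gx(1)]] by (simp only: \<gamma>_eq)
    have "Perm (\<gamma> s) \<in> M" for s using M \<gamma>xy by (cases s) simp_all
    then show "Perm h \<in> M" unfolding h
      using eval_word_perm_group[of "{1..n}" M \<gamma> w, OF finite_atLeastAtMost M(1) \<gamma>p] by blast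
  qed (use n xyG in auto)
  have \<alpha>\<beta>p: "\<alpha> permutes {1..m}" "\<beta> permutes {1..m}"
    using disjoint_p_cycles_permutes \<alpha> \<beta> by blast+
  define f\<alpha> f\<beta> where "f\<alpha> = Perm \<alpha>" and "f\<beta> = Perm \<beta>"
  have \<alpha>\<beta>1: "f\<alpha> ^ p = 1" "f\<beta> ^ p = 1"
    by (rule apply_eq_imp_eq; simp add: apply_power f\<alpha>_def f\<beta>_def Perm_apply[OF \<alpha>\<beta>p(1)] Perm_apply[OF \<alpha>\<beta>p(2)]
      disjoint_p_cycles_power[OF \<alpha>] disjoint_p_cycles_power[OF \<beta>])+
  have fib_gen: "mgen {f\<alpha>, f\<beta>} = alt_perms {1..m}"
    unfolding f\<alpha>_def f\<beta>_def
  proof (rule iso_alt_group_subgroup_generators[OF _ _ alt_m _ _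
        disjoint_p_cycles_power[OF \<alpha>] disjoint_p_cycles_power[OF \<beta>] pos(1,1)])
    show "subgroup (generate (perm_group {1..m}) {\<alpha>, \<beta>}) (perm_group {1..m})"
      using \<alpha>\<beta>p by (intro Pm.generate_is_subgroup) (simp add: perm_group_simps)
    fix M h assume M: "subgrp M" "Perm \<alpha> \<in> M" "Perm \<beta> \<in> M" and h: "h \<in> generate (perm_group {1..m}) {\<alpha>, \<beta>}"
    show "Perm h \<in> M"
      using generate_perm_group_in[OF _ M(1) _ h] M \<alpha>\<beta>p by blast
  qed (use m in \<open>auto intro: generate.incl\<close>)
  define z where "z = \<pi> y \<circ> \<pi> x"
  have zc: "z \<in> carrier (perm_group {1..n})" using xyp by (simp add: z_def perm_group_simps permutes_compose)
  \<comment> \<open>Exponents of \<open>z\<close> matter modulo \<open>r\<close> only, and may be taken nonnegative.\<close>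
  define t' where "t' = nat (t mod int r)"
  have zt: "z [^]\<^bsub>perm_group {1..n}\<^esub> t = z ^^ t'"
  proof -
    have zr: "z [^]\<^bsub>perm_group {1..n}\<^esub> (int r) = \<one>\<^bsub>perm_group {1..n}\<^esub>"
      using xyz(3) by (simp add: int_pow_int perm_group_pow z_def perm_group_simps)
    have "z [^]\<^bsub>perm_group {1..n}\<^esub> t = z [^]\<^bsub>perm_group {1..n}\<^esub> (int r * (t div int r) + int t')"
      using pos(3) by (simp add: t'_def)
    also have "\<dots> = z [^]\<^bsub>perm_group {1..n}\<^esub> (int r * (t div int r)) \<otimes>\<^bsub>perm_group {1..n}\<^esub> z [^]\<^bsub>perm_group {1..n}\<^esub> (int t')"
      by (rule Pn.int_pow_mult[OF zc])
    also have "z [^]\<^bsub>perm_group {1..n}\<^esub> (int r * (t div int r)) = \<one>\<^bsub>perm_group {1..n}\<^esub>"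
      using Pn.int_pow_pow[OF zc, of "int r" "t div int r"] zr by simp
    finally show ?thesis by (simp add: int_pow_int perm_group_pow perm_group_simps)
  qed
  have ab: "a \<in> {1..n}" "b \<in> {1..n}" "a \<noteq> b" "\<pi> x a = a" "\<pi> x b = b" "(z ^^ t') a = b"
    and cd: "c \<in> {1..n}" "d \<in> {1..n}" "c \<noteq> d" "\<pi> x c = c" "\<pi> x d = d" "(z ^^ t') c = d"
    using handle_ab handle_cd unfolding t_handle_def perm_group_simps(2) z_def[symmetric] zt by blast+
  have dist: "distinct [a, b, c, d]" using disj ab(3) cd(3) by auto
  have pts: "{a, b, c, d} \<subseteq> {1..n}" using ab cd by blast
  have fixed: "\<pi> x e = e" if "e \<in> {a, b, c, d}" for e using that ab cd by blast
  define X where "X = Wr (handle_label a b c d f\<alpha> f\<beta>) px"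
  define Y :: "(nat, nat perm) wr" where "Y = Wr (\<lambda>_. 1) py"
  have apz: "apply (py * px) = z" by (simp add: apply_times ap z_def)
  have hp: "handle_pair {1..n} px py a b c d t' f\<alpha> f\<beta> X Y"
  proof
    show "affected px \<subseteq> {1..n}" "affected py \<subseteq> {1..n}"
      unfolding px_def py_def using affected_Perm xyp by blast+
    show "((py * px) ^ t') $ a = b" "((py * px) ^ t') $ c = d"
      using ab cd by (simp_all add: apply_power apz)
    show "unlinked (apply (py * px)) a b c d"
      using unlink by (simp add: apz z_def perm_group_simps(2))
  qed (use dist pts fixed in \<open>auto simp: ap X_def Y_def\<close>)
  then interpret hp: handle_pair "{1..n}" px py a b c d t' f\<alpha> f\<beta> X Y .
  have wreath: "mgen {X, Y} = alt_wreath m n"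
    by (rule handles_generate_wreath_product[OF n m p hp pp(1,2) pos(2) pp(3) pos(3) top_gen \<alpha>\<beta>1 fib_gen])
  have XYW: "X \<in> alt_wreath m n" "Y \<in> alt_wreath m n"
    using mgen_generator[of X "{X, Y}"] mgen_generator[of Y "{X, Y}"] wreath by auto
  have XY1: "X ^ p = 1" "Y ^ q = 1" "(Y * X) ^ r = 1"
    using hp.X_power_eq_1[OF pp(1) \<alpha>\<beta>1] hp.Y_power_eq_1[OF pp(2)] hp.z_power_eq_1[OF pp(3)] by blast+
  have realX: "perm_prod (all_copies m n (\<pi> x) @ map (handle_join n a b) \<alpha>s @ map (handle_join n c d) \<beta>s)
      = realize m n X"
    unfolding X_def px_def f\<alpha>_def f\<beta>_def by (rule realize_handles[OF xyp(1) \<alpha> \<beta> dist pts fixed])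
  have realY: "perm_prod (all_copies m n (\<pi> y)) = realize m n Y"
    unfolding Y_def py_def by (rule realize_copies[OF xyp(2)])
  define \<delta> where "\<delta> s = realize m n (case s of Gen_x \<Rightarrow> X | Gen_y \<Rightarrow> Y)" for s
  have \<delta>c: "\<delta> s \<in> carrier (perm_group {1..m * n})" for s
    using XYW realize_permutes by (cases s) (simp_all add: \<delta>_def perm_group_simps)
  have power_W: "realize m n h ^^ k = realize m n (h ^ k) \<and> h ^ k \<in> alt_wreath m n" if "h \<in> alt_wreath m n" for h k
  proof (induction k)
    case (Suc k)
    then show ?case using realize_mult[of "h ^ k" m n h] that subgrpD(2)[OF subgrp_alt_wreath] by simp
  qed (simp add: realize_1 subgrpD(1)[OF subgrp_alt_wreath])
  have "eval_word (perm_group {1..m * n}) \<delta> w = \<one>\<^bsub>perm_group {1..m * n}\<^esub>" if "w \<in> R" for w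
  proof -
    have "realize m n Y \<circ> realize m n X = realize m n (Y * X)" using realize_mult[OF XYW(1)] by simp
    moreover have "Y * X \<in> alt_wreath m n" using XYW subgrpD(2)[OF subgrp_alt_wreath] by blast
    ultimately show ?thesis
      using that power_W XYW XY1
      by (auto simp: relators PN.eval_word_relators[OF \<delta>c] perm_group_pow perm_group_simps(2,3) \<delta>_def realize_1)
  qed
  then obtain \<phi>0 where \<phi>0: "\<phi>0 \<in> hom G (perm_group {1..m * n})" "\<And>s. \<phi>0 (pres_gen R s) = \<delta> s"
    using presented_group_hom_exists[of "perm_group {1..m * n}" \<delta> R, OF group_perm_group \<delta>c] unfolding Gx(1) by blast
  have ex: "is_\<phi> \<phi>0"
    using \<phi>0 unfolding is_\<phi>_def realX realY by (simp add: Gx(2,3) \<delta>_def)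
  have "perm_subgroup {1..m * n} (\<phi> ` carrier G) \<cong> alt_wreath_alt m n" if \<phi>: "is_\<phi> \<phi>" for \<phi>
  proof -
    have \<phi>h: "\<phi> \<in> hom G (perm_group {1..m * n})" and \<phi>xy: "\<phi> x = realize m n X" "\<phi> y = realize m n Y"
      using \<phi> unfolding is_\<phi>_def realX realY by blast+
    have \<phi>\<delta>: "(\<lambda>s. \<phi> (pres_gen R s)) = \<delta>"
    proof
      show "\<phi> (pres_gen R s) = \<delta> s" for s using \<phi>xy by (cases s) (simp_all add: \<delta>_def Gx)
    qed
    have "\<phi> ` carrier G = realize m n ` alt_wreath m n"
    proof (intro equalityI subsetI)
      fix f assume "f \<in> \<phi> ` carrier G"
      then obtain w where "f = \<phi> (pres_rel R `` {w})" by (auto simp: Gx presented_group_carrier)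
      then have f: "f = eval_word (perm_group {1..m * n}) \<delta> w"
        using hom_presented_group_eval[OF group_perm_group \<phi>h[unfolded Gx(1)]] \<phi>\<delta> by simp
      have "eval_word (perm_group {1..m * n}) \<delta> w \<in> realize m n ` alt_wreath m n" for w
      proof (induction w)
        case Nil
        have "realize m n 1 \<in> realize m n ` alt_wreath m n" using subgrpD(1)[OF subgrp_alt_wreath] by blast
        then show ?case by (simp add: perm_group_simps realize_1 id_def)
      next
        case (Cons l w)
        obtain s e where l: "l = (s, e)" by force
        obtain h where h: "h \<in> alt_wreath m n" "eval_word (perm_group {1..m * n}) \<delta> w = realize m n h" using Cons by blast
        define k where "k = (case s of Gen_x \<Rightarrow> X | Gen_y \<Rightarrow> Y)"
        have k: "k \<in> alt_wreath m n" using XYW by (cases s) (simp_all add: k_def)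
        then have k': "inverse k \<in> alt_wreath m n" by (rule subgrpD(3)[OF subgrp_alt_wreath])
        have inv: "inv\<^bsub>perm_group {1..m * n}\<^esub> \<delta> s = realize m n (inverse k)"
        proof (rule PN.inv_equality[OF _ \<delta>c])
          show "realize m n (inverse k) \<otimes>\<^bsub>perm_group {1..m * n}\<^esub> \<delta> s = \<one>\<^bsub>perm_group {1..m * n}\<^esub>"
            using realize_mult[OF k', of k] by (simp add: perm_group_simps \<delta>_def k_def[symmetric] realize_1)
        qed (use realize_permutes[OF k'] in \<open>simp add: perm_group_simps\<close>)
        define g where "g = (if e then k else inverse k)"
        have g: "g \<in> alt_wreath m n" using k k' by (simp add: g_def)
        have "eval_word (perm_group {1..m * n}) \<delta> (l # w) = realize m n h \<circ> realize m n g"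
          using inv by (cases e) (simp_all add: l h(2) perm_group_simps(2) g_def \<delta>_def k_def)
        also have "\<dots> = realize m n (h * g)" using realize_mult[OF g] by simp
        finally show ?case using h(1) g subgrpD(2)[OF subgrp_alt_wreath] by blast
      qed
      then show "f \<in> realize m n ` alt_wreath m n" by (simp only: f)
    next
      interpret \<phi>: group_hom G "perm_group {1..m * n}" \<phi>
        using \<phi>h unfolding Gx(1) by (intro group_hom.intro group_hom_axioms.intro group_presented_group group_perm_group)
      fix f assume "f \<in> realize m n ` alt_wreath m n"
      then obtain h where h: "h \<in> mgen {X, Y}" "f = realize m n h" using wreath by blast
      have "realize m n h \<in> \<phi> ` carrier G" using h(1)
      proof induction
        case one
        have "\<phi> \<one>\<^bsub>G\<^esub> = realize m n 1" by (simp add: \<phi>.hom_one perm_group_simps realize_1)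
        then show ?case using \<pi>.G.one_closed by (metis imageI)
      next
        case (step s h)
        then obtain g where g: "g \<in> carrier G" "realize m n h = \<phi> g" by blast
        obtain k where k: "k \<in> carrier G" "realize m n s = \<phi> k" using step(1) \<phi>xy xyG by auto
        have "realize m n (s * h) = \<phi> (g \<otimes>\<^bsub>G\<^esub> k)"
          using realize_mult[of h m n s] step(2) wreath g k by (simp add: perm_group_simps(2))
        then show ?case using \<pi>.G.m_closed[OF g(1) k(1)] by blast
      qed
      then show "f \<in> \<phi> ` carrier G" by (simp add: h(2))
    qed
    then show ?thesis using alt_wreath_iso[of m n] m(1) by simp
  qed
  then show ?thesis using ex by blast
qed

end
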